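(* Let $n\ge2$, and let $q\in\Bbbk$ be a root of unity whose order $m\ge3$ is odd. Let $T$ and $I$ be as below and $R=T/I$. Then (1) $R$ has Krull dimension $n^2$; (2) $R$ is an integral domain; (3) the $\Bbbk$-algebra map $T\to Z(\mathcal{O}_q(M_n(\Bbbk)))$ given by $Z_{ij}\mapsto x_{ij}^m$, $Y_{tr}\mapsto D(t)^r\tau(D(n-t))^{m-r}$, $D\mapsto D_q$ induces an isomorphism $R\cong Z(\mathcal{O}_q(M_n(\Bbbk)))$.
   Context: $\Bbbk$ is an algebraically closed field of characteristic zero. $\mathcal{O}_q(M_n(\Bbbk))$ is generated by $x_{ij}$, $1\le i,j\le n$, with relations: for $i<k$, $j<l$: $x_{ij}x_{kl}=x_{kl}x_{ij}+(q-q^{-1})x_{il}x_{kj}$; for $i<k$: $x_{ij}x_{kj}=qx_{kj}x_{ij}$; for $j<l$: $x_{ij}x_{il}=qx_{il}x_{ij}$; for $i<k$, $l<j$: $x_{ij}x_{kl}=x_{kl}x_{ij}$. Quantum minors $D(I,J)=\sum_{\pi\in S_r}(-q)^{\ell(\pi)}x_{i_1j_{\pi(1)}}\cdots x_{i_rj_{\pi(r)}}$ for $I=\{i_1<\dots<i_r\}$, $J=\{j_1<\dots<j_r\}$, $\ell(\pi)$ the number of inversions; $D_q=D([n],[n])$; $D(t)=D(\{1,\dots,t\},\{n-t+1,\dots,n\})$; $\tau$ is the transpose automorphism $x_{ij}\mapsto x_{ji}$. $T=\Bbbk[Z_{ij},Y_{tr},D\mid 1\le i,j\le n,1\le t\le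 n-1,1\le r\le m-1]$ is a commutative polynomial ring and $I\subseteq T$ is the ideal generated by $D^m-\det(Z_{ij})$ and, for $1\le t\le n-1$, $1\le i,j\le m-1$: $Y_{ti}Y_{tj}-Y_{t,i+j}\det(B_{n-t})$ if $i+j<m$; $Y_{ti}Y_{tj}-\det(A_t)\det(B_{n-t})$ if $i+j=m$; $Y_{ti}Y_{tj}-Y_{t,i+j-m}\det(A_t)$ if $i+j>m$. Here $A_t=(Z_{ij})_{1\le i\le t,\ n-t+1\le j\le n}$, $B_t=(Z_{ij})_{n-t+1\le i\le n,\ 1\le j\le t}$, and $\det$ is the ordinary determinant. *)

theory Defs
  imports "HOL-Library.Poly_Mapping" "HOL-Library.Product_Lexorder"
          "HOL-Computational_Algebra.Polynomial" "HOL-Library.Extended_Nat"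
          "HOL-Combinatorics.Permutations"
begin

section \<open>Generic ideal notions relative to a carrier set S (a subring of an ambient ring type)\<close>

definition ideal_in :: "'a::ring_1 set \<Rightarrow> 'a set \<Rightarrow> bool" where
  "ideal_in S J \<longleftrightarrow> J \<subseteq> S \<and> 0 \<in> J \<and> (\<forall>x\<in>J. \<forall>y\<in>J. x + y \<in> J)
     \<and> (\<forall>a\<in>S. \<forall>x\<in>J. a * x \<in> J \<and> x * a \<in> J)"

definition gen_ideal :: "'a::ring_1 set \<Rightarrow> 'a set \<Rightarrow> 'a set" where
  "gen_ideal S G = \<Inter>{J. ideal_in S J \<and> G \<subseteq> J}"

definition prime_in :: "'a::comm_ring_1 set \<Rightarrow> 'a set \<Rightarrow> bool" where
  "prime_in S P \<longleftrightarrow> ideal_in S P \<and> P \<noteq> S \<and>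
     (\<forall>a\<in>S. \<forall>b\<in>S. a * b \<in> P \<longrightarrow> a \<in> P \<or> b \<in> P)"

text \<open>Krull dimension of S/I: supremum of lengths l of strict chains
  P_0 < P_1 < ... < P_l of prime ideals of S containing I
  (these correspond to prime ideals of S/I).\<close>
definition krull_dim_quot :: "'a::comm_ring_1 set \<Rightarrow> 'a set \<Rightarrow> enat" where
  "krull_dim_quot S I = Sup {enat l | l. \<exists>C :: nat \<Rightarrow> 'a set.
       (\<forall>i\<le>l. prime_in S (C i) \<and> I \<subseteq> C i) \<and> (\<forall>i<l. C i \<subset> C (Suc i))}"

definition quot_is_domain :: "'a::comm_ring_1 set \<Rightarrow> 'a set \<Rightarrow> bool" where
  "quot_is_domain S I \<longleftrightarrow> (1::'a) \<notin> I \<and>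
     (\<forall>a\<in>S. \<forall>b\<in>S. a * b \<in> I \<longrightarrow> a \<in> I \<or> b \<in> I)"

definition alg_closed :: "'k::field itself \<Rightarrow> bool" where
  "alg_closed _ \<longleftrightarrow> (\<forall>p :: 'k poly. degree p > 0 \<longrightarrow> (\<exists>x. poly p x = 0))"

definition root_of_unity_order :: "'k::field \<Rightarrow> nat \<Rightarrow> bool" where
  "root_of_unity_order q m \<longleftrightarrow> m > 0 \<and> q ^ m = 1 \<and> (\<forall>k. 0 < k \<and> k < m \<longrightarrow> q ^ k \<noteq> 1)"

datatype 'a fword = FW "'a list"

instantiation fword :: (type) monoid_add
begin
fun plus_fword :: "'a fword \<Rightarrow> 'a fword \<Rightarrow> 'a fword" where
  "plus_fword (FW u) (FW v) = FW (u @ v)"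
definition zero_fword :: "'a fword" where "zero_fword = FW []"
instance
proof
  fix a b c :: "'a fword"
  show "a + b + c = a + (b + c)" by (cases a; cases b; cases c) simp
  show "0 + a = a" by (cases a) (simp add: zero_fword_def)
  show "a + 0 = a" by (cases a) (simp add: zero_fword_def)
qed
end

type_synonym 'k free_alg = "(nat \<times> nat) fword \<Rightarrow>\<^sub>0 'k"

definition fsc :: "'k::ring_1 \<Rightarrow> 'k free_alg" where
  "fsc c = Poly_Mapping.single (FW []) c"

definition X :: "nat \<Rightarrow> nat \<Rightarrow> 'k::ring_1 free_alg" where
  "X i j = Poly_Mapping.single (FW [(i, j)]) 1"

definition Fcar :: "nat \<Rightarrow> 'k::ring_1 free_alg set" where
  "Fcar n = {f. \<forall>w \<in> Poly_Mapping.keys f. \<forall>a. w = FW a \<longrightarrow> set a \<subseteq> {1..n} \<times> {1..n}}"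

definition qrels :: "nat \<Rightarrow> 'k::field \<Rightarrow> 'k free_alg set" where
  "qrels n q =
     {X i j * X k l - X k l * X i j - fsc (q - inverse q) * X i l * X k j
        | i j k l. i \<in> {1..n} \<and> j \<in> {1..n} \<and> k \<in> {1..n} \<and> l \<in> {1..n} \<and> i < k \<and> j < l}
   \<union> {X i j * X k j - fsc q * X k j * X i j
        | i j k. i \<in> {1..n} \<and> j \<in> {1..n} \<and> k \<in> {1..n} \<and> i < k}
   \<union> {X i j * X i l - fsc q * X i l * X i j
        | i j l. i \<in> {1..n} \<and> j \<in> {1..n} \<and> l \<in> {1..n} \<and> j < l}
   \<union> {X i j * X k l - X k l * X i j
        | i j k l. i \<in> {1..n} \<and> j \<in> {1..n} \<and> k \<in> {1..n} \<and> l \<in> {1..n} \<and> i < k \<and> l < j}"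

text \<open>O_q(M_n(k)) = Fcar n / Jq n q.\<close>
definition Jq :: "nat \<Rightarrow> 'k::field \<Rightarrow> 'k free_alg set" where
  "Jq n q = gen_ideal (Fcar n) (qrels n q)"

definition centre_reps :: "nat \<Rightarrow> 'k::field \<Rightarrow> 'k free_alg set" where
  "centre_reps n q = {f \<in> Fcar n. \<forall>g \<in> Fcar n. f * g - g * f \<in> Jq n q}"

definition inversions :: "nat \<Rightarrow> (nat \<Rightarrow> nat) \<Rightarrow> nat" where
  "inversions r \<pi> = card {(a, b). a < b \<and> b < r \<and> \<pi> a > \<pi> b}"

text \<open>Quantum minor D(I,J) for sorted index lists I = [i_1..i_r], J = [j_1..j_r]
  (permutations of {0..<r}, 0-based positions).\<close>
definition qminor :: "'k::field \<Rightarrow> nat list \<Rightarrow> nat list \<Rightarrow> 'k free_alg" where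
  "qminor q I J = (\<Sum>\<pi> \<in> {\<pi>. \<pi> permutes {0..<length I}}.
      fsc ((- q) ^ inversions (length I) \<pi>) *
      prod_list (map (\<lambda>a. X (I ! a) (J ! (\<pi> a))) [0..<length I]))"

text \<open>Transpose automorphism tau applied to D(I,J): x_ij replaced by x_ji.\<close>
definition qminor_tau :: "'k::field \<Rightarrow> nat list \<Rightarrow> nat list \<Rightarrow> 'k free_alg" where
  "qminor_tau q I J = (\<Sum>\<pi> \<in> {\<pi>. \<pi> permutes {0..<length I}}.
      fsc ((- q) ^ inversions (length I) \<pi>) *
      prod_list (map (\<lambda>a. X (J ! (\<pi> a)) (I ! a)) [0..<length I]))"

definition Dq :: "nat \<Rightarrow> 'k::field \<Rightarrow> 'k free_alg" where
  "Dq n q = qminor q [1..<n+1] [1..<n+1]"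

definition Dt :: "nat \<Rightarrow> 'k::field \<Rightarrow> nat \<Rightarrow> 'k free_alg" where
  "Dt n q t = qminor q [1..<t+1] [n-t+1..<n+1]"

definition tauDt :: "nat \<Rightarrow> 'k::field \<Rightarrow> nat \<Rightarrow> 'k free_alg" where
  "tauDt n q t = qminor_tau q [1..<t+1] [n-t+1..<n+1]"

type_synonym var = "nat \<times> nat \<times> nat"
type_synonym 'k cpoly = "(var \<Rightarrow>\<^sub>0 nat) \<Rightarrow>\<^sub>0 'k"

definition ZV :: "nat \<Rightarrow> nat \<Rightarrow> var" where "ZV i j = (0, i, j)"
definition YV :: "nat \<Rightarrow> nat \<Rightarrow> var" where "YV t r = (1, t, r)"
definition DV :: var where "DV = (2, 0, 0)"

definition Tvars :: "nat \<Rightarrow> nat \<Rightarrow> var set" where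
  "Tvars n m = {ZV i j | i j. i \<in> {1..n} \<and> j \<in> {1..n}}
             \<union> {YV t r | t r. t \<in> {1..n-1} \<and> r \<in> {1..m-1}} \<union> {DV}"

definition Var :: "var \<Rightarrow> 'k::comm_ring_1 cpoly" where
  "Var v = Poly_Mapping.single (Poly_Mapping.single v 1) 1"

definition Tcar :: "nat \<Rightarrow> nat \<Rightarrow> 'k::comm_ring_1 cpoly set" where
  "Tcar n m = {p. \<forall>\<mu> \<in> Poly_Mapping.keys p. Poly_Mapping.keys \<mu> \<subseteq> Tvars n m}"

definition detZ :: "nat list \<Rightarrow> nat list \<Rightarrow> 'k::comm_ring_1 cpoly" where
  "detZ rows cols = (\<Sum>\<pi> \<in> {\<pi>. \<pi> permutes {0..<length rows}}.
      of_int (sign \<pi>) * (\<Prod>a\<in>{0..<length rows}. Var (ZV (rows ! a) (cols ! (\<pi> a)))))"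

definition detA :: "nat \<Rightarrow> nat \<Rightarrow> 'k::comm_ring_1 cpoly" where
  "detA n t = detZ [1..<t+1] [n-t+1..<n+1]"

definition detB :: "nat \<Rightarrow> nat \<Rightarrow> 'k::comm_ring_1 cpoly" where
  "detB n t = detZ [n-t+1..<n+1] [1..<t+1]"

definition Igens :: "nat \<Rightarrow> nat \<Rightarrow> 'k::comm_ring_1 cpoly set" where
  "Igens n m =
     {Var DV ^ m - detZ [1..<n+1] [1..<n+1]}
   \<union> {Var (YV t i) * Var (YV t j) -
        (if i + j < m then Var (YV t (i + j)) * detB n (n - t)
         else if i + j = m then detA n t * detB n (n - t)
         else Var (YV t (i + j - m)) * detA n t)
      | t i j. t \<in> {1..n-1} \<and> i \<in> {1..m-1} \<and> j \<in> {1..m-1}}"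

definition Iideal :: "nat \<Rightarrow> nat \<Rightarrow> 'k::comm_ring_1 cpoly set" where
  "Iideal n m = gen_ideal (Tcar n m) (Igens n m)"

definition img :: "nat \<Rightarrow> nat \<Rightarrow> 'k::field \<Rightarrow> var \<Rightarrow> 'k free_alg" where
  "img n m q v = (case v of
      (0, i, j) \<Rightarrow> X i j ^ m
    | (Suc 0, t, r) \<Rightarrow> Dt n q t ^ r * tauDt n q (n - t) ^ (m - r)
    | _ \<Rightarrow> Dq n q)"

text \<open>Evaluation of a polynomial; monomials are multiplied out in a fixed
  (sorted) variable order. The images are central modulo Jq, so the order is
  immaterial in O_q(M_n(k)).\<close>
definition phi :: "nat \<Rightarrow> nat \<Rightarrow> 'k::field \<Rightarrow> 'k cpoly \<Rightarrow> 'k free_alg" where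
  "phi n m q p = (\<Sum>\<mu> \<in> Poly_Mapping.keys p.
      fsc (Poly_Mapping.lookup p \<mu>) *
      prod_list (map (\<lambda>v. img n m q v ^ Poly_Mapping.lookup \<mu> v)
                     (sorted_list_of_set (Poly_Mapping.keys \<mu>))))"

end

theory Submission
  imports Defs
begin

text \<open>Cauchon's path model embeds the quantum matrix algebra into the quantum torus with monomials \<open>T a\<close>, \<open>a\<close> an
  integer matrix: \<open>x i j\<close> becomes a sum over lattice paths, with leading term the variable at \<open>(i, j)\<close> for the
  lexicographic order. So sorted words have distinct leading terms, which gives the PBW basis, and the leading
  exponent of a central element is a nonnegative matrix in the radical modulo \<open>m\<close> of the commutation form. Modulo
  \<open>m\<close>, such a matrix is constant along diagonals, with opposite values on the two diagonals of lengths \<open>t\<close> and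
  \<open>n - t\<close> that carry \<open>D(t)\<close> and the transpose of \<open>D(n - t)\<close>.

  Minors that touch the border of the matrix are monomials in the torus, by a Gaussian elimination valid for
  every \<open>q\<close>. By the q-binomial theorem the powers \<open>x i j ^ m\<close> are the path sums in the \<open>m\<close>-th powers of the
  variables, so the same elimination with \<open>q = 1\<close> evaluates their determinants and proves the relations in \<open>I\<close>.
  The normal forms (a polynomial in the \<open>Z\<close>, times a power of \<open>D\<close> below \<open>m\<close>, times at most one \<open>Y\<close> for each
  \<open>t\<close>) have distinct leading exponents, and these exhaust the nonnegative part of the radical. Hence \<open>I\<close> is the
  kernel and the image is the centre.

  The central part of the torus is a Laurent polynomial ring, so \<open>T/I\<close> is a domain. Any \<open>n^2 + 1\<close> elements of it
  are algebraically dependent, which bounds the length of a chain of primes; a chain of length \<open>n^2\<close> arises by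
  setting the variables to 1 one after the other, the largest first.\<close>

text \<open>Oddness of \<open>m\<close> enters in four places: \<open>q\<^sup>2\<close> still has
  order \<open>m\<close>, as the q-binomial theorem requires, because the two summands of a path sum
  commute up to \<open>q\<^sup>2\<close>; the exponent 0 + 1 + ... + (m - 1) produced by
  \<open>(x * g) ^ m\<close> is a multiple of \<open>m\<close>; \<open>q\<close> has a square root
  that is an \<open>m\<close>-th root of unity; and a factor 2 can be cancelled modulo
  \<open>m\<close> when the radical is computed.

  Two models are kept apart. Membership in \<open>Jq\<close> is tested by \<open>ev\<close> in the
  noncommutative torus, realised by operators so that it sits in an honest ring type; polynomials in
  \<open>T\<close> are evaluated by \<open>psi\<close> in a commutative Laurent ring. The bridge
  \<open>telt\<close> from the second to the first is linear and injective, but multiplicative only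
  on exponents in the radical, so the images of all generators must be shown to stay there. The
  identity of \<open>ev\<close> after \<open>phi\<close> with \<open>telt\<close> after
  \<open>psi\<close> then turns questions on \<open>phi\<close> modulo \<open>Jq\<close> into
  questions on \<open>psi\<close>.

  Leading exponents alone handle polynomials in the \<open>Z\<close>; different normal forms are
  separated by cosets of the lattice of multiples of \<open>m\<close>, which avoids comparing their
  leading terms.\<close>

abbreviation (input) "lookup \<equiv> Poly_Mapping.lookup"
abbreviation (input) "keys \<equiv> Poly_Mapping.keys"
abbreviation (input) "single \<equiv> Poly_Mapping.single"

section \<open>Algebras over a field\<close>

text \<open>The scalar action is an explicit operation because the same lemmas serve two rings:
  linear operators, which contain the quantum torus, and commutative Laurent polynomials.\<close>

locale kalg =
  fixes sc :: "'k::field \<Rightarrow> 'r::ring_1 \<Rightarrow> 'r"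
  assumes sc_add: "sc c (x + y) = sc c x + sc c y"
    and sc_add_left: "sc (c + d) x = sc c x + sc d x"
    and sc_sc [simp]: "sc c (sc d x) = sc (c * d) x"
    and sc_one [simp]: "sc 1 x = x"
    and sc_mult_left [simp]: "sc c x * y = sc c (x * y)"
    and sc_mult_right [simp]: "x * sc c y = sc c (x * y)"
begin

lemma sc_zero_right [simp]: "sc c 0 = 0"
  using sc_add[of c 0 0] by simp

lemma sc_zero_left [simp]: "sc 0 x = 0"
  using sc_add_left[of 0 0 x] by simp

lemma sc_minus: "sc c (- x) = - sc c x"
  using sc_add[of c x "- x"] by (simp add: eq_neg_iff_add_eq_0 add.commute)

lemma sc_minus_left: "sc (- c) x = - sc c x"
  using sc_add_left[of c "- c" x] by (simp add: eq_neg_iff_add_eq_0 add.commute)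

lemma sc_diff: "sc c (x - y) = sc c x - sc c y"
  using sc_add[of c x "- y"] by (simp add: sc_minus)

lemma sc_diff_left: "sc (c - d) x = sc c x - sc d x"
  using sc_add_left[of c "- d" x] by (simp add: sc_minus_left)

lemma sc_sum: "sc c (sum f A) = (\<Sum>a\<in>A. sc c (f a))"
  by (induction A rule: infinite_finite_induct) (auto simp: sc_add)

lemma sc_eq_zero_iff [simp]: "sc c x = 0 \<longleftrightarrow> c = 0 \<or> x = 0"
proof
  assume *: "sc c x = 0"
  show "c = 0 \<or> x = 0"
  proof (cases "c = 0")
    case False
    then have "x = sc (inverse c) (sc c x)" by simp
    then show ?thesis using * by simp
  qed simp
qed auto

text \<open>The linear extension of \<open>h\<close> from basis elements; \<open>ev\<close>,
  \<open>psi\<close>, \<open>telt\<close> and \<open>specialize\<close> are all of this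
  form.\<close>

definition lin :: "('e \<Rightarrow> 'r) \<Rightarrow> ('e \<Rightarrow>\<^sub>0 'k) \<Rightarrow> 'r" where
  "lin h f = (\<Sum>a\<in>keys f. sc (lookup f a) (h a))"

lemma lin_superset:
  assumes "finite A" "keys f \<subseteq> A"
  shows "lin h f = (\<Sum>a\<in>A. sc (lookup f a) (h a))"
  unfolding lin_def
  by (rule sum.mono_neutral_left) (use assms in \<open>auto simp: in_keys_iff\<close>)

lemma lin_zero [simp]: "lin h 0 = 0"
  by (simp add: lin_def)

lemma lin_add: "lin h (f + g) = lin h f + lin h g"
proof -
  let ?A = "keys f \<union> keys g"
  have "lin h (f + g) = (\<Sum>a\<in>?A. sc (lookup (f + g) a) (h a))"
    by (rule lin_superset[OF _ keys_add]) simp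
  moreover have "lin h f = (\<Sum>a\<in>?A. sc (lookup f a) (h a))"
    by (rule lin_superset) auto
  moreover have "lin h g = (\<Sum>a\<in>?A. sc (lookup g a) (h a))"
    by (rule lin_superset) auto
  ultimately show ?thesis
    by (simp add: lookup_add sc_add_left sum.distrib)
qed

lemma lin_single [simp]: "lin h (single a c) = sc c (h a)"
  by (auto simp: lin_def)

lemma lin_sum: "lin h (sum F A) = (\<Sum>a\<in>A. lin h (F a))"
  by (induction A rule: infinite_finite_induct) (auto simp: lin_add)

lemma lin_uminus: "lin h (- f) = - lin h f"
  using lin_add[of h f "- f"] by (simp add: eq_neg_iff_add_eq_0 add.commute)

lemma lin_diff: "lin h (f - g) = lin h f - lin h g"
  using lin_add[of h f "- g"] by (simp add: lin_uminus)

end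

lemma poly_mapping_sum_single:
  "(\<Sum>a\<in>keys f. single a (lookup f a)) = f"
proof (rule poly_mapping_eqI)
  fix k
  show "lookup (\<Sum>a\<in>keys f. single a (lookup f a)) k
      = lookup f k"
    by (auto simp: lookup_sum lookup_single when_def in_keys_iff)
qed

lemma poly_mapping_mult_sum:
  fixes f g :: "'m::monoid_add \<Rightarrow>\<^sub>0 'k::semiring_0"
  shows "f * g = (\<Sum>a\<in>keys f. \<Sum>b\<in>keys g.
    single (a + b) (lookup f a * lookup g b))"
proof -
  have "f * g = (\<Sum>a\<in>keys f. single a (lookup f a)) *
      (\<Sum>b\<in>keys g. single b (lookup g b))"
    by (simp add: poly_mapping_sum_single)
  then show ?thesis by (simp add: sum_product mult_single)
qed

context kalg
begin

text \<open>Multiplicativity of \<open>h\<close> is asked only on the two supports. This matters for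
  \<open>telt\<close>: torus monomials multiply without a scalar only when suitable exponents lie in
  the radical.\<close>

lemma lin_mult:
  fixes f g :: "'m::monoid_add \<Rightarrow>\<^sub>0 'k"
  assumes "\<And>a b. a \<in> keys f \<Longrightarrow> b \<in> keys g \<Longrightarrow> h (a + b) = h a * h b"
  shows "lin h (f * g) = lin h f * lin h g"
proof -
  have "lin h (f * g) = (\<Sum>a\<in>keys f. \<Sum>b\<in>keys g.
    sc (lookup f a * lookup g b) (h a * h b))"
    by (simp add: poly_mapping_mult_sum[of f g] lin_sum assms)
  also have "\<dots> = lin h f * lin h g"
    by (simp add: lin_def sum_product mult.commute)
  finally show ?thesis .
qed

end

section \<open>Commutation up to a power of q\<close>

locale qkalg = kalg sc for sc :: "'k::field \<Rightarrow> 'r::ring_1 \<Rightarrow> 'r" +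
  fixes q :: 'k
  assumes q_nonzero [simp]: "q \<noteq> 0"
begin

definition qc :: "int \<Rightarrow> 'r \<Rightarrow> 'r \<Rightarrow> bool" where
  "qc e x y \<longleftrightarrow> x * y = sc (q powi e) (y * x)"

lemma qc_zero_iff: "qc 0 x y \<longleftrightarrow> x * y = y * x"
  by (simp add: qc_def)

lemma qc_zero_left [simp]: "qc e 0 y"
  by (simp add: qc_def)

lemma qc_mult_left:
  assumes "qc e x y" "qc e' x' y" shows "qc (e + e') (x * x') y"
proof -
  have "x * x' * y = sc (q powi e') (x * y * x')"
    using assms(2) by (simp add: qc_def mult.assoc)
  also have "\<dots> = sc (q powi (e + e')) (y * x * x')"
    using assms(1) by (simp add: qc_def power_int_add mult.commute)
  finally show ?thesis by (simp add: qc_def mult.assoc)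
qed

lemma qc_mult_right:
  assumes "qc e x y" "qc e' x y'" shows "qc (e + e') x (y * y')"
proof -
  have "x * (y * y') = sc (q powi e) (y * (x * y'))"
    using assms(1) by (simp add: qc_def mult.assoc[symmetric])
  also have "\<dots> = sc (q powi (e + e')) (y * (y' * x))"
    using assms(2) by (simp add: qc_def power_int_add mult.commute)
  finally show ?thesis by (simp add: qc_def mult.assoc)
qed

lemma qc_sum_left: "(\<And>a. a \<in> A \<Longrightarrow> qc e (f a) y) \<Longrightarrow> qc e (sum f A) y"
  by (simp add: qc_def sum_distrib_left sum_distrib_right sc_sum)

lemma qc_sum_right: "(\<And>a. a \<in> A \<Longrightarrow> qc e x (f a)) \<Longrightarrow> qc e x (sum f A)"
  by (simp add: qc_def sum_distrib_left sum_distrib_right sc_sum)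

lemma qc_swap: "qc e x y \<Longrightarrow> qc (- e) y x"
  by (simp add: qc_def power_int_minus)

lemma qc_inverse_right:
  assumes "qc e x y" "y * y' = 1" "y' * y = 1" shows "qc (- e) x y'"
proof -
  have "y' * x = y' * (x * y) * y'" using assms(2) by (simp add: mult.assoc)
  also have "\<dots> = sc (q powi e) (x * y')"
    using assms(1,3) by (simp add: qc_def) (simp add: mult.assoc[symmetric])
  finally show ?thesis by (simp add: qc_def power_int_minus)
qed

lemma qc_inverse_left:
  assumes "qc e x y" "x * x' = 1" "x' * x = 1" shows "qc (- e) x' y"
  using qc_swap[OF qc_inverse_right[OF qc_swap[OF assms(1)] assms(2,3)]] by simp

lemma qc_power_left: "qc e x y \<Longrightarrow> qc (int n * e) (x ^ n) y"
proof (induction n)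
  case (Suc n)
  then show ?case using qc_mult_left[of e x y "int n * e" "x ^ n"]
    by (simp add: algebra_simps)
qed (simp add: qc_def)

lemma qc_power_right: "qc e x y \<Longrightarrow> qc (int n * e) x (y ^ n)"
  using qc_swap[OF qc_power_left[OF qc_swap]] by fastforce

end

section \<open>The binomial theorem at a root of unity\<close>

fun gauss_binom :: "'k::comm_ring_1 \<Rightarrow> nat \<Rightarrow> nat \<Rightarrow> 'k" where
  "gauss_binom z n 0 = 1"
| "gauss_binom z 0 (Suc k) = 0"
| "gauss_binom z (Suc n) (Suc k) = gauss_binom z n k + z ^ Suc k * gauss_binom z n (Suc k)"

lemma gauss_binom_eq_0: "n < k \<Longrightarrow> gauss_binom z n k = 0"
  by (induction z n k rule: gauss_binom.induct) auto

lemma gauss_binom_diag [simp]: "gauss_binom z n n = 1"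
  by (induction n) (auto simp: gauss_binom_eq_0)

text \<open>The absorption identity with denominators cleared, since \<open>z ^ Suc k - 1\<close>
  may vanish at a root of unity.\<close>

lemma gauss_binom_absorb:
  "k \<le> n \<Longrightarrow> (z ^ Suc k - 1) * gauss_binom z n (Suc k) = (z ^ (n - k) - 1) * gauss_binom z n k"
proof (induction n arbitrary: k)
  case (Suc n)
  show ?case
  proof (cases k)
    case 0
    have "(z - 1) * gauss_binom z n (Suc 0) = z ^ n - 1"
      using Suc.IH[of 0] by simp
    then show ?thesis using 0 by (simp add: algebra_simps)
  next
    case (Suc k')
    show ?thesis
    proof (cases "k = Suc n")
      case True
      then show ?thesis by (simp add: gauss_binom_eq_0)
    next
      case False
      then have kn: "k \<le> n" using Suc.prems by simp
      have a: "(z ^ Suc k - 1) * gauss_binom z n (Suc k) = (z ^ (n - k) - 1) * gauss_binom z n k"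
        using Suc.IH kn by blast
      have b: "(z ^ k - 1) * gauss_binom z n k = (z ^ (Suc n - k) - 1) * gauss_binom z n k'"
        using Suc.IH[of k'] kn Suc by simp
      have c: "z ^ Suc k * z ^ (n - k) = z ^ k * z ^ (Suc n - k)" "z ^ Suc k * z ^ (n - k) = z ^ Suc n"
        using kn by (simp_all flip: power_add power_Suc)
      have "(z ^ Suc k - 1) * gauss_binom z (Suc n) (Suc k)
          = (z ^ Suc k - 1) * gauss_binom z n k + z ^ Suc k * ((z ^ (n - k) - 1) * gauss_binom z n k)"
        using a by (simp add: algebra_simps)
      also have "\<dots> = (z ^ Suc n - 1) * gauss_binom z n k"
        using c(2) by (simp add: algebra_simps flip: power_add)
      also have "\<dots> = (z ^ (Suc n - k) - 1) * gauss_binom z n k' + z ^ k * (z ^ (Suc n - k) - 1) * gauss_binom z n k"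
        using c b by (simp add: algebra_simps)
      also have "\<dots> = (z ^ (Suc n - k) - 1) * gauss_binom z (Suc n) k"
        using Suc by (simp add: algebra_simps)
      finally show ?thesis .
    qed
  qed
qed simp

text \<open>By absorption, vanishing passes from \<open>k\<close> to \<open>Suc k\<close> as long as
  \<open>z ^ Suc k - 1\<close> is nonzero, that is, below the order of \<open>z\<close>. It starts
  at \<open>k = 1\<close> because of the factor \<open>z ^ m - 1\<close>.\<close>

lemma gauss_binom_root_of_unity:
  fixes z :: "'k::field"
  assumes "root_of_unity_order z m" "0 < k" "k < m"
  shows "gauss_binom z m k = 0"
  using assms(2,3)
proof (induction k)
  case (Suc k)
  have "(z ^ (m - k) - 1) * gauss_binom z m k = 0"
    using Suc assms(1) by (cases "k = 0") (auto simp: root_of_unity_order_def)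
  moreover have "z ^ Suc k - 1 \<noteq> 0"
    using Suc.prems assms(1) unfolding root_of_unity_order_def by fastforce
  moreover have "(z ^ Suc k - 1) * gauss_binom z m (Suc k) = (z ^ (m - k) - 1) * gauss_binom z m k"
    by (rule gauss_binom_absorb) (use Suc.prems in simp)
  ultimately show ?case by (metis mult_eq_0_iff)
qed simp

context kalg
begin

lemma gauss_binomial_theorem:
  assumes "x * y = sc z (y * x)"
  shows "(x + y) ^ n = (\<Sum>k\<le>n. sc (gauss_binom z n k) (y ^ (n - k) * x ^ k))"
proof (induction n)
  case (Suc n)
  have xy: "x ^ k * y = sc (z ^ k) (y * x ^ k)" for k
  proof (induction k)
    case (Suc k)
    have "x ^ Suc k * y = x * (x ^ k * y)" by (simp add: mult.assoc)
    also have "\<dots> = sc (z ^ k) (x * y * x ^ k)" by (simp add: Suc mult.assoc)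
    also have "\<dots> = sc (z ^ Suc k) (y * x ^ Suc k)" by (simp add: assms mult.assoc mult.commute)
    finally show ?case .
  qed simp
  have "(x + y) ^ Suc n = (\<Sum>k\<le>n. sc (gauss_binom z n k) (y ^ (n - k) * x ^ k)) * (x + y)"
    by (simp add: Suc power_Suc2 del: power_Suc)
  also have "\<dots> = (\<Sum>k\<le>n. sc (gauss_binom z n k) (y ^ (n - k) * x ^ Suc k))
      + (\<Sum>k\<le>n. sc (z ^ k * gauss_binom z n k) (y ^ (Suc n - k) * x ^ k))"
  proof -
    have "y ^ (n - k) * x ^ k * x = y ^ (n - k) * x ^ Suc k" for k
      by (simp only: power_Suc2 mult.assoc)
    moreover have "y ^ (n - k) * x ^ k * y = sc (z ^ k) (y ^ (Suc n - k) * x ^ k)" if "k \<le> n" for k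
    proof -
      have "y ^ (n - k) * x ^ k * y = sc (z ^ k) (y ^ (n - k) * y * x ^ k)"
        by (simp add: mult.assoc xy)
      then show ?thesis using that by (simp add: Suc_diff_le flip: power_Suc2 del: power_Suc)
    qed
    ultimately show ?thesis
      by (simp add: distrib_left sum.distrib sum_distrib_right mult.commute)
  qed
  also have "(\<Sum>k\<le>n. sc (z ^ k * gauss_binom z n k) (y ^ (Suc n - k) * x ^ k))
      = y ^ Suc n + (\<Sum>k\<le>n. sc (z ^ Suc k * gauss_binom z n (Suc k)) (y ^ (n - k) * x ^ Suc k))"
  proof -
    have "(\<Sum>k\<le>n. sc (z ^ k * gauss_binom z n k) (y ^ (Suc n - k) * x ^ k))
       = (\<Sum>k\<le>Suc n. sc (z ^ k * gauss_binom z n k) (y ^ (Suc n - k) * x ^ k))"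
      by (simp add: gauss_binom_eq_0)
    also have "\<dots> = y ^ Suc n + (\<Sum>k\<le>n. sc (z ^ Suc k * gauss_binom z n (Suc k)) (y ^ (n - k) * x ^ Suc k))"
      by (subst sum.atMost_Suc_shift) simp
    finally show ?thesis .
  qed
  also have "(\<Sum>k\<le>n. sc (gauss_binom z n k) (y ^ (n - k) * x ^ Suc k)) +
      (y ^ Suc n + (\<Sum>k\<le>n. sc (z ^ Suc k * gauss_binom z n (Suc k)) (y ^ (n - k) * x ^ Suc k)))
     = (\<Sum>k\<le>Suc n. sc (gauss_binom z (Suc n) k) (y ^ (Suc n - k) * x ^ k))"
    by (simp only: sum.atMost_Suc_shift gauss_binom.simps(1,3) sc_add_left sum.distrib diff_Suc_Suc
        diff_zero power_0 mult_1_right sc_one add.left_commute)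
  finally show ?case .
qed simp

text \<open>A Frobenius-type identity: only the two end terms of the q-binomial expansion
  survive.\<close>

lemma add_power_root_of_unity:
  assumes "x * y = sc z (y * x)" "root_of_unity_order z m"
  shows "(x + y) ^ m = x ^ m + y ^ m"
proof -
  have m: "m > 0" using assms(2) by (simp add: root_of_unity_order_def)
  have "(x + y) ^ m = (\<Sum>k\<le>m. sc (gauss_binom z m k) (y ^ (m - k) * x ^ k))"
    by (rule gauss_binomial_theorem[OF assms(1)])
  also have "\<dots> = (\<Sum>k\<in>{0, m}. sc (gauss_binom z m k) (y ^ (m - k) * x ^ k))"
    by (rule sum.mono_neutral_right) (auto simp: gauss_binom_root_of_unity[OF assms(2)])
  also have "\<dots> = x ^ m + y ^ m" using m by (simp add: add.commute)
  finally show ?thesis .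
qed

text \<open>Reordering costs \<open>d\<close> to the power 0 + 1 + ... + (m - 1), which for odd
  \<open>m\<close> is a multiple of \<open>m\<close>.\<close>

lemma mult_power_root_of_unity:
  assumes "g * x = sc d (x * g)" "d ^ m = 1" "odd m"
  shows "(x * g) ^ m = x ^ m * g ^ m"
proof -
  have gx: "g ^ k * x = sc (d ^ k) (x * g ^ k)" for k
  proof (induction k)
    case (Suc k)
    have "g ^ Suc k * x = g * (g ^ k * x)" by (simp add: mult.assoc)
    also have "\<dots> = sc (d ^ k) (g * x * g ^ k)" by (simp add: Suc mult.assoc)
    also have "\<dots> = sc (d ^ Suc k) (x * g ^ Suc k)" by (simp add: assms mult.assoc mult.commute)
    finally show ?case .
  qed simp
  have *: "(x * g) ^ n = sc (d ^ (\<Sum>i<n. i)) (x ^ n * g ^ n)" for n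
  proof (induction n)
    case (Suc n)
    have "(x * g) ^ Suc n = sc (d ^ (\<Sum>i<n. i)) (x ^ n * (g ^ n * x) * g)"
      by (simp only: power_Suc2 Suc sc_mult_left mult.assoc)
    also have "\<dots> = sc (d ^ (\<Sum>i<Suc n. i)) (x ^ Suc n * g ^ Suc n)"
      by (simp add: gx power_add mult.assoc del: power_Suc) (simp only: power_Suc2 mult.assoc)
    finally show ?case .
  qed simp
  have "(\<Sum>i<m. i) = m * ((m - 1) div 2)"
  proof -
    from assms(3) obtain h where h: "m = 2 * h + 1" by (auto elim: oddE)
    have "2 * (\<Sum>i<m. i) = m * (m - 1)" for m :: nat
      by (induction m) (auto simp: algebra_simps)
    from this[of m] h show ?thesis by simp
  qed
  then show ?thesis using *[of m] assms(2) by (simp add: power_mult)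
qed

end

section \<open>Quantum determinants of arrays\<close>

text \<open>The transposition reverses the order of no pair of positions except
  \<open>(a, Suc a)\<close>, so it carries the inversions of \<open>\<pi>\<close> bijectively to all
  those of the composite except this new one.\<close>

lemma inversions_transpose:
  assumes "Suc a < s" "\<pi> a < \<pi> (Suc a)"
  shows "inversions s (\<pi> \<circ> Transposition.transpose a (Suc a)) = Suc (inversions s \<pi>)"
proof -
  let ?\<tau> = "Transposition.transpose a (Suc a)"
  let ?Inv = "\<lambda>\<pi>. {(x, y). x < y \<and> y < s \<and> \<pi> x > (\<pi> y :: nat)}"
  have mono: "?\<tau> x < ?\<tau> y \<and> ?\<tau> y < s" if "x < y" "y < s" "(x, y) \<noteq> (a, Suc a)" for x y
    using that assms(1) by (auto simp: Transposition.transpose_def)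
  have eq: "?Inv (\<pi> \<circ> ?\<tau>) = insert (a, Suc a) (map_prod ?\<tau> ?\<tau> ` ?Inv \<pi>)" (is "?L = ?R")
  proof (intro equalityI subsetI)
    fix z assume z: "z \<in> ?L"
    obtain x y where xy: "z = (x, y)" by force
    show "z \<in> ?R"
    proof (cases "(x, y) = (a, Suc a)")
      case False
      then have "(?\<tau> x, ?\<tau> y) \<in> ?Inv \<pi>" using z xy mono[of x y] by auto
      then have "map_prod ?\<tau> ?\<tau> (?\<tau> x, ?\<tau> y) \<in> map_prod ?\<tau> ?\<tau> ` ?Inv \<pi>" by blast
      then show ?thesis using xy by simp
    qed (use xy in simp)
  next
    fix z assume "z \<in> ?R"
    then consider "z = (a, Suc a)" | x y where "(x, y) \<in> ?Inv \<pi>" "z = (?\<tau> x, ?\<tau> y)" by auto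
    then show "z \<in> ?L"
    proof cases
      case 2
      then have "(x, y) \<noteq> (a, Suc a)" using assms(2) by auto
      then show ?thesis using 2 mono[of x y] by auto
    qed (use assms in auto)
  qed
  have fin: "finite (?Inv \<pi>)"
    by (rule finite_subset[of _ "{..<s} \<times> {..<s}"]) auto
  have "(a, Suc a) \<notin> map_prod ?\<tau> ?\<tau> ` ?Inv \<pi>"
  proof
    assume "(a, Suc a) \<in> map_prod ?\<tau> ?\<tau> ` ?Inv \<pi>"
    then obtain x y where "x < y" "?\<tau> x = a" "?\<tau> y = Suc a" by auto
    then show False by (auto simp: Transposition.transpose_def split: if_splits)
  qed
  moreover have "inj_on (map_prod ?\<tau> ?\<tau>) (?Inv \<pi>)"
    by (rule inj_onI) (auto, (metis transpose_involutory)+)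
  ultimately show ?thesis
    unfolding inversions_def eq using fin by (simp add: card_image)
qed

lemma inversions_fix_last:
  assumes "\<pi> permutes {0..<s}"
  shows "inversions (Suc s) \<pi> = inversions s \<pi>"
proof -
  have "\<pi> a < s" if "a < s" for a
    using permutes_in_image[OF assms, of a] that by simp
  moreover have "\<pi> s = s" using assms by (simp add: permutes_def)
  ultimately have "{(a, b). a < b \<and> b < Suc s \<and> \<pi> a > \<pi> b} = {(a, b). a < b \<and> b < s \<and> \<pi> a > \<pi> b}"
    by (auto simp: less_Suc_eq) (metis less_asym)
  then show ?thesis by (simp add: inversions_def)
qed

lemma upt_split: "a < s \<Longrightarrow> [0..<s] = [0..<a] @ a # [Suc a..<s]"
  by (metis le_add_diff_inverse less_imp_le upt_add_eq_append upt_conv_Cons zero_le)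

lemma prod_list_upd:
  fixes z :: "nat \<Rightarrow> nat \<Rightarrow> 'r::monoid_mult"
  assumes "a < s"
  shows "prod_list (map (\<lambda>x. (z(a := w)) x (\<pi> x)) [0..<s])
    = prod_list (map (\<lambda>x. z x (\<pi> x)) [0..<a]) * w (\<pi> a) * prod_list (map (\<lambda>x. z x (\<pi> x)) [Suc a..<s])"
proof -
  have "map (\<lambda>x. (z(a := w)) x (\<pi> x)) [0..<a] = map (\<lambda>x. z x (\<pi> x)) [0..<a]"
    "map (\<lambda>x. (z(a := w)) x (\<pi> x)) [Suc a..<s] = map (\<lambda>x. z x (\<pi> x)) [Suc a..<s]"
    by auto
  then show ?thesis
    by (simp only: upt_split[OF assms] map_append list.map prod_list.append prod_list.Cons fun_upd_same mult.assoc)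
qed

context qkalg
begin

definition QD :: "nat \<Rightarrow> (nat \<Rightarrow> nat \<Rightarrow> 'r) \<Rightarrow> 'r" where
  "QD s z = (\<Sum>\<pi> | \<pi> permutes {0..<s}.
     sc ((- q) ^ inversions s \<pi>) (prod_list (map (\<lambda>a. z a (\<pi> a)) [0..<s])))"

lemma QD_cong:
  assumes "\<And>a b. a < s \<Longrightarrow> b < s \<Longrightarrow> z a b = w a b"
  shows "QD s z = QD s w"
  unfolding QD_def
proof (intro sum.cong refl arg_cong2[where f = sc] arg_cong[where f = prod_list] map_cong)
  fix \<pi> a assume "\<pi> \<in> {\<pi>. \<pi> permutes {0..<s}}" "a \<in> set [0..<s]"
  then show "z a (\<pi> a) = w a (\<pi> a)"
    using assms permutes_in_image[of \<pi> "{0..<s}" a] by simp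
qed

lemma QD_add:
  assumes "a < s"
  shows "QD s (z(a := \<lambda>b. f b + g b)) = QD s (z(a := f)) + QD s (z(a := g))"
  unfolding QD_def prod_list_upd[OF assms]
  by (simp add: sum.distrib[symmetric] distrib_left distrib_right sc_add)

lemma QD_mult_line:
  assumes "a < s" "\<And>a' b. a' < a \<Longrightarrow> b < s \<Longrightarrow> h * z a' b = z a' b * h"
  shows "QD s (z(a := \<lambda>b. h * w b)) = h * QD s (z(a := w))"
proof -
  have comm: "prod_list (map (\<lambda>x. z x (\<pi> x)) [0..<c]) * h = h * prod_list (map (\<lambda>x. z x (\<pi> x)) [0..<c])"
    if "c \<le> a" "\<pi> permutes {0..<s}" for c \<pi>
    using that(1)
  proof (induction c)
    case (Suc c)
    have "\<pi> c < s" using permutes_in_image[OF that(2), of c] Suc.prems assms(1) by simp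
    then have "z c (\<pi> c) * h = h * z c (\<pi> c)" using assms(2)[of c "\<pi> c"] Suc.prems by simp
    then show ?case using Suc by (simp add: mult.assoc) (simp add: mult.assoc[symmetric])
  qed simp
  show ?thesis
    unfolding QD_def prod_list_upd[OF assms(1)] sum_distrib_left sc_mult_right
    by (intro sum.cong refl arg_cong2[where f = sc])
       (use comm[of a] in \<open>simp add: mult.assoc[symmetric]\<close>)
qed

text \<open>Pair \<open>\<pi>\<close> with its composite with the adjacent transposition. The two
  products differ by exchanging two neighbouring entries of one line, which costs a factor
  \<open>q\<close>, and the additional inversion contributes \<open>- q\<close>; so they
  cancel.\<close>

lemma QD_equal_lines:
  assumes "Suc a < s" "\<And>b. b < s \<Longrightarrow> z (Suc a) b = z a b"
    and qc: "\<And>b b'. b < b' \<Longrightarrow> b' < s \<Longrightarrow> qc 1 (z a b) (z a b')"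
  shows "QD s z = 0"
proof -
  let ?\<tau> = "Transposition.transpose a (Suc a)"
  let ?P = "{\<pi>. \<pi> permutes {0..<s}}"
  let ?A = "{\<pi>\<in>?P. \<pi> a < \<pi> (Suc a)}" and ?B = "{\<pi>\<in>?P. \<not> \<pi> a < \<pi> (Suc a)}"
  let ?f = "\<lambda>\<pi>. sc ((- q) ^ inversions s \<pi>) (prod_list (map (\<lambda>x. z x (\<pi> x)) [0..<s]))"
  have fin: "finite ?P" by (simp add: finite_permutations)
  have split: "[0..<s] = [0..<a] @ a # Suc a # [Suc (Suc a)..<s]"
    using upt_split[of a s] upt_conv_Cons[of "Suc a" s] assms(1) by simp
  have \<tau>: "?\<tau> permutes {0..<s}"
    using assms(1) by (intro permutes_swap_id) auto
  have ne: "\<pi> a \<noteq> \<pi> (Suc a)" if "\<pi> permutes {0..<s}" for \<pi>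
    using injD[OF permutes_inj[OF that], of a "Suc a"] by auto
  have "sum ?f ?B = sum (\<lambda>\<pi>. ?f (\<pi> \<circ> ?\<tau>)) ?A"
    by (rule sum.reindex_bij_witness[of _ "\<lambda>\<pi>. \<pi> \<circ> ?\<tau>" "\<lambda>\<pi>. \<pi> \<circ> ?\<tau>"])
       (use ne in \<open>auto simp: comp_assoc intro!: permutes_compose[OF \<tau>] dest: order.strict_implies_not_eq\<close>,
        metis linorder_neqE_nat)
  moreover have "?f \<pi> + ?f (\<pi> \<circ> ?\<tau>) = 0" if "\<pi> \<in> ?A" for \<pi>
  proof -
    define P where "P = prod_list (map (\<lambda>x. z x (\<pi> x)) [0..<a])"
    define Q where "Q = prod_list (map (\<lambda>x. z x (\<pi> x)) [Suc (Suc a)..<s])"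
    have b: "\<pi> (Suc a) < s" "\<pi> a < s"
      using that permutes_in_image[of \<pi> "{0..<s}"] assms(1) by auto
    have maps: "map (\<lambda>x. z x ((\<pi> \<circ> ?\<tau>) x)) [0..<a] = map (\<lambda>x. z x (\<pi> x)) [0..<a]"
      "map (\<lambda>x. z x ((\<pi> \<circ> ?\<tau>) x)) [Suc (Suc a)..<s] = map (\<lambda>x. z x (\<pi> x)) [Suc (Suc a)..<s]"
      by (auto simp: Transposition.transpose_def)
    have p1: "prod_list (map (\<lambda>x. z x (\<pi> x)) [0..<s]) = P * (z a (\<pi> a) * z a (\<pi> (Suc a))) * Q"
      by (simp add: split P_def Q_def mult.assoc assms(2) b)
    have "prod_list (map (\<lambda>x. z x ((\<pi> \<circ> ?\<tau>) x)) [0..<s]) = P * (z a (\<pi> (Suc a)) * z a (\<pi> a)) * Q"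
      unfolding split map_append list.map maps prod_list.append prod_list.Cons P_def Q_def
      by (simp add: mult.assoc assms(2) b)
    moreover have "inversions s (\<pi> \<circ> ?\<tau>) = Suc (inversions s \<pi>)"
      by (rule inversions_transpose) (use that assms(1) in auto)
    moreover have "z a (\<pi> a) * z a (\<pi> (Suc a)) = sc q (z a (\<pi> (Suc a)) * z a (\<pi> a))"
      using qc[of "\<pi> a" "\<pi> (Suc a)"] that b by (simp add: qc_def)
    ultimately show ?thesis
      by (simp add: p1 sc_minus_left mult.commute)
  qed
  ultimately have "sum ?f ?A + sum ?f ?B = 0"
    by (simp add: sum.distrib[symmetric])
  moreover have "sum ?f ?P = sum ?f ?A + sum ?f ?B"
    by (subst sum.union_disjoint[symmetric]) (use fin in \<open>auto intro: sum.cong\<close>)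
  ultimately show ?thesis by (simp add: QD_def)
qed

text \<open>A permutation that moves \<open>s\<close> picks an entry of column \<open>s\<close> in
  an earlier line, which is 0.\<close>

lemma QD_triangular_last:
  assumes "\<And>a. a < s \<Longrightarrow> z a s = 0"
  shows "QD (Suc s) z = QD s z * z s s"
proof -
  let ?f = "\<lambda>\<pi>. sc ((- q) ^ inversions (Suc s) \<pi>) (prod_list (map (\<lambda>x. z x (\<pi> x)) [0..<Suc s]))"
  have "QD (Suc s) z = sum ?f {\<pi>. \<pi> permutes {0..<s}}"
    unfolding QD_def
  proof (rule sum.mono_neutral_right, simp add: finite_permutations)
    show "{\<pi>. \<pi> permutes {0..<s}} \<subseteq> {\<pi>. \<pi> permutes {0..<Suc s}}"
      by (auto intro: permutes_subset)
    show "\<forall>\<pi>\<in>{\<pi>. \<pi> permutes {0..<Suc s}} - {\<pi>. \<pi> permutes {0..<s}}. ?f \<pi> = 0"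
    proof
      fix \<pi> assume "\<pi> \<in> {\<pi>. \<pi> permutes {0..<Suc s}} - {\<pi>. \<pi> permutes {0..<s}}"
      then have 1: "\<pi> permutes {0..<Suc s}" and 2: "\<not> \<pi> permutes {0..<s}" by auto
      have "\<pi> s \<noteq> s"
      proof
        assume "\<pi> s = s"
        then have "\<pi> permutes {0..<s}"
          using permutes_superset[OF 1, of "{0..<s}"] by (auto simp: less_Suc_eq)
        then show False using 2 by simp
      qed
      obtain a where a: "a < Suc s" "\<pi> a = s"
        using permutes_image[OF 1] by (metis atLeastLessThan_iff imageE le0 lessI)
      then have "a < s" using \<open>\<pi> s \<noteq> s\<close> by (cases "a = s") auto
      then have "z a (\<pi> a) = 0" using assms a by simp
      then have "0 \<in> set (map (\<lambda>x. z x (\<pi> x)) [0..<Suc s])" using a(1) by (force simp del: upt_Suc)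
      moreover have "prod_list xs = 0" if "0 \<in> set xs" for xs :: "'r list"
        using that by (induction xs) auto
      ultimately have "prod_list (map (\<lambda>x. z x (\<pi> x)) [0..<Suc s]) = 0" by blast
      then show "?f \<pi> = 0" by (simp only: sc_zero_right)
    qed
  qed
  also have "\<dots> = QD s z * z s s"
    unfolding QD_def sum_distrib_right
    by (intro sum.cong refl) (auto simp: inversions_fix_last permutes_def[of _ "{0..<s}"])
  finally show ?thesis .
qed

lemma QD_1: "QD (Suc 0) z = z 0 0"
proof -
  have "QD 0 z = 1" by (simp add: QD_def inversions_def)
  then show ?thesis using QD_triangular_last[of 0 z] by simp
qed

text \<open>Gaussian elimination. The lines of \<open>z\<close> will be the rows for \<open>D(I,J)\<close> and the columns for its transpose;
  when line \<open>a\<close> is treated the lines before it are already reduced, so \<open>h a\<close> only has to move past those.\<close>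
lemma QD_eliminate:
  assumes u: "\<And>a b. Suc a < s \<Longrightarrow> b < s \<Longrightarrow> z a b = u a b + h a * z (Suc a) b"
    and last: "\<And>b. 0 < s \<Longrightarrow> b < s \<Longrightarrow> u (s - 1) b = z (s - 1) b"
    and comm: "\<And>a a' b. a' < a \<Longrightarrow> Suc a < s \<Longrightarrow> b < s \<Longrightarrow> h a * u a' b = u a' b * h a"
    and line: "\<And>a b b'. a < s \<Longrightarrow> b < b' \<Longrightarrow> b' < s \<Longrightarrow> qc 1 (z a b) (z a b')"
  shows "QD s z = QD s u"
proof -
  \<comment> \<open>The array with its first \<open>k\<close> lines reduced. Reducing line
    \<open>k\<close> changes the determinant by a multiple of one whose line \<open>k\<close>
    repeats the still unreduced line \<open>Suc k\<close>.\<close>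
  define w where "w k a = (if a < k then u a else z a)" for k a
  have "QD s (w k) = QD s z" if "Suc k \<le> s" for k
    using that
  proof (induction k)
    case (Suc k)
    then have k: "k < s" "Suc k < s" by auto
    have "QD s (w k) = QD s ((w k)(k := \<lambda>b. u k b + h k * z (Suc k) b))"
      by (rule QD_cong) (use u k in \<open>auto simp: w_def\<close>)
    also have "\<dots> = QD s ((w k)(k := u k)) + h k * QD s ((w k)(k := z (Suc k)))"
    proof -
      have "QD s ((w k)(k := \<lambda>b. h k * z (Suc k) b)) = h k * QD s ((w k)(k := z (Suc k)))"
        by (rule QD_mult_line) (use comm k in \<open>auto simp: w_def\<close>)
      then show ?thesis using QD_add[OF k(1)] by simp
    qed
    also have "(w k)(k := u k) = w (Suc k)"
      by (auto simp: w_def fun_eq_iff less_Suc_eq)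
    also have "QD s ((w k)(k := z (Suc k))) = 0"
      by (rule QD_equal_lines[of k]) (use k line in \<open>auto simp: w_def\<close>)
    finally show ?case using Suc by simp
  next
    case 0
    have "w 0 = z" by (simp add: w_def fun_eq_iff)
    then show ?case by simp
  qed
  from this[of "s - 1"] have "0 < s \<Longrightarrow> QD s (w (s - 1)) = QD s z" by simp
  moreover have "0 < s \<Longrightarrow> QD s (w (s - 1)) = QD s u"
  proof (rule QD_cong)
    fix a b assume "0 < s" "a < s" "b < s"
    then show "w (s - 1) a b = u a b"
      using last[of b] by (cases "a = s - 1") (auto simp: w_def)
  qed
  moreover have "s = 0 \<Longrightarrow> QD s z = QD s u" by (simp add: QD_def)
  ultimately show ?thesis by (cases "s = 0") auto
qed

section \<open>Quantum matrices\<close>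

definition qmat :: "nat set \<Rightarrow> nat set \<Rightarrow> (nat \<Rightarrow> nat \<Rightarrow> 'r) \<Rightarrow> bool" where
  "qmat I J x \<longleftrightarrow>
     (\<forall>i\<in>I. \<forall>j\<in>J. \<forall>l\<in>J. j < l \<longrightarrow> qc 1 (x i j) (x i l)) \<and>
     (\<forall>i\<in>I. \<forall>k\<in>I. \<forall>j\<in>J. i < k \<longrightarrow> qc 1 (x i j) (x k j)) \<and>
     (\<forall>i\<in>I. \<forall>k\<in>I. \<forall>j\<in>J. \<forall>l\<in>J. i < k \<longrightarrow> l < j \<longrightarrow> qc 0 (x i j) (x k l)) \<and>
     (\<forall>i\<in>I. \<forall>k\<in>I. \<forall>j\<in>J. \<forall>l\<in>J. i < k \<longrightarrow> j < l \<longrightarrow>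
        x i j * x k l = x k l * x i j + sc (q - inverse q) (x i l * x k j))"

lemma
  assumes "qmat I J x"
  shows qmat_row: "\<And>i j l. i \<in> I \<Longrightarrow> j \<in> J \<Longrightarrow> l \<in> J \<Longrightarrow> j < l \<Longrightarrow> qc 1 (x i j) (x i l)"
    and qmat_col: "\<And>i k j. i \<in> I \<Longrightarrow> k \<in> I \<Longrightarrow> j \<in> J \<Longrightarrow> i < k \<Longrightarrow> qc 1 (x i j) (x k j)"
    and qmat_anti: "\<And>i k j l. i \<in> I \<Longrightarrow> k \<in> I \<Longrightarrow> j \<in> J \<Longrightarrow> l \<in> J \<Longrightarrow> i < k \<Longrightarrow> l < j \<Longrightarrow> qc 0 (x i j) (x k l)"
    and qmat_cross: "\<And>i k j l. i \<in> I \<Longrightarrow> k \<in> I \<Longrightarrow> j \<in> J \<Longrightarrow> l \<in> J \<Longrightarrow> i < k \<Longrightarrow> j < l \<Longrightarrow>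
        x i j * x k l = x k l * x i j + sc (q - inverse q) (x i l * x k j)"
     apply (use assms[unfolded qmat_def, THEN conjunct1] in blast)
    apply (use assms[unfolded qmat_def, THEN conjunct2, THEN conjunct1] in blast)
   apply (use assms[unfolded qmat_def, THEN conjunct2, THEN conjunct2, THEN conjunct1] in blast)
  apply (use assms[unfolded qmat_def, THEN conjunct2, THEN conjunct2, THEN conjunct2] in blast)
  done

text \<open>A commutation rule in the form that rewriting can apply inside right-associated
  products.\<close>

lemma move_left: "x * y = sc c (y * x) \<Longrightarrow> x * (y * z) = sc c (y * (x * z))"
  by (metis mult.assoc sc_mult_left)

text \<open>Factor \<open>x i j\<close> as \<open>S i j * c j\<close> with partial sums \<open>S\<close> of terms \<open>v\<close> that satisfy homogeneous relations.\<close>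
lemma qmat_add_row:
  assumes y: "qmat I {1..s} y"
    and cc: "\<And>j l. 1 \<le> j \<Longrightarrow> j < l \<Longrightarrow> l \<le> s \<Longrightarrow> qc 1 (c j) (c l)"
    and ci: "\<And>j. c j * c' j = 1" "\<And>j. c' j * c j = 1"
    and yc: "\<And>i j l. i \<in> I \<Longrightarrow> j \<in> {1..s} \<Longrightarrow> l \<in> {1..s} \<Longrightarrow> qc (if l = j then 1 else 0) (y i j) (c l)"
  defines "x \<equiv> \<lambda>i j. \<Sum>l\<in>{j..s}. y i l * c' l * c j"
  shows "qmat I {1..s} x"
    and "\<And>i j. i \<in> I \<Longrightarrow> j \<in> {1..s} \<Longrightarrow> qc 1 (x i j) (c j)"
    and "\<And>i j l. i \<in> I \<Longrightarrow> j \<in> {1..s} \<Longrightarrow> l \<in> {1..s} \<Longrightarrow> l < j \<Longrightarrow> qc 0 (x i j) (c l)"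
    and "\<And>i j l. i \<in> I \<Longrightarrow> j \<in> {1..s} \<Longrightarrow> l \<in> {1..s} \<Longrightarrow> j < l \<Longrightarrow>
        x i j * c l = c l * x i j + sc (q - inverse q) (x i l * c j)"
proof -
  define v where "v i j = y i j * c' j" for i j
  define S where "S i j = (\<Sum>a\<in>{j..s}. v i a)" for i j
  \<comment> \<open>\<open>d i j l\<close> is the part of \<open>S i j\<close> before column
    \<open>l\<close>. Its rules with the tails \<open>S i l\<close> and with \<open>c l\<close> have
    coefficients independent of the summands, so all relations for \<open>x\<close> reduce to
    rewriting words in \<open>d\<close>, \<open>S\<close> and \<open>c\<close>.\<close>
  define d where "d i j l = (\<Sum>a\<in>{j..<l}. v i a)" for i j l
  have x: "x i j = S i j * c j" for i j
    by (simp add: x_def S_def v_def sum_distrib_right)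
  have Sd: "S i j = d i j l + S i l" if "j \<le> l" "l \<le> Suc s" for i j l
    unfolding S_def d_def using that
    by (subst sum.union_disjoint[symmetric]) (auto intro!: sum.cong)
  have cc': "qc (if j = l then 0 else if j < l then 1 else - 1) (c j) (c l)" if "j \<in> {1..s}" "l \<in> {1..s}" for j l
    using cc[of j l] qc_swap[OF cc[of l j]] that by (auto simp: qc_zero_iff)
  have icc: "qc (if j = l then 0 else if j < l then - 1 else 1) (c' j) (c l)" if "j \<in> {1..s}" "l \<in> {1..s}" for j l
    using qc_inverse_left[OF cc'[OF that] ci] by (auto split: if_splits)
  have icic: "qc (if j = l then 0 else if j < l then 1 else - 1) (c' j) (c' l)" if "j \<in> {1..s}" "l \<in> {1..s}" for j l
    using qc_inverse_right[OF icc[OF that] ci] by (auto split: if_splits)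
  have yic: "qc (if l = j then - 1 else 0) (y i j) (c' l)" if "i \<in> I" "j \<in> {1..s}" "l \<in> {1..s}" for i j l
    using qc_inverse_right[OF yc[OF that] ci] by (auto split: if_splits)
  have icy: "qc (if l = j then 1 else 0) (c' l) (y i j)" if "i \<in> I" "j \<in> {1..s}" "l \<in> {1..s}" for i j l
    using qc_swap[OF yic[OF that]] by (auto split: if_splits)
  have vv: "qc (e + e1 + (e2 + e3)) (v i j) (v k l)"
    if "qc e (y i j) (y k l)" "qc e1 (y i j) (c' l)" "qc e2 (c' j) (y k l)" "qc e3 (c' j) (c' l)" for i j k l e e1 e2 e3
    unfolding v_def using that by (intro qc_mult_left qc_mult_right)
  have v1: "qc 2 (v i j) (v i l)" if "i \<in> I" "j \<in> {1..s}" "l \<in> {1..s}" "j < l" for i j l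
    using vv[OF qmat_row[OF y, of i j l] yic[of i j l] icy[of i l j] icic[of j l]] that by simp
  have v2: "qc 1 (v i j) (v k j)" if "i \<in> I" "k \<in> I" "j \<in> {1..s}" "i < k" for i k j
    using vv[OF qmat_col[OF y, of i k j] yic[of i j j] icy[of k j j] icic[of j j]] that by simp
  have v4: "qc (- 1) (v i j) (v k l)" if "i \<in> I" "k \<in> I" "j \<in> {1..s}" "l \<in> {1..s}" "i < k" "l < j" for i k j l
    using vv[OF qmat_anti[OF y, of i k j l] yic[of i j l] icy[of k l j] icic[of j l]] that by simp
  \<comment> \<open>The cross relation of \<open>y\<close> after normalising by \<open>c'\<close>:
    reordering costs one factor \<open>q\<close>, which turns \<open>q - inverse q\<close> into
    \<open>q\<^sup>2 - 1\<close>.\<close>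
  have v3: "v i j * v k l = sc q (v k l * v i j) + sc (q\<^sup>2 - 1) (v i l * v k j)"
    if "i \<in> I" "k \<in> I" "j \<in> {1..s}" "l \<in> {1..s}" "i < k" "j < l" for i k j l
  proof -
    have c1: "c' j * y k l = sc 1 (y k l * c' j)" using icy[of k l j] that by (simp add: qc_def)
    have c2: "c' l * y i j = sc 1 (y i j * c' l)" using icy[of i j l] that by (simp add: qc_def)
    have c3: "c' l * y k j = sc 1 (y k j * c' l)" using icy[of k j l] that by (simp add: qc_def)
    have c4: "c' j * c' l = sc q (c' l * c' j)" using icic[of j l] that by (simp add: qc_def)
    have yy: "y i j * (y k l * z) = y k l * (y i j * z) + sc (q - inverse q) (y i l * (y k j * z))" for z
      using qmat_cross[OF y, of i k j l] that by (simp add: mult.assoc[symmetric] distrib_right)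
    have q: "(q - inverse q) * q = q\<^sup>2 - 1" by (simp add: field_simps power2_eq_square)
    show ?thesis
      by (simp add: v_def mult.assoc move_left[OF c1] move_left[OF c2] move_left[OF c3] c4 yy sc_add q
          mult.commute[of q] flip: q)
  qed
  have vc: "qc (if l \<le> j then 1 else - 1) (v i j) (c l)" if "i \<in> I" "j \<in> {1..s}" "l \<in> {1..s}" for i j l
    using qc_mult_left[OF yc[of i j l] icc[of j l]] that by (auto simp: v_def split: if_splits)
  have Sc: "qc 1 (S i j) (c l)" if "i \<in> I" "j \<in> {1..s}" "l \<in> {1..s}" "l \<le> j" for i j l
    unfolding S_def
  proof (rule qc_sum_left)
    fix a assume "a \<in> {j..s}"
    then show "qc 1 (v i a) (c l)" using vc[of i a l] that by auto
  qed
  have dc: "qc (- 1) (d i j l) (c l)" if "i \<in> I" "j \<in> {1..s}" "l \<in> {1..s}" for i j l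
    unfolding d_def
  proof (rule qc_sum_left)
    fix a assume "a \<in> {j..<l}"
    then show "qc (- 1) (v i a) (c l)" using vc[of i a l] that by auto
  qed
  have dS: "qc 2 (d i j l) (S i l)" if "i \<in> I" "j \<in> {1..s}" "l \<in> {1..s}" for i j l
    unfolding d_def S_def by (intro qc_sum_left qc_sum_right v1) (use that in auto)
  have Sd4: "qc (- 1) (S i l) (d k j l)" if "i \<in> I" "k \<in> I" "j \<in> {1..s}" "i < k" for i k j l
    unfolding d_def S_def by (intro qc_sum_left qc_sum_right v4) (use that in auto)
  have dS3: "d i j l * S k l = sc q (S k l * d i j l) + sc (q\<^sup>2 - 1) (S i l * d k j l)"
    if "i \<in> I" "k \<in> I" "j \<in> {1..s}" "i < k" for i k j l
  proof -
    have "d i j l * S k l = (\<Sum>a\<in>{j..<l}. \<Sum>b\<in>{l..s}. sc q (v k b * v i a) + sc (q\<^sup>2 - 1) (v i b * v k a))"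
      unfolding d_def S_def sum_product by (intro sum.cong refl v3) (use that in auto)
    also have "\<dots> = (\<Sum>b\<in>{l..s}. \<Sum>a\<in>{j..<l}. sc q (v k b * v i a)) + (\<Sum>b\<in>{l..s}. \<Sum>a\<in>{j..<l}. sc (q\<^sup>2 - 1) (v i b * v k a))"
      by (subst sum.swap) (simp add: sum.distrib)
    also have "\<dots> = sc q (S k l * d i j l) + sc (q\<^sup>2 - 1) (S i l * d k j l)"
      unfolding d_def S_def sum_product by (simp add: sc_sum)
    finally show ?thesis .
  qed
  \<comment> \<open>One column is split off at a time. With the abbreviations below, the extra term
    \<open>(q\<^sup>2 - 1) C B\<close> in \<open>A D\<close> completes \<open>C B\<close> to
    \<open>q\<^sup>2 C B\<close>, which is \<open>q B C\<close>.\<close>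
  have SS: "qc 1 (S i j) (S k j)" if "i \<in> I" "k \<in> I" "1 \<le> j" "j \<le> Suc s" "i < k" for i k j
    using that(4,3)
  proof (induction j rule: inc_induct)
    case base
    then show ?case by (simp add: S_def)
  next
    case (step j)
    have j: "j \<in> {1..s}" using step by auto
    let ?A = "v i j" and ?B = "v k j" and ?C = "S i (Suc j)" and ?D = "S k (Suc j)"
    have s: "S i j = ?A + ?C" "S k j = ?B + ?D"
      using Sd[of j "Suc j"] j by (auto simp: d_def)
    have 1: "?A * ?B = sc q (?B * ?A)" using v2[of i k j] that j by (simp add: qc_def)
    have 2: "?A * ?D = sc q (?D * ?A) + sc (q\<^sup>2 - 1) (?C * ?B)"
      using dS3[of i k j "Suc j"] that j by (simp add: d_def)
    have 3: "?B * ?C = sc q (?C * ?B)"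
      using qc_swap[OF Sd4[of i k j "Suc j"]] that j by (simp add: d_def qc_def)
    have 4: "?C * ?D = sc q (?D * ?C)" using step.IH by (simp add: qc_def)
    show ?case
      unfolding s qc_def
      by (simp add: distrib_left distrib_right 1 2 3 4 sc_add sc_diff_left power2_eq_square)
  qed
  have q2: "q powi 2 = q\<^sup>2" by (simp add: power_int_def)
  have row: "qc 1 (x i j) (x i l)" if "i \<in> I" "j \<in> {1..s}" "l \<in> {1..s}" "j < l" for i j l
  proof -
    have s: "S i j = d i j l + S i l" using Sd[of j l] that by auto
    have 1: "c j * S i l = sc (inverse q) (S i l * c j)"
      using qc_swap[OF Sc[of i l j]] that by (simp add: qc_def power_int_minus)
    have 2: "c l * d i j l = sc q (d i j l * c l)" using qc_swap[OF dc[of i j l]] that by (simp add: qc_def)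
    have 3: "c l * S i l = sc (inverse q) (S i l * c l)"
      using qc_swap[OF Sc[of i l l]] that by (simp add: qc_def power_int_minus)
    have 4: "c j * c l = sc q (c l * c j)" using cc[of j l] that by (simp add: qc_def)
    have 5: "d i j l * S i l = sc (q\<^sup>2) (S i l * d i j l)" using dS[of i j l] that by (simp add: qc_def q2)
    show ?thesis
      unfolding qc_def x s
      by (simp add: mult.assoc distrib_left distrib_right 4 sc_add move_left[OF 1] move_left[OF 2]
          move_left[OF 3] move_left[OF 5] power2_eq_square)
  qed
  have col: "qc 1 (x i j) (x k j)" if "i \<in> I" "k \<in> I" "j \<in> {1..s}" "i < k" for i k j
  proof -
    have "qc (1 + - 1) (S i j * c j) (S k j)"
      using SS[of i k j] qc_swap[OF Sc[of k j j]] that by (intro qc_mult_left) auto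
    moreover have "qc (1 + 0) (S i j * c j) (c j)"
      using Sc[of i j j] that by (intro qc_mult_left) (auto simp: qc_zero_iff)
    ultimately have "qc 1 (S i j * c j) (S k j * c j)" using qc_mult_right by fastforce
    then show ?thesis by (simp add: x)
  qed
  have anti: "qc 0 (x i l) (x k j)" "x i j * x k l = x k l * x i j + sc (q - inverse q) (x i l * x k j)"
    if "i \<in> I" "k \<in> I" "j \<in> {1..s}" "l \<in> {1..s}" "i < k" "j < l" for i k j l
  proof -
    have s: "S i j = d i j l + S i l" "S k j = d k j l + S k l" using Sd[of j l] that by auto
    have 1: "c j * S i' l = sc (inverse q) (S i' l * c j)" if "i' \<in> I" for i'
      using qc_swap[OF Sc[of i' l j]] that \<open>j \<in> _\<close> \<open>l \<in> _\<close> \<open>j < l\<close> by (simp add: qc_def power_int_minus)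
    have 2: "c l * d i' j l = sc q (d i' j l * c l)" if "i' \<in> I" for i'
      using qc_swap[OF dc[of i' j l]] that \<open>j \<in> _\<close> \<open>l \<in> _\<close> by (simp add: qc_def)
    have 3: "c l * S i' l = sc (inverse q) (S i' l * c l)" if "i' \<in> I" for i'
      using qc_swap[OF Sc[of i' l l]] that \<open>l \<in> _\<close> by (simp add: qc_def power_int_minus)
    have 4: "c j * c l = sc q (c l * c j)" using cc[of j l] that by (simp add: qc_def)
    have 5: "d i j l * (S k l * z) = sc q (S k l * (d i j l * z)) + sc (q\<^sup>2 - 1) (S i l * (d k j l * z))" for z
      using dS3[of i k j l] that by (simp add: mult.assoc[symmetric] distrib_right)
    have 6: "d k j l * S i l = sc q (S i l * d k j l)"
      using qc_swap[OF Sd4[of i k j l]] that by (simp add: qc_def)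
    have 7: "S k l * S i l = sc (inverse q) (S i l * S k l)"
      using qc_swap[OF SS[of i k l]] that by (simp add: qc_def power_int_minus)
    note rules = mult.assoc distrib_left distrib_right 4 sc_add move_left[OF 1] move_left[OF 2]
          move_left[OF 3] 5 move_left[OF 6] move_left[OF 7]
    show "qc 0 (x i l) (x k j)"
      unfolding qc_def x s using that by (simp add: rules)
    have e: "(q - inverse q) * q = q\<^sup>2 - 1" by (simp add: field_simps power2_eq_square)
    show "x i j * x k l = x k l * x i j + sc (q - inverse q) (x i l * x k j)"
      unfolding x s using that
      by (simp add: rules e mult.commute[of q]) (simp add: sc_diff_left left_diff_distrib)
  qed
  show "qmat I {1..s} x"
    unfolding qmat_def using row col anti by auto
  show "qc 1 (x i j) (c j)" if "i \<in> I" "j \<in> {1..s}" for i j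
    using qc_mult_left[OF Sc[of i j j], of 0 "c j"] that by (auto simp: x qc_zero_iff)
  show "qc 0 (x i j) (c l)" if "i \<in> I" "j \<in> {1..s}" "l \<in> {1..s}" "l < j" for i j l
    using qc_mult_left[OF Sc[of i j l] cc'[of j l]] that by (simp add: x)
  show "x i j * c l = c l * x i j + sc (q - inverse q) (x i l * c j)"
    if "i \<in> I" "j \<in> {1..s}" "l \<in> {1..s}" "j < l" for i j l
  proof -
    have s: "S i j = d i j l + S i l" using Sd[of j l] that by auto
    have 2: "c l * d i j l = sc q (d i j l * c l)" using qc_swap[OF dc[of i j l]] that by (simp add: qc_def)
    have 3: "c l * S i l = sc (inverse q) (S i l * c l)"
      using qc_swap[OF Sc[of i l l]] that by (simp add: qc_def power_int_minus)
    have 4: "c j * c l = sc q (c l * c j)" using cc[of j l] that by (simp add: qc_def)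
    show ?thesis
      unfolding x s
      by (simp add: mult.assoc distrib_left distrib_right 4 sc_add move_left[OF 2] move_left[OF 3])
        (simp add: sc_diff_left)
  qed
qed

end

section \<open>The path model\<close>

text \<open>The sum over lattice paths in the rows \<open>i..r\<close> and columns \<open>j..s\<close> that start in row \<open>i\<close>, move left
  and down and leave through the bottom of column \<open>j\<close>; a path contributes \<open>t\<close> at the vertices where it turns
  from left to down, and the inverse \<open>t'\<close> where it turns from down to left.\<close>
primrec px :: "(nat \<Rightarrow> nat \<Rightarrow> 'r) \<Rightarrow> (nat \<Rightarrow> nat \<Rightarrow> 'r) \<Rightarrow> nat \<Rightarrow> nat \<Rightarrow> nat \<Rightarrow> nat \<Rightarrow> 'r::ring_1" where
  "px t t' 0 s i j = 0"
| "px t t' (Suc r) s i j = (if i = Suc r then t (Suc r) j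
     else \<Sum>l\<in>{j..s}. px t t' r s i l * t' (Suc r) l * t (Suc r) j)"

locale grid = qkalg sc q for sc :: "'k::field \<Rightarrow> 'r::ring_1 \<Rightarrow> 'r" and q +
  fixes t t' :: "nat \<Rightarrow> nat \<Rightarrow> 'r"
  assumes t_inv [simp]: "t i j * t' i j = 1" "t' i j * t i j = 1"
    and t_qc: "qc ((if j = l then sgn (int k - int i) else 0) + (if i = k then sgn (int l - int j) else 0))
          (t i j) (t k l)"
begin

abbreviation "path \<equiv> px t t'"

lemma t'_t_qc: "qc (- ((if j = l then sgn (int k - int i) else 0) + (if i = k then sgn (int l - int j) else 0)))
    (t' i j) (t k l)"
  by (rule qc_inverse_left[OF t_qc t_inv])

lemma path_last_row: "1 \<le> r \<Longrightarrow> path r s r j = t r j"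
  by (cases r) auto

lemma path_last_col: "1 \<le> i \<Longrightarrow> i \<le> r \<Longrightarrow> path r s i s = t i s"
  by (induction r) (auto simp: le_Suc_eq mult.assoc)

text \<open>A path comes straight down column \<open>j\<close>, or it arrives along the last row
  from column \<open>Suc j\<close>; in the second case it extends a path that would have left
  through column \<open>Suc j\<close>.\<close>

lemma path_row_step:
  assumes "1 \<le> i" "i \<le> r" "j < s"
  shows "path (Suc r) s i j = path r s i j + path (Suc r) s i (Suc j) * (t' (Suc r) (Suc j) * t (Suc r) j)"
proof -
  have "{j..s} = insert j {Suc j..s}" using assms(3) by auto
  moreover have "path (Suc r) s i (Suc j) * (t' (Suc r) (Suc j) * t (Suc r) j)
      = (\<Sum>l\<in>{Suc j..s}. path r s i l * t' (Suc r) l * t (Suc r) j)"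
    using assms by (simp add: sum_distrib_right mult.assoc)
      (simp add: mult.assoc[symmetric] mult.assoc[of _ "t (Suc r) (Suc j)" "t' (Suc r) (Suc j)"])
  ultimately show ?thesis using assms by (simp add: mult.assoc)
qed

text \<open>Sort the paths by the row \<open>k\<close> in which they leave the last column. For
  \<open>k = i\<close> the two factors cancel: such a path does not turn there.\<close>

lemma path_col:
  assumes "1 \<le> i" "i \<le> r" "j \<le> s"
  shows "path r (Suc s) i j = (\<Sum>k\<in>{i..r}. t i (Suc s) * t' k (Suc s) * path r s k j)"
  using assms
proof (induction r arbitrary: j)
  case (Suc r)
  show ?case
  proof (cases "i = Suc r")
    case False
    then have i: "i \<le> r" using Suc.prems by simp
    have "path (Suc r) (Suc s) i j
      = (\<Sum>l\<in>{j..s}. path r (Suc s) i l * t' (Suc r) l * t (Suc r) j)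
        + t i (Suc s) * t' (Suc r) (Suc s) * t (Suc r) j"
      using False Suc.prems i path_last_col[of i r "Suc s"]
      by (simp add: sum.atLeast_Suc_atMost_Suc_shift sum.nat_ivl_Suc')
    also have "(\<Sum>l\<in>{j..s}. path r (Suc s) i l * t' (Suc r) l * t (Suc r) j)
      = (\<Sum>l\<in>{j..s}. \<Sum>k\<in>{i..r}. t i (Suc s) * t' k (Suc s) * (path r s k l * t' (Suc r) l * t (Suc r) j))"
      using Suc.IH Suc.prems i by (intro sum.cong refl) (simp add: sum_distrib_right mult.assoc)
    also have "\<dots> = (\<Sum>k\<in>{i..r}. t i (Suc s) * t' k (Suc s) * path (Suc r) s k j)"
      by (subst sum.swap) (simp add: sum_distrib_left)
    also have "t (Suc r) j = path (Suc r) s (Suc r) j" by simp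
    finally show ?thesis using Suc.prems(2) by simp
  qed (simp add: mult.assoc)
qed simp

text \<open>The counterpart of \<open>path_row_step\<close> at the start of the path: one that turns
  down in the last column reaches row \<open>Suc i\<close> and continues as a path from
  there.\<close>

lemma path_col_step:
  assumes "1 \<le> i" "i < r" "j \<le> s"
  shows "path r (Suc s) i j = path r s i j + t i (Suc s) * t' (Suc i) (Suc s) * path r (Suc s) (Suc i) j"
proof -
  have "{i..r} = insert i {Suc i..r}" using assms(2) by auto
  moreover have "t i (Suc s) * t' (Suc i) (Suc s) * path r (Suc s) (Suc i) j
      = (\<Sum>k\<in>{Suc i..r}. t i (Suc s) * t' k (Suc s) * path r s k j)"
    using assms by (simp add: path_col sum_distrib_left mult.assoc)
      (simp add: mult.assoc[symmetric] mult.assoc[of _ "t' (Suc i) (Suc s)" "t (Suc i) (Suc s)"])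
  ultimately show ?thesis using assms by (simp add: path_col)
qed

text \<open>Only the exit column counts: a turn down in any other column is followed by a turn left
  in the same column, and their commutation factors with \<open>t k l\<close> cancel.\<close>

lemma path_qc_below:
  assumes "1 \<le> i" "i \<le> r" "r < k"
  shows "qc (if l = j then 1 else 0) (path r s i j) (t k l)"
  using assms
proof (induction r arbitrary: j)
  case (Suc r)
  show ?case
  proof (cases "i = Suc r")
    case True
    then show ?thesis using t_qc[of j l k i] Suc.prems by auto
  next
    case False
    have "qc (if l = j then 1 else 0) (path r s i a * t' (Suc r) a * t (Suc r) j) (t k l)" for a
      using qc_mult_left[OF qc_mult_left[OF Suc.IH[of a] t'_t_qc[of a l k "Suc r"]] t_qc[of j l k "Suc r"]] Suc.prems False
      by (auto split: if_splits)
    then show ?thesis using False by (auto intro!: qc_sum_left)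
  qed
qed simp

text \<open>Only the starting row counts: in every lower row a turn left is followed by a turn down
  in the same row, and their commutation factors with \<open>t k l\<close> cancel.\<close>

lemma path_qc_right:
  assumes "1 \<le> i" "i \<le> r" "s < l" "j \<le> s"
  shows "qc (if k = i then 1 else 0) (path r s i j) (t k l)"
  using assms
proof (induction r arbitrary: j)
  case (Suc r)
  show ?case
  proof (cases "i = Suc r")
    case True
    then show ?thesis using t_qc[of j l k i] Suc.prems by auto
  next
    case False
    have "qc (if k = i then 1 else 0) (path r s i a * t' (Suc r) a * t (Suc r) j) (t k l)" if "a \<le> s" for a
      using qc_mult_left[OF qc_mult_left[OF Suc.IH[of a] t'_t_qc[of a l k "Suc r"]] t_qc[of j l k "Suc r"]] Suc.prems False that
      by (auto split: if_splits)
    then show ?thesis using False by (auto intro!: qc_sum_left)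
  qed
qed simp

text \<open>Rows are added at the bottom. The new row consists of the generators
  \<open>t (Suc r) j\<close> themselves, and \<open>qmat_add_row\<close> supplies the relations
  among the extended upper rows and between them and the new row.\<close>

theorem path_qmat: "qmat {1..r} {1..s} (path r s)"
proof (induction r)
  case 0
  then show ?case by (simp add: qmat_def)
next
  case (Suc r)
  let ?c = "t (Suc r)" and ?c' = "t' (Suc r)"
  let ?x = "\<lambda>i j. \<Sum>l\<in>{j..s}. path r s i l * ?c' l * ?c j"
  have cc: "qc 1 (?c j) (?c l)" if "j < l" for j l
    using t_qc[of j l "Suc r" "Suc r"] that by simp
  have x: "path (Suc r) s i j = ?x i j" if "i \<in> {1..r}" for i j using that by simp
  have c: "path (Suc r) s (Suc r) j = ?c j" for j by simp
  have "qc 1 (path r s i j) (t (Suc r) j)" "l \<noteq> j \<Longrightarrow> qc 0 (path r s i j) (t (Suc r) l)"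
    if "Suc 0 \<le> i" "i \<le> r" for i j l
    using path_qc_below[of i r "Suc r" j j s] path_qc_below[of i r "Suc r" l j s] that by auto
  note prems = cc t_inv this
  have q: "qmat {1..r} {1..s} ?x"
    by (rule qmat_add_row(1)[OF Suc.IH, of ?c ?c']) (auto intro!: prems simp del: if_split)
  have xc1: "qc 1 (?x i j) (?c j)" if "i \<in> {1..r}" "j \<in> {1..s}" for i j
    by (rule qmat_add_row(2)[OF Suc.IH, of ?c ?c']) (use that in \<open>auto intro!: prems simp del: if_split\<close>)
  have xc2: "qc 0 (?x i j) (?c l)" if "i \<in> {1..r}" "j \<in> {1..s}" "l \<in> {1..s}" "l < j" for i j l
    by (rule qmat_add_row(3)[OF Suc.IH, of ?c ?c']) (use that in \<open>auto intro!: prems simp del: if_split\<close>)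
  have xc3: "?x i j * ?c l = ?c l * ?x i j + sc (q - inverse q) (?x i l * ?c j)"
    if "i \<in> {1..r}" "j \<in> {1..s}" "l \<in> {1..s}" "j < l" for i j l
    by (rule qmat_add_row(4)[OF Suc.IH, of ?c ?c']) (use that in \<open>auto intro!: prems simp del: if_split\<close>)
  have cases: "k \<in> {1..Suc r} \<Longrightarrow> k \<in> {1..r} \<or> k = Suc r" for k by auto
  show ?case
    unfolding qmat_def
  proof (intro conjI ballI impI)
    fix i j l assume a: "i \<in> {1..Suc r}" "j \<in> {1..s}" "l \<in> {1..s}" "j < l"
    show "qc 1 (path (Suc r) s i j) (path (Suc r) s i l)"
    proof (cases "i \<in> {1..r}")
      case True
      show ?thesis unfolding x[OF True] by (rule qmat_row[OF q]) (use a True in auto)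
    qed (use cases[OF a(1)] cc[OF a(4)] c in metis)
  next
    fix i k j assume a: "i \<in> {1..Suc r}" "k \<in> {1..Suc r}" "j \<in> {1..s}" "i < k"
    then have i: "i \<in> {1..r}" by auto
    show "qc 1 (path (Suc r) s i j) (path (Suc r) s k j)"
    proof (cases "k \<in> {1..r}")
      case True
      show ?thesis unfolding x[OF True] x[OF i] by (rule qmat_col[OF q]) (use a True i in auto)
    next
      case False
      then have "k = Suc r" using cases[OF a(2)] by blast
      then show ?thesis unfolding x[OF i] using xc1[OF i a(3)] by (simp only: c)
    qed
  next
    fix i k j l assume a: "i \<in> {1..Suc r}" "k \<in> {1..Suc r}" "j \<in> {1..s}" "l \<in> {1..s}" "i < k" "l < j"
    then have i: "i \<in> {1..r}" by auto
    show "qc 0 (path (Suc r) s i j) (path (Suc r) s k l)"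
    proof (cases "k \<in> {1..r}")
      case True
      show ?thesis unfolding x[OF True] x[OF i] by (rule qmat_anti[OF q]) (use a True i in auto)
    next
      case False
      then have "k = Suc r" using cases[OF a(2)] by blast
      then show ?thesis unfolding x[OF i] using xc2[OF i a(3,4,6)] by (simp only: c)
    qed
  next
    fix i k j l assume a: "i \<in> {1..Suc r}" "k \<in> {1..Suc r}" "j \<in> {1..s}" "l \<in> {1..s}" "i < k" "j < l"
    then have i: "i \<in> {1..r}" by auto
    show "path (Suc r) s i j * path (Suc r) s k l = path (Suc r) s k l * path (Suc r) s i j
        + sc (q - inverse q) (path (Suc r) s i l * path (Suc r) s k j)"
    proof (cases "k \<in> {1..r}")
      case True
      show ?thesis unfolding x[OF True] x[OF i] by (rule qmat_cross[OF q]) (use a True i in auto)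
    next
      case False
      then have "k = Suc r" using cases[OF a(2)] by blast
      then show ?thesis unfolding x[OF i] using xc3[OF i a(3,4,6)] by (simp only: c)
    qed
  qed
qed

subsection \<open>Minors touching the border are monomials\<close>

text \<open>Entries of the last column are single variables, so a monomial multiple of each
  following row clears that column above the corner. By \<open>path_col_step\<close> what remains
  are the path sums with one column fewer.\<close>

lemma minor_right_border:
  assumes "1 \<le> i" "i + h \<le> r" "1 \<le> j" "j + h = s"
  shows "QD (Suc h) (\<lambda>a b. path r s (i + a) (j + b)) = prod_list (map (\<lambda>a. t (i + a) (j + a)) [0..<Suc h])"
  using assms
proof (induction h arbitrary: s)
  case 0
  show ?case using 0 by (simp add: QD_1 path_last_col)
next
  case (Suc h)
  let ?z = "\<lambda>a b. path r s (i + a) (j + b)"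
  define s0 where "s0 = j + h"
  have s: "s = Suc s0" using Suc.prems s0_def by simp
  define u where "u a b = (if a = Suc h then ?z a b else if b = Suc h then 0 else path r s0 (i + a) (j + b))" for a b
  define g where "g a = t (i + a) s * t' (i + Suc a) s" for a
  have "QD (Suc (Suc h)) ?z = QD (Suc (Suc h)) u"
  proof (rule QD_eliminate[where h = g])
    fix a b assume ab: "Suc a < Suc (Suc h)" "b < Suc (Suc h)"
    show "?z a b = u a b + g a * ?z (Suc a) b"
    proof (cases "b = Suc h")
      case True
      then have "j + b = s" using Suc.prems by simp
      then show ?thesis using ab Suc.prems True by (simp add: path_last_col u_def g_def mult.assoc)
    next
      case False
      then show ?thesis
        using path_col_step[of "i + a" r "j + b" s0] ab Suc.prems s by (simp add: u_def g_def)
    qed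
  next
    fix a a' b assume ab: "a' < a" "Suc a < Suc (Suc h)" "b < Suc (Suc h)"
    show "g a * u a' b = u a' b * g a"
    proof (cases "b = Suc h")
      case False
      let ?y = "path r s0 (i + a') (j + b)"
      have y: "qc 0 ?y (t (i + a) s)" "qc 0 ?y (t (i + Suc a) s)"
        using path_qc_right[of "i + a'" r s0 s "j + b" "i + a"] path_qc_right[of "i + a'" r s0 s "j + b" "i + Suc a"]
          ab False Suc.prems s by (auto simp: s0_def)
      have "qc 0 ?y (t' (i + Suc a) s)" using qc_inverse_right[OF y(2) t_inv] by simp
      then have "qc 0 ?y (g a)" using qc_mult_right[OF y(1)] by (simp add: g_def)
      then show ?thesis using ab False by (simp add: u_def qc_zero_iff)
    qed (use ab in \<open>simp add: u_def\<close>)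
  next
    fix a b b' assume "a < Suc (Suc h)" "b < b'" "b' < Suc (Suc h)"
    then show "qc 1 (?z a b) (?z a b')"
      using qmat_row[OF path_qmat, of "i + a" r "j + b" s "j + b'"] Suc.prems by simp
  qed (simp add: u_def)
  also have "\<dots> = QD (Suc h) u * u (Suc h) (Suc h)"
    by (rule QD_triangular_last) (simp add: u_def)
  also have "QD (Suc h) u = QD (Suc h) (\<lambda>a b. path r s0 (i + a) (j + b))"
    by (rule QD_cong) (simp add: u_def)
  also have "\<dots> = prod_list (map (\<lambda>a. t (i + a) (j + a)) [0..<Suc h])"
    by (rule Suc.IH) (use Suc.prems s0_def in auto)
  also have "u (Suc h) (Suc h) = t (i + Suc h) (j + Suc h)"
    using Suc.prems path_last_col[of "i + Suc h" r s] by (simp add: u_def)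
  finally show ?case by (simp add: mult.assoc)
qed

text \<open>The same elimination with columns as lines: the last row consists of single variables,
  and \<open>path_row_step\<close> describes what is left after it is cleared.\<close>

lemma minor_bottom_border:
  assumes "1 \<le> i" "i + h = r" "1 \<le> j" "j + h \<le> s"
  shows "QD (Suc h) (\<lambda>a b. path r s (i + b) (j + a)) = prod_list (map (\<lambda>a. t (i + a) (j + a)) [0..<Suc h])"
  using assms
proof (induction h arbitrary: r)
  case 0
  show ?case using 0 by (simp add: QD_1 path_last_row)
next
  case (Suc h)
  let ?z = "\<lambda>a b. path r s (i + b) (j + a)"
  define r0 where "r0 = i + h"
  have r: "r = Suc r0" using Suc.prems r0_def by simp
  define u where "u a b = (if a = Suc h then ?z a b else if b = Suc h then 0 else path r0 s (i + b) (j + a))" for a b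
  define g where "g a = t' r (j + Suc a) * t r (j + a)" for a
  \<comment> \<open>\<open>path_row_step\<close> puts the multiplier on the right, whereas
    elimination needs it on the left. Moving it costs \<open>inverse q\<close> for every
    \<open>b\<close>, so it is still one multiplier for the whole line.\<close>
  have xg: "path r s (i + b) (j + Suc a) * g a = sc (inverse q) (g a) * path r s (i + b) (j + Suc a)"
    if "a < Suc h" "b < Suc (Suc h)" for a b
  proof -
    let ?y = "path r s (i + b) (j + Suc a)"
    have tr: "t r l = path r s r l" for l using path_last_row[of r s l] r by simp
    have "qc (- 1) ?y (t' r (j + Suc a) * t r (j + a))"
    proof (cases "b = Suc h")
      case True
      then have b: "i + b = r" using Suc.prems by simp
      have "qc 0 ?y (t r (j + Suc a))" by (simp add: b tr qc_def)
      moreover have "qc (- 1) ?y (t r (j + a))"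
        using qc_swap[OF qmat_row[OF path_qmat, of r r "j + a" s "j + Suc a"]] that Suc.prems r by (simp add: b tr)
      ultimately show ?thesis
        using qc_mult_right[OF qc_inverse_right[OF _ t_inv]] by fastforce
    next
      case False
      then have b: "i + b < r" using Suc.prems that by simp
      have "qc 1 ?y (t r (j + Suc a))"
        using qmat_col[OF path_qmat, of "i + b" r r "j + Suc a" s] that b Suc.prems r by (simp add: tr)
      moreover have "qc 0 ?y (t r (j + a))"
        using qmat_anti[OF path_qmat, of "i + b" r r "j + Suc a" s "j + a"] that b Suc.prems r by (simp add: tr)
      ultimately show ?thesis
        using qc_mult_right[OF qc_inverse_right[OF _ t_inv]] by fastforce
    qed
    then show ?thesis by (simp add: qc_def g_def power_int_minus)
  qed
  have "QD (Suc (Suc h)) ?z = QD (Suc (Suc h)) u"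
  proof (rule QD_eliminate[where h = "\<lambda>a. sc (inverse q) (g a)"])
    fix a b assume ab: "Suc a < Suc (Suc h)" "b < Suc (Suc h)"
    show "?z a b = u a b + sc (inverse q) (g a) * ?z (Suc a) b"
    proof (cases "b = Suc h")
      case True
      then have "i + b = r" using Suc.prems by simp
      then show ?thesis
        using ab Suc.prems True r xg[of a b] by (simp add: u_def path_last_row g_def)
          (simp add: mult.assoc[symmetric])
    next
      case False
      then show ?thesis
        using path_row_step[of "i + b" r0 "j + a" s] xg[of a b] ab Suc.prems r
        by (simp add: u_def g_def r0_def)
    qed
  next
    fix a a' b assume ab: "a' < a" "Suc a < Suc (Suc h)" "b < Suc (Suc h)"
    show "sc (inverse q) (g a) * u a' b = u a' b * sc (inverse q) (g a)"
    proof (cases "b = Suc h")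
      case False
      let ?y = "path r0 s (i + b) (j + a')"
      have y: "qc 0 ?y (t r (j + a))" "qc 0 ?y (t r (j + Suc a))"
        using path_qc_below[of "i + b" r0 r "j + a" "j + a'" s] path_qc_below[of "i + b" r0 r "j + Suc a" "j + a'" s]
          ab False Suc.prems r by (auto simp: r0_def split: if_splits)
      have "qc 0 ?y (t' r (j + Suc a))" using qc_inverse_right[OF y(2) t_inv] by simp
      then have "qc 0 ?y (g a)" using qc_mult_right[OF _ y(1)] by (fastforce simp: g_def)
      then show ?thesis using ab False by (simp add: u_def qc_zero_iff)
    qed (use ab in \<open>simp add: u_def\<close>)
  next
    fix a b b' assume "a < Suc (Suc h)" "b < b'" "b' < Suc (Suc h)"
    then show "qc 1 (?z a b) (?z a b')"
      using qmat_col[OF path_qmat, of "i + b" r "i + b'" "j + a" s] Suc.prems by simp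
  qed (simp add: u_def)
  also have "\<dots> = QD (Suc h) u * u (Suc h) (Suc h)"
    by (rule QD_triangular_last) (simp add: u_def)
  also have "QD (Suc h) u = QD (Suc h) (\<lambda>a b. path r0 s (i + b) (j + a))"
    by (rule QD_cong) (simp add: u_def)
  also have "\<dots> = prod_list (map (\<lambda>a. t (i + a) (j + a)) [0..<Suc h])"
    by (rule Suc.IH) (use Suc.prems r0_def in auto)
  also have "u (Suc h) (Suc h) = t (i + Suc h) (j + Suc h)"
    using Suc.prems path_last_row[of r s] r by (simp add: u_def)
  finally show ?case by (simp add: mult.assoc)
qed

subsection \<open>Powers at a root of unity\<close>

lemma grid_power:
  assumes "q ^ m = 1"
  shows "grid sc 1 (\<lambda>i j. t i j ^ m) (\<lambda>i j. t' i j ^ m)"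
proof -
  have inv: "x ^ m * y ^ m = 1" if "x * y = 1" "y * x = 1" for x y :: 'r
    using that by (metis left_right_inverse_power)
  have comm: "t i j ^ m * t k l ^ m = t k l ^ m * t i j ^ m" for i j k l
  proof -
    let ?e = "(if j = l then sgn (int k - int i) else 0) + (if i = k then sgn (int l - int j) else 0)"
    have "qc (int m * (int m * ?e)) (t i j ^ m) (t k l ^ m)"
      by (intro qc_power_left qc_power_right t_qc)
    moreover have "q powi (int m * (int m * ?e)) = 1"
      using assms by (simp add: power_int_mult)
    ultimately show ?thesis by (simp add: qc_def)
  qed
  interpret one: qkalg sc 1 by standard simp
  show ?thesis
    by standard (auto simp: inv one.qc_def comm)
qed

text \<open>The m-th power respects the recursion \<open>path_row_step\<close>: both the sum and the
  products in it obey the Frobenius-type rules above.\<close>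

lemma path_power:
  assumes "root_of_unity_order q m" "odd m" "1 \<le> i" "i \<le> r" "1 \<le> j" "j \<le> s"
  shows "path r s i j ^ m = px (\<lambda>i j. t i j ^ m) (\<lambda>i j. t' i j ^ m) r s i j"
proof -
  have qm: "q ^ m = 1" using assms(1) by (simp add: root_of_unity_order_def)
  interpret pow: grid sc 1 "\<lambda>i j. t i j ^ m" "\<lambda>i j. t' i j ^ m" by (rule grid_power[OF qm])
  \<comment> \<open>The two summands of \<open>path_row_step\<close> commute up to
    \<open>q\<^sup>2\<close>, so it is the order of \<open>q\<^sup>2\<close> that matters.\<close>
  have q2: "root_of_unity_order (q\<^sup>2) m"
    unfolding root_of_unity_order_def
  proof (intro conjI allI impI)
    show "0 < m" "(q\<^sup>2) ^ m = 1"
      using assms(1) qm by (simp_all add: root_of_unity_order_def power2_eq_square power_mult_distrib)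
    fix k assume k: "0 < k \<and> k < m"
    show "(q\<^sup>2) ^ k \<noteq> 1"
    proof
      assume "(q\<^sup>2) ^ k = 1"
      then have 2: "q ^ (2 * k) = 1" by (simp add: power_mult)
      show False
      proof (cases "2 * k < m")
        case True
        then show False using 2 k assms(1) by (auto simp: root_of_unity_order_def)
      next
        case False
        then have "q ^ (2 * k) = q ^ m * q ^ (2 * k - m)" by (simp flip: power_add)
        then have "q ^ (2 * k - m) = 1" using 2 qm by simp
        moreover have "2 * k - m \<noteq> 0" using assms(2) False by auto
        ultimately show False using k assms(1) by (auto simp: root_of_unity_order_def)
      qed
    qed
  qed
  show ?thesis
    using assms(3-6)
  proof (induction r arbitrary: j)
    case (Suc r)
    show ?case
    proof (cases "i = Suc r")
      case False
      then have i: "i \<le> r" using Suc.prems by simp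
      show ?thesis
        using Suc.prems(4,3)
      proof (induction j rule: inc_induct)
        case base
        then show ?case using Suc.prems by (simp only: path_last_col pow.path_last_col)
      next
        case (step j)
        let ?y = "path r s i j" and ?x = "path (Suc r) s i (Suc j)"
        let ?g = "t' (Suc r) (Suc j) * t (Suc r) j"
        have tr: "t (Suc r) l = path (Suc r) s (Suc r) l" for l by simp
        have xt: "qc 1 ?x (t (Suc r) (Suc j))" "qc 0 ?x (t (Suc r) j)"
          using qmat_col[OF path_qmat, of i "Suc r" "Suc r" "Suc j" s]
            qmat_anti[OF path_qmat, of i "Suc r" "Suc r" "Suc j" s j] step Suc.prems i
          unfolding tr by auto
        have xg: "qc (- 1) ?x ?g"
          using qc_mult_right[OF qc_inverse_right[OF xt(1) t_inv] xt(2)] by simp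
        have yt: "qc 0 ?y (t (Suc r) l)" if "l \<noteq> j" for l
          using path_qc_below[of i r "Suc r" l j s] Suc.prems i that by simp
        have yt': "qc 0 ?y (t' (Suc r) l)" if "l \<noteq> j" for l
          using qc_inverse_right[OF yt[OF that] t_inv] by simp
        have ytj: "qc 1 ?y (t (Suc r) j)"
          using path_qc_below[of i r "Suc r" j j s] Suc.prems i by simp
        have yx: "qc 1 ?y ?x"
        proof -
          have "qc 1 ?y (path r s i l * t' (Suc r) l * t (Suc r) (Suc j))" if "l \<in> {Suc j..s}" for l
          proof -
            have "qc 1 ?y (path r s i l)"
              using qmat_row[OF path_qmat, of i r j s l] that step Suc.prems i by auto
            from qc_mult_right[OF qc_mult_right[OF this yt'] yt, of l "Suc j"] that show ?thesis by simp
          qed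
          then show ?thesis using False by (auto intro!: qc_sum_right)
        qed
        have "qc 1 ?y ?g" using qc_mult_right[OF yt' ytj, of "Suc j"] by simp
        then have yz: "qc 2 ?y (?x * ?g)" using qc_mult_right[OF yx] by fastforce
        have "(?y + ?x * ?g) ^ m = ?y ^ m + (?x * ?g) ^ m"
          using yz by (intro add_power_root_of_unity[OF _ q2]) (simp add: qc_def power_int_def)
        also have "(?x * ?g) ^ m = ?x ^ m * ?g ^ m"
          using qc_swap[OF xg] qm assms(2) by (intro mult_power_root_of_unity[of _ _ q]) (simp_all add: qc_def)
        also have "?g ^ m = t' (Suc r) (Suc j) ^ m * t (Suc r) j ^ m"
        proof -
          have "qc 1 (t' (Suc r) (Suc j)) (t (Suc r) j)"
            using t'_t_qc[of "Suc j" j "Suc r" "Suc r"] by simp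
          from qc_swap[OF this] show ?thesis using qm assms(2)
            by (intro mult_power_root_of_unity[of _ _ "inverse q"]) (simp_all add: qc_def power_int_minus power_inverse)
        qed
        finally have "path (Suc r) s i j ^ m = ?y ^ m + ?x ^ m * (t' (Suc r) (Suc j) ^ m * t (Suc r) j ^ m)"
          using path_row_step[of i r j s] Suc.prems i step by simp
        also have "?y ^ m = px (\<lambda>i j. t i j ^ m) (\<lambda>i j. t' i j ^ m) r s i j"
          using Suc.IH[of j] Suc.prems i step by simp
        also have "?x ^ m = px (\<lambda>i j. t i j ^ m) (\<lambda>i j. t' i j ^ m) (Suc r) s i (Suc j)"
          using step.IH by simp
        finally show ?case
          using pow.path_row_step[of i r j s] Suc.prems i step by simp
      qed
    qed simp
  qed simp
qed

end

section \<open>Leading terms in twisted group algebras\<close>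

text \<open>The functionals \<open>\<kappa>\<close> read off coefficients; their existence is how
  linear independence of the \<open>T a\<close> is expressed.\<close>

locale twisted = kalg sc for sc :: "'k::field \<Rightarrow> 'r::ring_1 \<Rightarrow> 'r" +
  fixes T :: "'e::linordered_ab_group_add \<Rightarrow> 'r" and \<beta> :: "'e \<Rightarrow> 'e \<Rightarrow> 'k" and \<kappa> :: "'r \<Rightarrow> 'e \<Rightarrow> 'k"
  assumes T_zero [simp]: "T 0 = 1"
    and T_mult: "T a * T b = sc (\<beta> a b) (T (a + b))"
    and \<beta>_nonzero [simp]: "\<beta> a b \<noteq> 0"
    and \<kappa>_add: "\<kappa> (f + g) a = \<kappa> f a + \<kappa> g a"
    and \<kappa>_sc: "\<kappa> (sc c f) a = c * \<kappa> f a"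
    and \<kappa>_T: "\<kappa> (T a) b = (if a = b then 1 else 0)"
begin

inductive_set below :: "'e \<Rightarrow> 'r set" for a where
  zero: "0 \<in> below a"
| step: "f \<in> below a \<Longrightarrow> b < a \<Longrightarrow> f + sc c (T b) \<in> below a"

lemma below_T: "b < a \<Longrightarrow> sc c (T b) \<in> below a"
  using below.step[OF below.zero] by simp

lemma below_add:
  assumes "f \<in> below a" "g \<in> below a" shows "f + g \<in> below a"
  using assms(2,1) by (induction g rule: below.induct) (auto simp: add.assoc[symmetric] intro: below.step)

lemma below_sum: "(\<And>x. x \<in> A \<Longrightarrow> f x \<in> below a) \<Longrightarrow> sum f A \<in> below a"
  by (induction A rule: infinite_finite_induct) (auto intro: below_add below.zero)

lemma below_sc: "f \<in> below a \<Longrightarrow> sc c f \<in> below a"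
  by (induction f rule: below.induct) (auto simp: sc_add intro: below.intros)

lemma below_diff: "f \<in> below a \<Longrightarrow> g \<in> below a \<Longrightarrow> f - g \<in> below a"
  using below_add[OF _ below_sc[of g a "- 1"]] by (simp add: sc_minus_left)

lemma below_mono: "f \<in> below a \<Longrightarrow> a \<le> b \<Longrightarrow> f \<in> below b"
  by (induction f rule: below.induct) (auto intro: below.intros)

lemma below_mult_T: "f \<in> below a \<Longrightarrow> f * T b \<in> below (a + b)"
  by (induction f rule: below.induct) (auto simp: distrib_right T_mult intro: below.intros)

lemma T_mult_below: "f \<in> below a \<Longrightarrow> T b * f \<in> below (b + a)"
  by (induction f rule: below.induct) (auto simp: distrib_left T_mult intro: below.intros)

lemma below_mult:
  assumes "f \<in> below a" "g \<in> below b" shows "f * g \<in> below (a + b)"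
  using assms(2,1)
proof (induction g rule: below.induct)
  case (step g b' c)
  have "f * T b' \<in> below (a + b)"
    using below_mono[OF below_mult_T[OF step.prems]] step.hyps by simp
  then show ?case using step by (simp add: distrib_left below_add below_sc)
qed (simp add: below.zero)

lemma \<kappa>_zero [simp]: "\<kappa> 0 a = 0"
  using \<kappa>_sc[of 0 0 a] by simp

lemma \<kappa>_below: "f \<in> below a \<Longrightarrow> a \<le> b \<Longrightarrow> \<kappa> f b = 0"
proof (induction f rule: below.induct)
  case zero
  then show ?case by simp
qed (auto simp: \<kappa>_add \<kappa>_sc \<kappa>_T)

text \<open>With \<open>c = 0\<close> this says that \<open>f\<close> lies in
  \<open>below a\<close>; hence the separate condition that \<open>c\<close> is nonzero wherever a
  genuine leading term is meant.\<close>

definition lead :: "'r \<Rightarrow> 'e \<Rightarrow> 'k \<Rightarrow> bool" where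
  "lead f a c \<longleftrightarrow> f - sc c (T a) \<in> below a"

lemma lead_T: "lead (T a) a 1"
  by (simp add: lead_def below.zero)

lemma lead_below: "lead f a c \<Longrightarrow> a < b \<Longrightarrow> f \<in> below b"
  using below_add[of "f - sc c (T a)" b "sc c (T a)"]
  by (simp add: lead_def below_T below_mono)

lemma lead_add_below: "lead f a c \<Longrightarrow> g \<in> below a \<Longrightarrow> lead (f + g) a c"
  using below_add[of "f - sc c (T a)" a g] by (simp add: lead_def algebra_simps)

lemma lead_sc: "lead f a c \<Longrightarrow> lead (sc d f) a (d * c)"
  using below_sc[of "f - sc c (T a)" a d] by (simp add: lead_def sc_diff)

lemma lead_diff: "lead f a c \<Longrightarrow> lead g a c \<Longrightarrow> f - g \<in> below a"
  using below_diff[of "f - sc c (T a)" a "g - sc c (T a)"] by (simp add: lead_def)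

lemma lead_mult:
  assumes "lead f a c" "lead g b d"
  shows "lead (f * g) (a + b) (c * d * \<beta> a b)"
proof -
  define f' where "f' = f - sc c (T a)"
  define g' where "g' = g - sc d (T b)"
  have "f * g - sc (c * d * \<beta> a b) (T (a + b)) = sc c (T a * g') + sc d (f' * T b) + f' * g'"
    by (simp add: f'_def g'_def algebra_simps sc_diff sc_add T_mult)
  moreover have "T a * g' \<in> below (a + b)" "f' * T b \<in> below (a + b)" "f' * g' \<in> below (a + b)"
    using assms by (simp_all add: lead_def f'_def g'_def T_mult_below below_mult_T below_mult)
  ultimately show ?thesis by (simp add: lead_def below_add below_sc)
qed

lemma lead_\<kappa>: "lead f a c \<Longrightarrow> \<kappa> f a = c"
proof -
  assume "lead f a c"
  then have "\<kappa> (f - sc c (T a)) a = 0" by (simp add: lead_def \<kappa>_below)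
  then have "\<kappa> (f - sc c (T a) + sc c (T a)) a = c" by (simp only: \<kappa>_add \<kappa>_sc \<kappa>_T) simp
  then show ?thesis by simp
qed

lemma lead_nonzero: "lead f a c \<Longrightarrow> c \<noteq> 0 \<Longrightarrow> f \<noteq> 0"
  using lead_\<kappa> by fastforce

lemma lead_sum:
  assumes "finite K" "K \<noteq> {}" "inj_on a K" "\<And>k. k \<in> K \<Longrightarrow> lead (h k) (a k) (c k)"
  shows "\<exists>k\<in>K. lead (sum h K) (a k) (c k) \<and> (\<forall>k'\<in>K. a k' \<le> a k)"
proof -
  have "Max (a ` K) \<in> a ` K" using assms by simp
  then obtain k where k: "k \<in> K" "a k = Max (a ` K)" by auto
  have le: "a k' \<le> a k" if "k' \<in> K" for k' using k assms(1) that by simp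
  have "sum h (K - {k}) \<in> below (a k)"
  proof (rule below_sum)
    fix k' assume k': "k' \<in> K - {k}"
    then have "a k' < a k" using le[of k'] inj_onD[OF assms(3), of k' k] k(1) by fastforce
    then show "h k' \<in> below (a k)" using lead_below assms(4) k' by blast
  qed
  then have "lead (h k + sum h (K - {k})) (a k) (c k)" using lead_add_below assms(4) k(1) by blast
  then have "lead (sum h K) (a k) (c k)" using k(1) assms(1) by (simp only: sum.remove)
  then show ?thesis using k(1) le by blast
qed

lemma lead_prod_list:
  assumes "\<And>x. x \<in> set xs \<Longrightarrow> \<exists>c. c \<noteq> 0 \<and> lead (f x) (a x) c"
  shows "\<exists>c. c \<noteq> 0 \<and> lead (prod_list (map f xs)) (sum_list (map a xs)) c"
  using assms
proof (induction xs)
  case Nil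
  then show ?case using lead_T[of 0] by (intro exI[of _ 1]) simp
next
  case (Cons x xs)
  obtain c where c: "c \<noteq> 0" "lead (f x) (a x) c" using Cons.prems[of x] by auto
  obtain d where d: "d \<noteq> 0" "lead (prod_list (map f xs)) (sum_list (map a xs)) d" using Cons by auto
  show ?case using lead_mult[OF c(2) d(2)] c(1) d(1)
    by (intro exI[of _ "c * d * \<beta> (a x) (sum_list (map a xs))"]) simp
qed

end

type_synonym expo = "nat \<times> nat \<Rightarrow>\<^sub>0 int"

text \<open>Exponents are compared at the smallest variable where they differ; with pairs ordered
  lexicographically, matrices are read row by row.\<close>

lemma expo_lessI:
  fixes a b :: "'v::linorder \<Rightarrow>\<^sub>0 'c::{zero,linorder}"
  assumes "lookup a v < lookup b v"
    "\<And>w. w < v \<Longrightarrow> lookup a w = lookup b w"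
  shows "a < b"
  using assms by (auto simp: less_poly_mapping.rep_eq less_fun_def)

locale twisted_expo = twisted sc T \<beta> \<kappa>
  for sc :: "'k::field \<Rightarrow> 'r::ring_1 \<Rightarrow> 'r" and T :: "expo \<Rightarrow> 'r" and \<beta> \<kappa>
begin

text \<open>The path straight down column \<open>j\<close> is the only one that turns at
  \<open>(i, j)\<close>. Every other path first turns further right and otherwise only in lower
  rows, so its exponent is 0 at \<open>(i, j)\<close> and before. The cases \<open>k = 1\<close> and
  \<open>k = m\<close> serve the torus and the Laurent ring.\<close>

lemma path_lead:
  assumes inv: "\<And>i j. T (- single (i, j) k) * T (single (i, j) k) = 1"
    and "k > 0" "1 \<le> i" "i \<le> r" "j \<le> s"
  shows "lead (px (\<lambda>i j. T (single (i, j) k)) (\<lambda>i j. T (- single (i, j) k)) r s i j)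
    (single (i, j) k) 1"
  using assms(3-5)
proof (induction r arbitrary: j)
  case (Suc r)
  let ?t = "\<lambda>i j. T (single (i, j) k)" and ?t' = "\<lambda>i j. T (- single (i, j) k)"
  let ?x = "px ?t ?t'"
  show ?case
  proof (cases "i = Suc r")
    case False
    have "?x r s i l * ?t' (Suc r) l * ?t (Suc r) j \<in> below (single (i, j) k)" if "l \<in> {Suc j..s}" for l
    proof -
      let ?a = "single (i, l) k + - single (Suc r, l) k + single (Suc r, j) k"
      have "lead (?x r s i l) (single (i, l) k) 1" using Suc False that by auto
      from lead_mult[OF lead_mult[OF this lead_T] lead_T]
      have "\<exists>c. lead (?x r s i l * ?t' (Suc r) l * ?t (Suc r) j) ?a c" by blast
      moreover have "?a < single (i, j) k"
        by (rule expo_lessI[of _ "(i, j)"])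
           (use that Suc.prems False assms(2) in \<open>auto simp: lookup_add lookup_minus lookup_single when_def less_prod_def\<close>)
      ultimately show ?thesis using lead_below by blast
    qed
    then have "(\<Sum>l\<in>{Suc j..s}. ?x r s i l * ?t' (Suc r) l * ?t (Suc r) j) \<in> below (single (i, j) k)"
      by (rule below_sum)
    moreover have "{j..s} = insert j {Suc j..s}" using Suc.prems by auto
    ultimately show ?thesis
      using Suc False by (simp add: mult.assoc inv lead_add_below)
  qed (simp add: lead_T)
qed simp

end

section \<open>The commutative Laurent algebra\<close>

type_synonym 'k laurent = "expo \<Rightarrow>\<^sub>0 'k"

definition laurent_sc :: "'k::field \<Rightarrow> ('e::comm_monoid_add \<Rightarrow>\<^sub>0 'k) \<Rightarrow> ('e \<Rightarrow>\<^sub>0 'k)" where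
  "laurent_sc c f = single 0 c * f"

lemma lookup_laurent_sc: "lookup (laurent_sc c f) a = c * lookup f a"
  unfolding laurent_sc_def mult_map_scale_conv_mult[symmetric]
  by (simp add: Poly_Mapping.map.rep_eq when_def)

interpretation laurent_kalg: kalg laurent_sc
  by standard (simp_all add: laurent_sc_def algebra_simps single_add mult_single flip: mult.assoc)

abbreviation lmono :: "'e \<Rightarrow> ('e \<Rightarrow>\<^sub>0 'k::field)" where
  "lmono a \<equiv> single a 1"

interpretation laurent: twisted_expo laurent_sc "lmono :: expo \<Rightarrow> 'k::field laurent" "\<lambda>_ _. 1" lookup
  by standard (simp_all add: lookup_laurent_sc lookup_add mult_single lookup_single when_def)

section \<open>Linear operators\<close>

text \<open>A noncommutative ring type in which the quantum torus is realised by its regular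
  representation; associativity is that of composition.\<close>

typedef (overloaded) ('e, 'k::comm_ring_1) lop =
  "{f :: ('e \<Rightarrow> 'k) \<Rightarrow> 'e \<Rightarrow> 'k. (\<forall>x y. f (\<lambda>e. x e + y e) = (\<lambda>e. f x e + f y e)) \<and>
     (\<forall>c x. f (\<lambda>e. c * x e) = (\<lambda>e. c * f x e))}"
  by (rule exI[of _ "\<lambda>x. x"]) simp

lemma Rep_lop_add: "Rep_lop f (\<lambda>e. x e + y e) = (\<lambda>e. Rep_lop f x e + Rep_lop f y e)"
  and Rep_lop_scale: "Rep_lop f (\<lambda>e. c * x e) = (\<lambda>e. c * Rep_lop f x e)"
  using Rep_lop[of f] by auto

instantiation lop :: (type, comm_ring_1) ring_1
begin

definition zero_lop :: "('a, 'b) lop" where "0 = Abs_lop (\<lambda>x e. 0)"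
definition one_lop :: "('a, 'b) lop" where "1 = Abs_lop (\<lambda>x. x)"
definition plus_lop :: "('a, 'b) lop \<Rightarrow> ('a, 'b) lop \<Rightarrow> ('a, 'b) lop"
  where "f + g = Abs_lop (\<lambda>x e. Rep_lop f x e + Rep_lop g x e)"
definition minus_lop :: "('a, 'b) lop \<Rightarrow> ('a, 'b) lop \<Rightarrow> ('a, 'b) lop"
  where "f - g = Abs_lop (\<lambda>x e. Rep_lop f x e - Rep_lop g x e)"
definition uminus_lop :: "('a, 'b) lop \<Rightarrow> ('a, 'b) lop"
  where "- f = Abs_lop (\<lambda>x e. - Rep_lop f x e)"
definition times_lop :: "('a, 'b) lop \<Rightarrow> ('a, 'b) lop \<Rightarrow> ('a, 'b) lop"
  where "f * g = Abs_lop (\<lambda>x. Rep_lop f (Rep_lop g x))"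

lemma Rep_lop_simps:
  fixes f g :: "('a, 'b) lop"
  shows "Rep_lop (0 :: ('a, 'b) lop) = (\<lambda>x e. 0)" "Rep_lop (1 :: ('a, 'b) lop) = (\<lambda>x. x)"
    "Rep_lop (f + g) = (\<lambda>x e. Rep_lop f x e + Rep_lop g x e)"
    "Rep_lop (f - g) = (\<lambda>x e. Rep_lop f x e - Rep_lop g x e)"
    "Rep_lop (- f) = (\<lambda>x e. - Rep_lop f x e)"
    "Rep_lop (f * g) = (\<lambda>x. Rep_lop f (Rep_lop g x))"
  unfolding zero_lop_def one_lop_def plus_lop_def minus_lop_def uminus_lop_def times_lop_def
  by (subst Abs_lop_inverse; simp add: Rep_lop_add Rep_lop_scale algebra_simps)+

instance
proof
  fix f g h :: "('a, 'b) lop"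
  show "f + g + h = f + (g + h)" "f + g = g + f" "0 + f = f" "- f + f = 0" "f - g = f + - g"
    "f * g * h = f * (g * h)" "1 * f = f" "f * 1 = f" "(f + g) * h = f * h + g * h" "f * (g + h) = f * g + f * h"
    by (simp_all add: Rep_lop_inject[symmetric] Rep_lop_simps Rep_lop_add ac_simps)
  show "(0 :: ('a, 'b) lop) \<noteq> 1"
  proof
    assume "(0 :: ('a, 'b) lop) = 1"
    then have "Rep_lop (0 :: ('a, 'b) lop) (\<lambda>_. 1) = Rep_lop 1 (\<lambda>_. 1)" by simp
    then show False by (simp add: Rep_lop_simps fun_eq_iff)
  qed
qed

end

definition lop_sc :: "'k::field \<Rightarrow> ('e, 'k) lop \<Rightarrow> ('e, 'k) lop" where
  "lop_sc c f = Abs_lop (\<lambda>x e. c * Rep_lop f x e)"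

lemma Rep_lop_sc: "Rep_lop (lop_sc c f) = (\<lambda>x e. c * Rep_lop f x e)"
  unfolding lop_sc_def
  by (subst Abs_lop_inverse) (simp_all add: Rep_lop_add Rep_lop_scale algebra_simps)

interpretation lop: kalg lop_sc
  by standard (simp_all add: Rep_lop_inject[symmetric] Rep_lop_simps Rep_lop_sc Rep_lop_scale algebra_simps)

section \<open>The quantum torus\<close>

fun qsgn :: "nat \<times> nat \<Rightarrow> nat \<times> nat \<Rightarrow> int" where
  "qsgn (i, j) (k, l) = (if j = l then sgn (int k - int i) else 0) + (if i = k then sgn (int l - int j) else 0)"

text \<open>The skew form of the torus: for \<open>p * p = q\<close> the monomials with exponents
  \<open>a\<close> and \<open>b\<close> commute up to \<open>q powi qform a b\<close>.\<close>

definition qform :: "expo \<Rightarrow> expo \<Rightarrow> int" where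
  "qform a b = (\<Sum>u\<in>keys a. \<Sum>v\<in>keys b.
     lookup a u * lookup b v * qsgn u v)"

lemma qsgn_antisym: "qsgn v u = - qsgn u v"
  by (cases u; cases v) (auto simp: sgn_if)

lemma qform_superset:
  assumes "finite U" "keys a \<subseteq> U" "finite V" "keys b \<subseteq> V"
  shows "qform a b = (\<Sum>u\<in>U. \<Sum>v\<in>V. lookup a u * lookup b v * qsgn u v)"
proof -
  have "qform a b = (\<Sum>u\<in>keys a. \<Sum>v\<in>V. lookup a u * lookup b v * qsgn u v)"
    unfolding qform_def
    by (intro sum.cong refl sum.mono_neutral_left) (use assms in \<open>auto simp: in_keys_iff\<close>)
  also have "\<dots> = (\<Sum>u\<in>U. \<Sum>v\<in>V. lookup a u * lookup b v * qsgn u v)"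
    by (rule sum.mono_neutral_left) (use assms in \<open>auto simp: in_keys_iff\<close>)
  finally show ?thesis .
qed

lemma qform_antisym: "qform b a = - qform a b"
proof -
  have "qform b a = (\<Sum>u\<in>keys a. \<Sum>v\<in>keys b.
     lookup b v * lookup a u * qsgn v u)"
    unfolding qform_def by (rule sum.swap)
  also have "\<dots> = - qform a b"
    unfolding qform_def sum_negf[symmetric]
    by (intro sum.cong refl) (subst qsgn_antisym, simp)
  finally show ?thesis .
qed

lemma qform_add_left: "qform (a + a') b = qform a b + qform a' b"
proof -
  let ?U = "keys a \<union> keys a'"
  have "qform c b = (\<Sum>u\<in>?U. \<Sum>v\<in>keys b. lookup c u * lookup b v * qsgn u v)"
    if "c \<in> {a, a', a + a'}" for c
    by (rule qform_superset) (use that keys_add[of a a'] in auto)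
  then show ?thesis by (simp add: lookup_add distrib_right sum.distrib)
qed

lemma qform_add_right: "qform a (b + b') = qform a b + qform a b'"
  using qform_add_left[of b b' a] qform_antisym by (metis minus_add_distrib minus_minus)

lemma qform_zero [simp]: "qform 0 a = 0" "qform a 0 = 0"
  by (auto simp: qform_def)

lemma qform_uminus_left: "qform (- a) b = - qform a b"
  using qform_add_left[of a "- a" b] by simp

lemma qform_uminus_right: "qform a (- b) = - qform a b"
  using qform_add_right[of a b "- b"] by simp

lemma qform_diff_right: "qform a (b - c) = qform a b - qform a c"
  using qform_add_right[of a b "- c"] by (simp add: qform_uminus_right)

lemma qform_self [simp]: "qform a a = 0"
  using qform_antisym[of a a] by simp

lemma qform_single: "qform (single u c) (single v d) = c * d * qsgn u v"
  by (simp add: qform_def)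

lemma qform_sum_left: "qform (sum f A) b = (\<Sum>x\<in>A. qform (f x) b)"
  by (induction A rule: infinite_finite_induct) (auto simp: qform_add_left)

lemma qform_sum_right: "qform b (sum f A) = (\<Sum>x\<in>A. qform b (f x))"
  by (induction A rule: infinite_finite_induct) (auto simp: qform_add_right)

text \<open>Left multiplication in the twisted group algebra: the delta function at \<open>b\<close>
  goes to \<open>p powi qform a b\<close> times the delta function at \<open>a + b\<close>.\<close>

definition torus :: "'k::field \<Rightarrow> expo \<Rightarrow> (expo, 'k) lop" where
  "torus p a = Abs_lop (\<lambda>x e. p powi qform a (e - a) * x (e - a))"

lemma Rep_torus: "Rep_lop (torus p a) = (\<lambda>x e. p powi qform a (e - a) * x (e - a))"
  unfolding torus_def by (subst Abs_lop_inverse) (simp_all add: algebra_simps)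

text \<open>The value at the delta function of 0. Since \<open>torus p a\<close> sends it to the
  delta function of \<open>a\<close>, a combination of the \<open>torus p a\<close> is recovered
  from this value.\<close>

definition vac_coeff :: "(expo, 'k::field) lop \<Rightarrow> expo \<Rightarrow> 'k" where
  "vac_coeff f = Rep_lop f (\<lambda>e. if e = 0 then 1 else 0)"

lemma torus_twisted:
  assumes "(p :: 'k::field) \<noteq> 0"
  shows "twisted_expo lop_sc (torus p) (\<lambda>a b. p powi qform a b) vac_coeff"
proof
  fix a b :: expo
  show "torus p a * torus p b = lop_sc (p powi qform a b) (torus p (a + b))"
  proof -
    have "p powi qform a (e - a) * p powi qform b (e - a - b)
        = p powi qform a b * p powi qform (a + b) (e - (a + b))" for e
      using assms by (simp add: qform_add_left qform_add_right qform_diff_right qform_antisym[of b a] ac_simps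
          flip: power_int_add)
    then show ?thesis
      by (simp add: Rep_lop_inject[symmetric] Rep_lop_simps Rep_lop_sc Rep_torus fun_eq_iff
          mult.assoc[symmetric] diff_diff_add[symmetric])
  qed
qed (use assms in \<open>auto simp: Rep_lop_inject[symmetric] Rep_lop_simps Rep_lop_sc Rep_torus vac_coeff_def\<close>)

section \<open>Ideals generated in a subring\<close>

definition is_subring :: "'a::ring_1 set \<Rightarrow> bool" where
  "is_subring S \<longleftrightarrow> 0 \<in> S \<and> 1 \<in> S \<and> (\<forall>x\<in>S. - x \<in> S) \<and> (\<forall>x\<in>S. \<forall>y\<in>S. x + y \<in> S \<and> x * y \<in> S)"

lemma
  assumes "is_subring S"
  shows subring_0: "0 \<in> S" and subring_1: "1 \<in> S" and subring_uminus: "x \<in> S \<Longrightarrow> - x \<in> S"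
    and subring_add: "x \<in> S \<Longrightarrow> y \<in> S \<Longrightarrow> x + y \<in> S"
    and subring_mult: "x \<in> S \<Longrightarrow> y \<in> S \<Longrightarrow> x * y \<in> S"
    and subring_diff: "x \<in> S \<Longrightarrow> y \<in> S \<Longrightarrow> x - y \<in> S"
  using assms unfolding is_subring_def by (auto simp: diff_conv_add_uminus simp del: add_uminus_conv_diff)

lemma subring_sum: "is_subring S \<Longrightarrow> (\<And>x. x \<in> A \<Longrightarrow> f x \<in> S) \<Longrightarrow> sum f A \<in> S"
  by (induction A rule: infinite_finite_induct) (auto intro: subring_0 subring_add)

lemma subring_power: "is_subring S \<Longrightarrow> x \<in> S \<Longrightarrow> x ^ k \<in> S"
  by (induction k) (auto intro: subring_1 subring_mult)

lemma subring_prod_list: "is_subring S \<Longrightarrow> set xs \<subseteq> S \<Longrightarrow> prod_list xs \<in> S"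
  by (induction xs) (auto intro: subring_1 subring_mult)

lemma subring_prod:
  fixes f :: "'b \<Rightarrow> 'a::comm_ring_1"
  shows "is_subring S \<Longrightarrow> (\<And>x. x \<in> A \<Longrightarrow> f x \<in> S) \<Longrightarrow> prod f A \<in> S"
  by (induction A rule: infinite_finite_induct) (auto intro: subring_1 subring_mult)

lemma subring_of_int: "is_subring S \<Longrightarrow> of_int k \<in> S"
proof -
  assume S: "is_subring S"
  have n: "of_nat k \<in> S" for k by (induction k) (auto intro: subring_0[OF S] subring_1[OF S] subring_add[OF S])
  show ?thesis by (cases k rule: int_cases2) (auto intro: n subring_uminus[OF S])
qed

lemma gen_ideal_superset: "G \<subseteq> gen_ideal S G"
  by (auto simp: gen_ideal_def)

lemma gen_ideal_least: "ideal_in S J \<Longrightarrow> G \<subseteq> J \<Longrightarrow> gen_ideal S G \<subseteq> J"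
  by (auto simp: gen_ideal_def)

lemma ideal_gen_ideal:
  assumes "is_subring S" "G \<subseteq> S"
  shows "ideal_in S (gen_ideal S G)"
proof -
  have "ideal_in S S" using assms(1) by (auto simp: ideal_in_def is_subring_def)
  then have "gen_ideal S G \<subseteq> S" using gen_ideal_least assms(2) by blast
  then show ?thesis unfolding ideal_in_def gen_ideal_def by blast
qed

lemma
  assumes "ideal_in S J"
  shows ideal_subset: "J \<subseteq> S" and ideal_0: "0 \<in> J"
    and ideal_add: "x \<in> J \<Longrightarrow> y \<in> J \<Longrightarrow> x + y \<in> J"
    and ideal_mult_left: "a \<in> S \<Longrightarrow> x \<in> J \<Longrightarrow> a * x \<in> J"
    and ideal_mult_right: "a \<in> S \<Longrightarrow> x \<in> J \<Longrightarrow> x * a \<in> J"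
  using assms unfolding ideal_in_def by auto

lemma ideal_diff: "is_subring S \<Longrightarrow> ideal_in S J \<Longrightarrow> x \<in> J \<Longrightarrow> y \<in> J \<Longrightarrow> x - y \<in> J"
  using ideal_add[of S J x "- y"] ideal_mult_left[of S J "- 1" y] subring_uminus[of S 1] subring_1[of S] by simp

lemma ideal_uminus: "is_subring S \<Longrightarrow> ideal_in S J \<Longrightarrow> x \<in> J \<Longrightarrow> - x \<in> J"
  using ideal_diff[of S J 0 x] ideal_0[of S J] by simp

section \<open>Straightening in the quantum matrix algebra\<close>

definition word :: "(nat \<times> nat) list \<Rightarrow> 'k::ring_1 free_alg" where
  "word u = single (FW u) 1"

lemma word_append: "word (u @ v) = word u * word v"
  by (simp add: word_def mult_single)

lemma X_eq_word: "X i j = word [(i, j)]"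
  by (simp add: X_def word_def)

lemma fsc_mult_left: "fsc (c :: 'k::comm_ring_1) * f = f * fsc c"
proof -
  have "fsc c * f = (\<Sum>w\<in>keys f. single (FW []) c * single w (lookup f w))"
    by (simp add: fsc_def poly_mapping_sum_single flip: sum_distrib_left)
  also have "\<dots> = (\<Sum>w\<in>keys f. single w (lookup f w) * single (FW []) c)"
    by (simp add: mult_single mult.commute flip: zero_fword_def)
  also have "\<dots> = f * fsc c"
    by (simp add: fsc_def poly_mapping_sum_single flip: sum_distrib_right)
  finally show ?thesis .
qed

lemma fsc_mult: "fsc c * fsc d = fsc (c * d)"
  by (simp add: fsc_def mult_single)

lemma fsc_1 [simp]: "fsc 1 = 1"
  by (simp add: fsc_def flip: zero_fword_def)

lemma fsc_0 [simp]: "fsc 0 = 0"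
  by (simp add: fsc_def)

lemma fsc_uminus: "fsc (- c) = - fsc c"
  by (simp add: fsc_def single_uminus)

lemma single_eq_fsc_word: "single (FW u) c = fsc c * word u"
  by (simp add: fsc_def word_def mult_single)

abbreviation square :: "nat \<Rightarrow> (nat \<times> nat) set" where
  "square n \<equiv> {1..n} \<times> {1..n}"

lemma word_Fcar [simp]: "set u \<subseteq> square n \<Longrightarrow> word u \<in> Fcar n"
  by (auto simp: Fcar_def word_def split: if_splits)

lemma subring_Fcar: "is_subring (Fcar n :: 'k::ring_1 free_alg set)"
  unfolding is_subring_def
proof (intro conjI ballI)
  fix f g :: "'k free_alg" assume *: "f \<in> Fcar n" "g \<in> Fcar n"
  show "f + g \<in> Fcar n"
    using * keys_add[of f g] by (auto simp: Fcar_def)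
  show "f * g \<in> Fcar n"
    unfolding Fcar_def
  proof (intro CollectI ballI allI impI)
    fix w a assume w: "w \<in> keys (f * g)" "w = FW a"
    obtain u v where uv: "FW u \<in> keys f" "FW v \<in> keys g" "FW a = FW u + FW v"
    proof -
      obtain x y where "x \<in> keys f" "y \<in> keys g" "FW a = x + y"
        using w keys_mult[of f g] by auto
      then show ?thesis using that by (cases x; cases y) auto
    qed
    then have "a = u @ v" by simp
    moreover have "set u \<subseteq> square n" "set v \<subseteq> square n" using uv * by (auto simp: Fcar_def)
    ultimately show "set a \<subseteq> square n" by auto
  qed
qed (auto simp: Fcar_def zero_fword_def)

lemma X_Fcar: "i \<in> {1..n} \<Longrightarrow> j \<in> {1..n} \<Longrightarrow> X i j \<in> Fcar n"
  by (simp add: X_eq_word)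

lemma fsc_Fcar [simp]: "fsc c \<in> Fcar n"
  by (auto simp: Fcar_def fsc_def)

lemma qrels_Fcar: "qrels n q \<subseteq> Fcar n"
  unfolding qrels_def
  by (auto intro!: subring_diff[OF subring_Fcar] subring_mult[OF subring_Fcar] X_Fcar)

lemma ideal_Jq: "ideal_in (Fcar n) (Jq n q)"
  unfolding Jq_def by (rule ideal_gen_ideal[OF subring_Fcar qrels_Fcar])

text \<open>The condition on \<open>d\<close> is what makes straightening terminate: if the
  correction term occurs, its first letter \<open>(i, l)\<close> is smaller than
  \<open>(k, l)\<close>.\<close>

lemma Jq_swap:
  assumes "(q :: 'k::field) \<noteq> 0" "(i, j) \<in> square n" "(k, l) \<in> square n" "(i, j) < (k, l)"
  shows "\<exists>c d. X k l * X i j - (fsc c * (X i j * X k l) + fsc d * (X i l * X k j)) \<in> Jq n q \<and> (d \<noteq> 0 \<longrightarrow> i < k)"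
proof -
  have rel: "r \<in> qrels n q \<Longrightarrow> r \<in> Jq n q" for r
    unfolding Jq_def using gen_ideal_superset by blast
  have neg: "r \<in> Jq n q \<Longrightarrow> - r \<in> Jq n q" for r
    using ideal_uminus[OF subring_Fcar ideal_Jq] by blast
  have q: "X k l * X i j - fsc (inverse q) * (X i j * X k l) \<in> Jq n q"
    if "X i j * X k l - fsc q * X k l * X i j \<in> qrels n q"
  proof -
    have "fsc (- inverse q) * (X i j * X k l - fsc q * X k l * X i j) \<in> Jq n q"
      by (rule ideal_mult_left[OF ideal_Jq]) (use rel[OF that] in auto)
    moreover have "fsc (- inverse q) * (X i j * X k l - fsc q * X k l * X i j)
        = X k l * X i j - fsc (inverse q) * (X i j * X k l)"
      using assms(1) by (simp add: right_diff_distrib mult.assoc[symmetric] fsc_mult fsc_uminus)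
    ultimately show ?thesis by simp
  qed
  consider "i = k" "j < l" | "i < k" "j = l" | "i < k" "l < j" | "i < k" "j < l"
  proof -
    have "i < k \<or> i = k \<and> j < l" using assms(4) by (auto simp: less_prod_def)
    then show ?thesis using that by (cases j l rule: linorder_cases) blast+
  qed
  then show ?thesis
  proof cases
    case 1
    then have "X i j * X k l - fsc q * X k l * X i j \<in> qrels n q"
      using assms unfolding qrels_def by blast
    from q[OF this] show ?thesis by (intro exI[of _ "inverse q"] exI[of _ 0]) simp
  next
    case 2
    then have "X i j * X k l - fsc q * X k l * X i j \<in> qrels n q"
      using assms unfolding qrels_def by blast
    from q[OF this] show ?thesis by (intro exI[of _ "inverse q"] exI[of _ 0]) simp
  next
    case 3
    then have "X i j * X k l - X k l * X i j \<in> qrels n q"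
      using assms unfolding qrels_def by blast
    from neg[OF rel[OF this]] show ?thesis by (intro exI[of _ 1] exI[of _ 0]) simp
  next
    case 4
    then have "X i j * X k l - X k l * X i j - fsc (q - inverse q) * X i l * X k j \<in> qrels n q"
      using assms unfolding qrels_def by blast
    moreover define e where "e = q - inverse q"
    ultimately have "- (X i j * X k l - X k l * X i j - fsc e * X i l * X k j) \<in> Jq n q"
      using neg[OF rel] by blast
    also have "- (X i j * X k l - X k l * X i j - fsc e * X i l * X k j)
        = X k l * X i j - (fsc 1 * (X i j * X k l) + fsc (- e) * (X i l * X k j))"
      by (simp add: fsc_uminus mult.assoc)
    finally show ?thesis using 4 by blast
  qed
qed

definition straight :: "nat \<Rightarrow> 'k::ring_1 free_alg set" where
  "straight n = {g \<in> Fcar n. \<forall>w\<in>keys g. \<forall>u. w = FW u \<longrightarrow> sorted u}"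

lemma straight_add: "f \<in> straight n \<Longrightarrow> g \<in> straight n \<Longrightarrow> f + g \<in> straight n"
  using keys_add[of f g] subring_add[OF subring_Fcar, of f n g] by (auto simp: straight_def)

lemma straight_fsc: 
  fixes g :: "'k::field free_alg"
  assumes "g \<in> straight n" shows "fsc c * g \<in> straight n"
proof -
  have "keys (fsc c * g) \<subseteq> keys g"
    by (auto simp: fsc_def mult_map_scale_conv_mult[symmetric] in_keys_iff Poly_Mapping.map.rep_eq
        simp flip: zero_fword_def)
  moreover have "fsc c * g \<in> Fcar n"
    using assms by (intro subring_mult[OF subring_Fcar]) (auto simp: straight_def)
  ultimately show ?thesis using assms by (auto simp: straight_def)
qed

lemma word_straighten:
  assumes "(q :: 'k::field) \<noteq> 0" "set u \<subseteq> square n"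
  shows "\<exists>g\<in>straight n. word u - g \<in> Jq n q"
proof -
  \<comment> \<open>Words of equal length are compared at the first place where they differ. At the
    descent, both the swapped word and the correction word have a smaller letter than
    \<open>u\<close>.\<close>
  let ?r = "lex {(a, b :: nat \<times> nat). a < b}"
  have "wf {(a, b :: nat \<times> nat). a < b}"
  proof (rule wfUNIVI)
    fix P :: "nat \<times> nat \<Rightarrow> bool" and x
    assume *: "\<forall>x. (\<forall>y. (y, x) \<in> {(a, b). a < b} \<longrightarrow> P y) \<longrightarrow> P x"
    show "P x"
    proof (induction x rule: less_induct)
      case (less x)
      show ?case by (rule *[rule_format]) (use less in simp)
    qed
  qed
  then have "wf ?r" by (rule wf_lex)
  then show ?thesis using assms(2)
  proof (induction u rule: wf_induct_rule)
    case (less u)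
    show ?case
    proof (cases "sorted u")
      case True
      then have "word u \<in> straight n"
        using less.prems word_Fcar[of u n] by (auto simp: straight_def word_def split: if_splits)
      then show ?thesis using ideal_0[OF ideal_Jq] by (intro bexI[of _ "word u"]) auto
    next
      case False
      then obtain x where x: "Suc x < length u" "\<not> u ! x \<le> u ! Suc x"
        by (auto simp: sorted_iff_nth_Suc)
      define u1 u2 where "u1 = take x u" and "u2 = drop (Suc (Suc x)) u"
      obtain i j k l where ij: "u ! Suc x = (i, j)" "u ! x = (k, l)" by (metis surj_pair)
      have u: "u = u1 @ [(k, l), (i, j)] @ u2"
        using x(1) ij unfolding u1_def u2_def
        by (metis Cons_nth_drop_Suc Suc_lessD append_Cons append_Nil append_take_drop_id)
      have lt: "(i, j) < (k, l)" using x(2) unfolding ij not_le .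
      have sq: "set u1 \<subseteq> square n" "set u2 \<subseteq> square n" "(i, j) \<in> square n" "(k, l) \<in> square n"
        using less.prems u by auto
      obtain c d where cd: "X k l * X i j - (fsc c * (X i j * X k l) + fsc d * (X i l * X k j)) \<in> Jq n q"
        "d \<noteq> 0 \<longrightarrow> i < k" using Jq_swap[OF assms(1) sq(3,4) lt] by blast
      define v w where "v = u1 @ [(i, j), (k, l)] @ u2" and "w = u1 @ [(i, l), (k, j)] @ u2"
      have "word u1 * (X k l * X i j - (fsc c * (X i j * X k l) + fsc d * (X i l * X k j))) * word u2 \<in> Jq n q"
        by (intro ideal_mult_left[OF ideal_Jq] ideal_mult_right[OF ideal_Jq] cd word_Fcar sq)
      moreover have "word u1 * (fsc e * y) * word u2 = fsc e * (word u1 * y * word u2)" for e :: 'k and y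
        by (simp add: mult.assoc[symmetric] fsc_mult_left[of e "word u1"])
      ultimately have 1: "word u - (fsc c * word v + fsc d * word w) \<in> Jq n q"
        by (simp add: u v_def w_def word_append X_eq_word left_diff_distrib right_diff_distrib
            distrib_left distrib_right flip: word_append)
      have "(v, u) \<in> ?r"
        unfolding u v_def using lt by (intro lex_append_leftI) auto
      then obtain g where g: "g \<in> straight n" "word v - g \<in> Jq n q"
        using less.IH[of v] sq by (auto simp: v_def)
      have "\<exists>h\<in>straight n. fsc d * word w - h \<in> Jq n q"
      proof (cases "d = 0")
        case True
        then show ?thesis using ideal_0[OF ideal_Jq] subring_0[OF subring_Fcar]
          by (intro bexI[of _ 0]) (auto simp: straight_def)
      next
        case False
        then have "(i, l) < (k, l)" using cd(2) by (simp add: less_prod_def)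
        then have "(w, u) \<in> ?r"
          unfolding u w_def by (intro lex_append_leftI) auto
        then obtain h where h: "h \<in> straight n" "word w - h \<in> Jq n q"
          using less.IH[of w] sq by (auto simp: w_def)
        have "fsc d * (word w - h) \<in> Jq n q"
          by (rule ideal_mult_left[OF ideal_Jq]) (use h in auto)
        then show ?thesis using straight_fsc[OF h(1), of d] by (auto simp: right_diff_distrib)
      qed
      then obtain h where h: "h \<in> straight n" "fsc d * word w - h \<in> Jq n q" by blast
      have "fsc c * (word v - g) \<in> Jq n q"
        by (rule ideal_mult_left[OF ideal_Jq]) (use g in auto)
      then have "word u - (fsc c * word v + fsc d * word w) + (fsc c * (word v - g) + (fsc d * word w - h)) \<in> Jq n q"
        by (intro ideal_add[OF ideal_Jq] 1 h)
      then have "word u - (fsc c * g + h) \<in> Jq n q"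
        by (simp add: algebra_simps)
      then show ?thesis using straight_add[OF straight_fsc[OF g(1)] h(1)] by blast
    qed
  qed
qed

lemma straighten:
  assumes "(q :: 'k::field) \<noteq> 0" "f \<in> Fcar n"
  shows "\<exists>g\<in>straight n. f - g \<in> Jq n q"
proof -
  have "\<exists>g\<in>straight n. (\<Sum>w\<in>A. single w (lookup f w)) - g \<in> Jq n q"
    if "finite A" "A \<subseteq> keys f" for A
    using that
  proof (induction A rule: finite_induct)
    case empty
    show ?case using ideal_0[OF ideal_Jq] subring_0[OF subring_Fcar]
      by (intro bexI[of _ 0]) (auto simp: straight_def)
  next
    case (insert w A)
    obtain u where w: "w = FW u" by (cases w)
    then have "set u \<subseteq> square n" using insert.prems assms(2) by (auto simp: Fcar_def)
    then obtain g where g: "g \<in> straight n" "word u - g \<in> Jq n q"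
      using word_straighten[OF assms(1)] by blast
    obtain h where h: "h \<in> straight n" "(\<Sum>w\<in>A. single w (lookup f w)) - h \<in> Jq n q"
      using insert by auto
    let ?c = "lookup f w"
    have "fsc ?c * (word u - g) + ((\<Sum>w\<in>A. single w (lookup f w)) - h) \<in> Jq n q"
      by (intro ideal_add[OF ideal_Jq] ideal_mult_left[OF ideal_Jq] g h fsc_Fcar)
    then show ?case using insert straight_add[OF straight_fsc[OF g(1), of ?c] h(1)]
      by (intro bexI[of _ "fsc ?c * g + h"]) (simp_all add: w single_eq_fsc_word algebra_simps)
  qed
  from this[OF finite_keys subset_refl] show ?thesis by (simp add: poly_mapping_sum_single)
qed

section \<open>Embedding the quantum matrix algebra into the quantum torus\<close>

locale quantum_matrices =
  fixes q :: "'k::field" and n m :: nat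
  assumes root: "root_of_unity_order q m" and odd_m: "odd m"
begin

text \<open>This square root of \<open>q\<close> is an \<open>m\<close>-th root of unity; normalizing the torus with it makes the \<open>m\<close>-th power
  of the monomial of exponent \<open>a\<close> equal to the monomial of exponent \<open>m a\<close>.\<close>
definition p :: 'k where "p = q ^ ((m + 1) div 2)"

lemma q_m: "q ^ m = 1" and m_pos: "m > 0"
  using root by (auto simp: root_of_unity_order_def)

lemma q_nonzero: "q \<noteq> 0"
  using q_m m_pos by (auto simp: power_0_left)

lemma p_nonzero: "p \<noteq> 0"
  using q_nonzero by (simp add: p_def)

lemma p_square: "p * p = q"
proof -
  have "p * p = q ^ (m + 1)"
    using odd_m by (auto simp: p_def power_add[symmetric] mult_2[symmetric] elim!: oddE)
  then show ?thesis using q_m by simp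
qed

lemma p_m: "p ^ m = 1"
  unfolding p_def power_mult[symmetric] by (subst mult.commute) (simp add: power_mult q_m)

lemma q_powi_eq_1_iff: "q powi k = 1 \<longleftrightarrow> int m dvd k"
proof
  assume *: "q powi k = 1"
  have "q powi k = q powi (int m * (k div int m) + k mod int m)" by simp
  also have "\<dots> = q powi (k mod int m)"
    using q_nonzero q_m by (subst power_int_add) (auto simp: power_int_mult)
  also have "\<dots> = q ^ nat (k mod int m)"
    using m_pos by (simp add: power_int_def)
  finally have "q ^ nat (k mod int m) = 1" using * by simp
  moreover have "nat (k mod int m) < m" using m_pos by (simp add: nat_less_iff)
  ultimately have "nat (k mod int m) = 0"
    using root unfolding root_of_unity_order_def by (metis gr0I)
  then have "k mod int m = 0" using m_pos pos_mod_sign[of "int m" k] by linarith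
  then show "int m dvd k" by auto
qed (auto simp: power_int_mult q_m)

lemma p_powi_eq_1: "int m dvd k \<Longrightarrow> p powi k = 1"
  by (auto simp: power_int_mult p_m)

lemma p_powi_double: "p powi k * p powi k = q powi k"
  by (simp add: power_int_mult_distrib[symmetric] p_square)

sublocale tor: twisted_expo lop_sc "torus p" "\<lambda>a b. p powi qform a b" vac_coeff
  by (rule torus_twisted[OF p_nonzero])

sublocale qlop: qkalg "lop_sc :: 'k \<Rightarrow> (expo, 'k) lop \<Rightarrow> (expo, 'k) lop" q
  by standard (rule q_nonzero)

lemma torus_qc: "qlop.qc (qform a b) (torus p a) (torus p b)"
proof -
  have "q powi qform a b * p powi qform b a = p powi qform a b"
    using p_nonzero by (simp add: p_powi_double[symmetric] qform_antisym[of b a] power_int_minus)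
  then show ?thesis by (simp add: qlop.qc_def tor.T_mult add.commute[of b a])
qed

lemma torus_inverse: "torus p a * torus p (- a) = 1" "torus p (- a) * torus p a = 1"
  by (simp_all add: tor.T_mult qform_uminus_left qform_uminus_right)

abbreviation t :: "nat \<Rightarrow> nat \<Rightarrow> (expo, 'k) lop" where
  "t i j \<equiv> torus p (single (i, j) 1)"

abbreviation t' :: "nat \<Rightarrow> nat \<Rightarrow> (expo, 'k) lop" where
  "t' i j \<equiv> torus p (- single (i, j) 1)"

sublocale qg: grid lop_sc q t t'
proof
  fix i j k l
  show "t i j * t' i j = 1" "t' i j * t i j = 1" by (rule torus_inverse)+
  show "qlop.qc ((if j = l then sgn (int k - int i) else 0) + (if i = k then sgn (int l - int j) else 0)) (t i j) (t k l)"
    using torus_qc[of "single (i, j) 1" "single (k, l) 1"] by (simp add: qform_single)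
qed

abbreviation x :: "nat \<Rightarrow> nat \<Rightarrow> (expo, 'k) lop" where
  "x i j \<equiv> px t t' n n i j"

lemma x_lead:
  assumes "(i, j) \<in> square n"
  shows "tor.lead (x i j) (single (i, j) 1) 1"
  by (rule tor.path_lead) (use assms torus_inverse in auto)

definition ev_word :: "(nat \<times> nat) fword \<Rightarrow> (expo, 'k) lop" where
  "ev_word w = (case w of FW u \<Rightarrow> prod_list (map (\<lambda>v. x (fst v) (snd v)) u))"

definition ev :: "'k free_alg \<Rightarrow> (expo, 'k) lop" where
  "ev = lop.lin ev_word"

lemma ev_word_add: "ev_word (v + w) = ev_word v * ev_word w"
  by (cases v; cases w) (simp add: ev_word_def)

lemma ev_mult: "ev (f * g) = ev f * ev g"
  unfolding ev_def by (rule lop.lin_mult) (rule ev_word_add)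

lemma ev_add: "ev (f + g) = ev f + ev g"
  and ev_diff: "ev (f - g) = ev f - ev g"
  and ev_sum: "ev (sum F A) = (\<Sum>a\<in>A. ev (F a))"
  and ev_0 [simp]: "ev 0 = 0"
  unfolding ev_def by (simp_all add: lop.lin_add lop.lin_diff lop.lin_sum)

lemma ev_fsc [simp]: "ev (fsc c) = lop_sc c 1"
  by (simp add: ev_def fsc_def ev_word_def)

lemma ev_1 [simp]: "ev 1 = 1"
  using ev_fsc[of 1] by (simp del: ev_fsc)

lemma ev_X [simp]: "ev (X i j) = x i j"
  by (simp add: ev_def X_def ev_word_def)

lemma ev_word [simp]: "ev (word u) = prod_list (map (\<lambda>v. x (fst v) (snd v)) u)"
  by (simp add: ev_def word_def ev_word_def)

lemma ev_power: "ev (f ^ k) = ev f ^ k"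
  by (induction k) (auto simp: ev_mult)

lemma ev_prod_list: "ev (prod_list (map F xs)) = prod_list (map (\<lambda>a. ev (F a)) xs)"
  by (induction xs) (auto simp: ev_mult)

lemma Jq_ev: "f \<in> Jq n q \<Longrightarrow> ev f = 0"
proof -
  have "ideal_in (Fcar n) {f \<in> Fcar n. ev f = 0}"
    unfolding ideal_in_def
    using subring_0[OF subring_Fcar] subring_add[OF subring_Fcar] subring_mult[OF subring_Fcar]
    by (auto simp: ev_add ev_mult)
  moreover have "qrels n q \<subseteq> {f \<in> Fcar n. ev f = 0}"
  proof -
    have "ev r = 0" if "r \<in> qrels n q" for r
    proof -
      note qm = qg.path_qmat[of n n]
      have 1: "ev (X i j * X k l - X k l * X i j - fsc (q - inverse q) * X i l * X k j) = 0"
        if "i \<in> {1..n}" "j \<in> {1..n}" "k \<in> {1..n}" "l \<in> {1..n}" "i < k" "j < l" for i j k l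
        using qlop.qmat_cross[OF qm, of i k j l] that by (simp add: ev_diff ev_mult)
      have 2: "ev (X i j * X k j - fsc q * X k j * X i j) = 0"
        if "i \<in> {1..n}" "j \<in> {1..n}" "k \<in> {1..n}" "i < k" for i j k
        using qlop.qmat_col[OF qm, of i k j] that by (simp add: ev_diff ev_mult qlop.qc_def)
      have 3: "ev (X i j * X i l - fsc q * X i l * X i j) = 0"
        if "i \<in> {1..n}" "j \<in> {1..n}" "l \<in> {1..n}" "j < l" for i j l
        using qlop.qmat_row[OF qm, of i j l] that by (simp add: ev_diff ev_mult qlop.qc_def)
      have 4: "ev (X i j * X k l - X k l * X i j) = 0"
        if "i \<in> {1..n}" "j \<in> {1..n}" "k \<in> {1..n}" "l \<in> {1..n}" "i < k" "l < j" for i j k l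
        using qlop.qmat_anti[OF qm, of i k j l] that by (simp add: ev_diff ev_mult qlop.qc_def)
      show ?thesis
        using that unfolding qrels_def
        by (elim UnE CollectE exE conjE) (simp_all only: 1 2 3 4)
    qed
    then show ?thesis using qrels_Fcar by blast
  qed
  ultimately have "Jq n q \<subseteq> {f \<in> Fcar n. ev f = 0}"
    unfolding Jq_def by (rule gen_ideal_least)
  then show "f \<in> Jq n q \<Longrightarrow> ev f = 0" by blast
qed

definition wt :: "(nat \<times> nat) list \<Rightarrow> expo" where
  "wt u = sum_list (map (\<lambda>v. single v 1) u)"

lemma lookup_wt: "lookup (wt u) v = int (count (mset u) v)"
  by (induction u) (auto simp: wt_def lookup_add lookup_single when_def)

lemma wt_inj: "sorted u \<Longrightarrow> sorted v \<Longrightarrow> wt u = wt v \<Longrightarrow> u = v"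
proof -
  assume s: "sorted u" "sorted v" "wt u = wt v"
  have "mset u = mset v"
    by (rule multiset_eqI) (metis lookup_wt of_nat_eq_iff s(3))
  then show "u = v" using s by (metis properties_for_sort)
qed

lemma word_lead:
  assumes "set u \<subseteq> square n"
  shows "\<exists>c. c \<noteq> 0 \<and> tor.lead (ev (word u)) (wt u) c"
  unfolding ev_word wt_def
  by (rule tor.lead_prod_list) (use assms x_lead in \<open>force intro!: exI[of _ 1]\<close>)

text \<open>A sorted word is determined by its multiset of letters, hence by the leading exponent of
  its image; so the leading terms of different sorted words cannot cancel.\<close>

lemma straight_lead:
  assumes "g \<in> straight n" "g \<noteq> 0"
  shows "\<exists>u c. set u \<subseteq> square n \<and> c \<noteq> 0 \<and> tor.lead (ev g) (wt u) c"
proof -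
  define a where "a w = (case w of FW u \<Rightarrow> wt u)" for w
  have w: "\<exists>c. c \<noteq> 0 \<and> tor.lead (lop_sc (lookup g w) (ev_word w)) (a w) c"
    if w: "w \<in> keys g" for w
  proof -
    obtain u where u: "w = FW u" by (cases w)
    then have "set u \<subseteq> square n" using assms(1) w by (auto simp: straight_def Fcar_def)
    then obtain c where c: "c \<noteq> 0" "tor.lead (ev_word w) (wt u) c"
      using word_lead[of u] u by (auto simp: ev_word_def)
    then have "tor.lead (lop_sc (lookup g w) (ev_word w)) (a w) (lookup g w * c)"
      using u by (simp add: tor.lead_sc a_def)
    moreover have "lookup g w * c \<noteq> 0" using w c by (simp add: in_keys_iff)
    ultimately show ?thesis by blast
  qed
  then obtain c where c: "\<And>w. w \<in> keys g \<Longrightarrow> c w \<noteq> 0 \<and>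
      tor.lead (lop_sc (lookup g w) (ev_word w)) (a w) (c w)" by metis
  have "inj_on a (keys g)"
  proof (rule inj_onI)
    fix v w assume vw: "v \<in> keys g" "w \<in> keys g" "a v = a w"
    obtain u u' where u: "v = FW u" "w = FW u'" by (cases v; cases w)
    then have "sorted u" "sorted u'" "wt u = wt u'" using vw assms(1) by (auto simp: straight_def a_def)
    then show "v = w" using u wt_inj by blast
  qed
  moreover have "keys g \<noteq> {}" using assms(2) by simp
  ultimately obtain w where w: "w \<in> keys g" "tor.lead (ev g) (a w) (c w)"
    using tor.lead_sum[OF finite_keys, of g a "\<lambda>w. lop_sc (lookup g w) (ev_word w)" c] c
    by (auto simp: ev_def lop.lin_def)
  obtain u where u: "w = FW u" by (cases w)
  then have "set u \<subseteq> square n" using assms(1) w by (auto simp: straight_def Fcar_def)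
  then show ?thesis using w c u by (auto simp: a_def)
qed

lemma ev_lead:
  assumes "f \<in> Fcar n" "f \<notin> Jq n q"
  shows "\<exists>u c. set u \<subseteq> square n \<and> c \<noteq> 0 \<and> tor.lead (ev f) (wt u) c"
proof -
  obtain g where g: "g \<in> straight n" "f - g \<in> Jq n q"
    using straighten[OF q_nonzero assms(1)] by blast
  then have "ev f = ev g" using Jq_ev[OF g(2)] by (simp add: ev_diff)
  moreover have "g \<noteq> 0" using assms(2) g(2) by auto
  ultimately show ?thesis using straight_lead[OF g(1)] by simp
qed

text \<open>Modulo \<open>Jq\<close> every element is straight, and a nonzero straight element has a
  nonzero leading term. From here on membership in \<open>Jq\<close> is tested in the torus.\<close>

theorem ev_eq_0_iff: "f \<in> Fcar n \<Longrightarrow> ev f = 0 \<longleftrightarrow> f \<in> Jq n q"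
  using ev_lead[of f] Jq_ev[of f] tor.lead_nonzero by blast

text \<open>The products with \<open>x i j\<close> in the two orders have the same leading exponent,
  with coefficients that differ by \<open>q powi qform a (single v 1)\<close>; centrality forces
  this power to be 1.\<close>

lemma centre_lead:
  assumes f: "f \<in> centre_reps n q" "tor.lead (ev f) a c" "c \<noteq> 0" and v: "v \<in> square n"
  shows "int m dvd qform a (single v 1)"
proof -
  obtain i j where ij: "v = (i, j)" by (cases v)
  let ?e = "single v 1"
  have "f * X i j - X i j * f \<in> Jq n q"
    using f(1) X_Fcar[of i n j] v ij by (auto simp: centre_reps_def)
  from Jq_ev[OF this] have comm: "ev f * x i j = x i j * ev f" by (simp add: ev_diff ev_mult)
  have xl: "tor.lead (x i j) ?e 1" using x_lead v ij by simp
  have "c * p powi qform a ?e = c * p powi qform ?e a"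
    using tor.lead_\<kappa>[OF tor.lead_mult[OF f(2) xl]] tor.lead_\<kappa>[OF tor.lead_mult[OF xl f(2)]] comm
    by (simp add: add.commute)
  then have "p powi qform a ?e = p powi qform ?e a" using f(3) by simp
  then have "p powi qform a ?e * p powi qform a ?e = p powi qform a ?e * p powi (- qform a ?e)"
    by (simp add: qform_antisym[of ?e a])
  also have "\<dots> = 1" using p_nonzero by (simp add: power_int_minus)
  finally show ?thesis by (simp add: p_powi_double q_powi_eq_1_iff)
qed

end

section \<open>Inversions and signs\<close>

text \<open>Increasing values give \<open>a \<le> \<pi> a\<close>, and the sum over all positions
  equals the sum over all values.\<close>

lemma permutes_increasing_id:
  assumes "\<pi> permutes {0..<s}" "\<And>a. Suc a < s \<Longrightarrow> \<pi> a < \<pi> (Suc a)"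
  shows "\<pi> = id"
proof -
  have le: "a \<le> \<pi> a" if "a < s" for a
    using that
  proof (induction a)
    case (Suc a)
    then show ?case using assms(2)[of a] by simp
  qed simp
  have "(\<Sum>a\<in>{0..<s}. a) = (\<Sum>a\<in>{0..<s}. \<pi> a)"
    using sum.permute[OF assms(1), of "\<lambda>a. a"] by (simp add: comp_def)
  then have "a = \<pi> a" if "a < s" for a
    using sum_mono_inv[of "\<lambda>a. a" "{0..<s}" \<pi> a] le that by auto
  moreover have "\<pi> a = a" if "\<not> a < s" for a
    using assms(1) that by (simp add: permutes_def)
  ultimately show ?thesis by (metis eq_id_iff)
qed

text \<open>An adjacent transposition at a descent removes one inversion and flips the sign. This
  identifies the quantum determinant at \<open>q = 1\<close> with the signed sum in
  \<open>detZ\<close>.\<close>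

lemma sign_eq_inversions:
  assumes "\<pi> permutes {0..<s}"
  shows "sign \<pi> = (- 1) ^ inversions s \<pi>"
  using assms
proof (induction "inversions s \<pi>" arbitrary: \<pi> rule: less_induct)
  case less
  show ?case
  proof (cases "\<exists>a. Suc a < s \<and> \<not> \<pi> a < \<pi> (Suc a)")
    case True
    then obtain a where a: "Suc a < s" "\<not> \<pi> a < \<pi> (Suc a)" by blast
    let ?\<tau> = "Transposition.transpose a (Suc a)"
    have \<tau>: "?\<tau> permutes {0..<s}" using a(1) by (intro permutes_swap_id) auto
    have "\<pi> a \<noteq> \<pi> (Suc a)" using injD[OF permutes_inj[OF less.prems], of a "Suc a"] by auto
    then have "inversions s ((\<pi> \<circ> ?\<tau>) \<circ> ?\<tau>) = Suc (inversions s (\<pi> \<circ> ?\<tau>))"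
      using a by (intro inversions_transpose) auto
    then have inv: "inversions s \<pi> = Suc (inversions s (\<pi> \<circ> ?\<tau>))"
      by (simp add: comp_assoc)
    have "sign (\<pi> \<circ> ?\<tau>) = (- 1) ^ inversions s (\<pi> \<circ> ?\<tau>)"
      by (rule less.hyps) (use inv permutes_compose[OF \<tau> less.prems] in auto)
    moreover have "sign (\<pi> \<circ> ?\<tau>) = sign \<pi> * sign ?\<tau>"
      using permutation_permutes[of \<pi>] permutation_permutes[of ?\<tau>] less.prems \<tau>
      by (intro sign_compose) (auto simp: permutation_permutes intro: finite_atLeastLessThan)
    ultimately show ?thesis by (simp add: inv sign_swap_id)
  next
    case False
    then have "\<pi> = id" using permutes_increasing_id[OF less.prems] by blast
    moreover have "{(a, b). a < b \<and> b < s \<and> id a > id b} = {}" by auto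
    then have "inversions s id = 0" by (simp only: inversions_def card.empty)
    ultimately show ?thesis by (simp only: sign_id power_0)
  qed
qed

section \<open>Diagonal exponents\<close>

definition diag :: "nat \<Rightarrow> nat \<Rightarrow> nat \<Rightarrow> expo" where
  "diag i j h = (\<Sum>a<h. single (i + a, j + a) 1)"

lemma lookup_diag: "lookup (diag i j h) (k, l) = (if i \<le> k \<and> k < i + h \<and> l + i = j + k then 1 else 0)"
proof -
  have "lookup (diag i j h) (k, l) = (\<Sum>a<h. if a = k - i then (if i \<le> k \<and> l + i = j + k then 1 else 0) else 0)"
    unfolding diag_def lookup_sum by (intro sum.cong refl) (auto simp: lookup_single when_def)
  also have "\<dots> = (if i \<le> k \<and> k < i + h \<and> l + i = j + k then 1 else 0)"
    by (subst sum.delta) auto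
  finally show ?thesis .
qed

lemma keys_diag: "i \<ge> 1 \<Longrightarrow> j \<ge> 1 \<Longrightarrow> i + h \<le> n + 1 \<Longrightarrow> j + h \<le> n + 1 \<Longrightarrow> keys (diag i j h) \<subseteq> square n"
  by (auto simp: in_keys_iff lookup_diag split: if_splits)

lemma qform_diag_single:
  "qform (diag i j h) (single (k, l) 1) =
     (if j \<le> l \<and> l < j + h then sgn (int k - int i - int l + int j) else 0) +
     (if i \<le> k \<and> k < i + h then sgn (int l - int j - int k + int i) else 0)"
proof -
  have "qform (diag i j h) (single (k, l) 1) = (\<Sum>a<h. qsgn (i + a, j + a) (k, l))"
    by (simp add: diag_def qform_sum_left qform_single del: qsgn.simps)
  also have "\<dots> = (\<Sum>a<h. if a = l - j then (if j \<le> l then sgn (int k - int i - int l + int j) else 0) else 0)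
      + (\<Sum>a<h. if a = k - i then (if i \<le> k then sgn (int l - int j - int k + int i) else 0) else 0)"
  proof -
    have "(if j + a = l then sgn (int k - int (i + a)) else 0)
        = (if a = l - j then (if j \<le> l then sgn (int k - int i - int l + int j) else 0) else 0)" for a
      by (cases "j + a = l") (auto intro!: arg_cong[where f = sgn])
    moreover have "(if i + a = k then sgn (int l - int (j + a)) else 0)
        = (if a = k - i then (if i \<le> k then sgn (int l - int j - int k + int i) else 0) else 0)" for a
      by (cases "i + a = k") (auto intro!: arg_cong[where f = sgn])
    ultimately show ?thesis by (simp only: qsgn.simps sum.distrib)
  qed
  also have "\<dots> = (if j \<le> l \<and> l < j + h then sgn (int k - int i - int l + int j) else 0) +
     (if i \<le> k \<and> k < i + h then sgn (int l - int j - int k + int i) else 0)"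
    by (subst (1 2) sum.delta) auto
  finally show ?thesis .
qed

text \<open>The two diagonals share no row and no column.\<close>

lemma qform_diag_diag:
  assumes "i + h \<le> i'" "j' + h' \<le> j"
  shows "qform (diag i j h) (diag i' j' h') = 0"
  unfolding diag_def qform_sum_left qform_sum_right qform_single
  by (intro sum.neutral ballI) (use assms in auto)

lemma frag_cmul_single: "frag_cmul c (single v d) = single v (c * d)"
  by (rule poly_mapping_eqI) (simp add: lookup_single when_def)

lemma qform_frag_cmul_left: "qform (frag_cmul c a) b = c * qform a b"
proof -
  have "qform (frag_cmul c a) b = (\<Sum>u\<in>keys a. \<Sum>v\<in>keys b.
     lookup (frag_cmul c a) u * lookup b v * qsgn u v)"
    by (rule qform_superset) (auto simp: in_keys_iff)
  then show ?thesis by (simp add: qform_def sum_distrib_left mult.assoc)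
qed

lemma qform_frag_cmul_right: "qform a (frag_cmul c b) = c * qform a b"
  using qform_frag_cmul_left[of c b a] by (simp add: qform_antisym[of a])

lemma qform_single_right:
  assumes "keys a \<subseteq> square n" "(k, l) \<in> square n"
  shows "qform a (single (k, l) 1) =
    (\<Sum>i\<in>{1..n}. lookup a (i, l) * sgn (int k - int i)) +
    (\<Sum>j\<in>{1..n}. lookup a (k, j) * sgn (int l - int j))"
proof -
  have "qform a (single (k, l) 1) = (\<Sum>u\<in>square n. \<Sum>v\<in>{(k, l)}.
      lookup a u * lookup (single (k, l) (1::int)) v * qsgn u v)"
    by (rule qform_superset) (use assms in auto)
  also have "\<dots> = (\<Sum>(i, j)\<in>square n. lookup a (i, j) * qsgn (i, j) (k, l))"
    by (intro sum.cong) (auto simp del: qsgn.simps)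
  also have "\<dots> = (\<Sum>i\<in>{1..n}. \<Sum>j\<in>{1..n}. lookup a (i, j) * qsgn (i, j) (k, l))"
    by (rule sum.cartesian_product[symmetric])
  also have "\<dots> = (\<Sum>i\<in>{1..n}. \<Sum>j\<in>{1..n}. if j = l then lookup a (i, l) * sgn (int k - int i) else 0)
     + (\<Sum>i\<in>{1..n}. \<Sum>j\<in>{1..n}. if i = k then lookup a (k, j) * sgn (int l - int j) else 0)"
    unfolding sum.distrib[symmetric] by (intro sum.cong refl) (auto simp: distrib_left)
  also have "(\<Sum>i\<in>{1..n}. \<Sum>j\<in>{1..n}. if i = k then lookup a (k, j) * sgn (int l - int j) else 0)
    = (\<Sum>j\<in>{1..n}. \<Sum>i\<in>{1..n}. if i = k then lookup a (k, j) * sgn (int l - int j) else 0)"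
    by (rule sum.swap)
  finally show ?thesis using assms(2) by simp
qed

text \<open>The radical modulo \<open>m\<close> of the form on exponents supported in the square;
  its monomials commute with all torus monomials supported there.\<close>

definition rad :: "nat \<Rightarrow> nat \<Rightarrow> expo set" where
  "rad n m = {a. keys a \<subseteq> square n \<and> (\<forall>v\<in>square n. int m dvd qform a (single v 1))}"

lemma rad_dvd:
  assumes "a \<in> rad n m" "keys b \<subseteq> square n"
  shows "int m dvd qform a b"
proof -
  have "qform a b = (\<Sum>v\<in>keys b. qform a (single v (lookup b v)))"
    by (simp add: poly_mapping_sum_single flip: qform_sum_right)
  also have "\<dots> = (\<Sum>v\<in>keys b. lookup b v * qform a (single v 1))"
  proof (rule sum.cong[OF refl])
    fix v
    show "qform a (single v (lookup b v))
        = lookup b v * qform a (single v 1)"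
      using qform_frag_cmul_right[of a "lookup b v" "single v 1"]
      by (simp only: frag_cmul_single mult_1_right)
  qed
  finally show ?thesis
    using assms by (auto simp: rad_def intro!: dvd_sum dvd_mult)
qed

lemma rad_zero: "0 \<in> rad n m"
  by (simp add: rad_def)

lemma rad_add: "a \<in> rad n m \<Longrightarrow> b \<in> rad n m \<Longrightarrow> a + b \<in> rad n m"
  using keys_add[of a b] by (auto simp: rad_def qform_add_left)

lemma rad_cmul: "keys a \<subseteq> square n \<Longrightarrow> frag_cmul (int m * c) a \<in> rad n m"
  by (auto simp: rad_def qform_frag_cmul_left)

lemma rad_single: "v \<in> square n \<Longrightarrow> single v (int m) \<in> rad n m"
  "v \<in> square n \<Longrightarrow> - single v (int m) \<in> rad n m"
  using rad_cmul[of "single v 1" n m 1] rad_cmul[of "single v 1" n m "- 1"]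
  by (auto simp: frag_cmul_single single_uminus)

text \<open>Against the variable at \<open>(k, l)\<close>, the row and the column contribute
  opposite signs.\<close>

lemma rad_diag: "diag 1 1 n \<in> rad n m"
  using keys_diag[of 1 1 n n] by (auto simp: rad_def qform_diag_single sgn_if)

text \<open>The exponent of \<open>D(t)\<close> to the power \<open>r\<close> times the transpose of
  \<open>D(n - t)\<close> to the power \<open>m - r\<close>.\<close>

definition yexp :: "nat \<Rightarrow> nat \<Rightarrow> nat \<Rightarrow> nat \<Rightarrow> expo" where
  "yexp n m t r = frag_cmul (int r) (diag 1 (n - t + 1) t) + frag_cmul (int m - int r) (diag (t + 1) 1 (n - t))"

text \<open>The two diagonals have the same pairing with every variable of the square, so the
  weights \<open>r\<close> and \<open>m - r\<close> add up to \<open>m\<close> times that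
  pairing.\<close>

lemma rad_yexp:
  assumes "t \<in> {1..n-1}"
  shows "yexp n m t r \<in> rad n m"
proof -
  have keys: "keys (diag 1 (n - t + 1) t) \<subseteq> square n" "keys (diag (t + 1) 1 (n - t)) \<subseteq> square n"
    by (rule keys_diag; use assms in auto)+
  have eq: "qform (diag 1 (n - t + 1) t) (single (k, l) 1) = qform (diag (t + 1) 1 (n - t)) (single (k, l) 1)"
    if "(k, l) \<in> square n" for k l
    using assms that by (auto simp: qform_diag_single sgn_if of_nat_diff)
  have "qform (yexp n m t r) (single (k, l) 1)
      = int m * qform (diag (t + 1) 1 (n - t)) (single (k, l) 1)"
    if "(k, l) \<in> square n" for k l
    unfolding yexp_def qform_add_left qform_frag_cmul_left eq[OF that] by (simp add: algebra_simps)
  moreover have "keys (yexp n m t r) \<subseteq> square n"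
    unfolding yexp_def using keys
    by (intro order.trans[OF keys_add] Un_least order.trans[OF keys_cmul])
  ultimately show ?thesis by (auto simp: rad_def)
qed

section \<open>Evaluating commutative polynomials\<close>

definition meval :: "('v \<Rightarrow> 'b::comm_monoid_mult) \<Rightarrow> ('v \<Rightarrow>\<^sub>0 nat) \<Rightarrow> 'b" where
  "meval f \<mu> = (\<Prod>v\<in>keys \<mu>. f v ^ lookup \<mu> v)"

lemma meval_superset:
  "finite V \<Longrightarrow> keys \<mu> \<subseteq> V \<Longrightarrow> meval f \<mu> = (\<Prod>v\<in>V. f v ^ lookup \<mu> v)"
  unfolding meval_def by (rule prod.mono_neutral_left) (auto simp: in_keys_iff)

lemma meval_zero [simp]: "meval f 0 = 1"
  by (simp add: meval_def)

lemma meval_add: "meval f (\<mu> + \<nu>) = meval f \<mu> * meval f \<nu>"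
proof -
  let ?V = "keys \<mu> \<union> keys \<nu>"
  have "meval f \<xi> = (\<Prod>v\<in>?V. f v ^ lookup \<xi> v)" if "\<xi> \<in> {\<mu>, \<nu>, \<mu> + \<nu>}" for \<xi>
    by (rule meval_superset) (use that keys_add[of \<mu> \<nu>] in auto)
  then show ?thesis by (simp add: lookup_add power_add prod.distrib)
qed

lemma meval_single [simp]: "meval f (single v k) = f v ^ k"
  by (simp add: meval_def)

definition Pcar :: "var set \<Rightarrow> 'k::comm_ring_1 cpoly set" where
  "Pcar V = {f. \<forall>\<mu>\<in>keys f. keys \<mu> \<subseteq> V}"

lemma Tcar_eq_Pcar: "Tcar n m = Pcar (Tvars n m)"
  by (simp add: Tcar_def Pcar_def)

lemma subring_Pcar: "is_subring (Pcar V :: 'k::comm_ring_1 cpoly set)"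
  unfolding is_subring_def
proof (intro conjI ballI)
  fix f g :: "'k cpoly" assume *: "f \<in> Pcar V" "g \<in> Pcar V"
  show "f + g \<in> Pcar V" using * keys_add[of f g] by (auto simp: Pcar_def)
  show "f * g \<in> Pcar V"
    unfolding Pcar_def
  proof (intro CollectI ballI)
    fix \<mu> assume "\<mu> \<in> keys (f * g)"
    then obtain a b where "a \<in> keys f" "b \<in> keys g" "\<mu> = a + b"
      using keys_mult[of f g] by auto
    moreover from this have "keys a \<subseteq> V" "keys b \<subseteq> V"
      using * by (auto simp: Pcar_def)
    ultimately show "keys \<mu> \<subseteq> V"
      using keys_add[of a b] by blast
  qed
qed (auto simp: Pcar_def)

lemma subring_Tcar: "is_subring (Tcar n m :: 'k::comm_ring_1 cpoly set)"
  by (simp add: Tcar_eq_Pcar subring_Pcar)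

lemma Var_Pcar: "v \<in> V \<Longrightarrow> Var v \<in> Pcar V"
  by (auto simp: Pcar_def Var_def split: if_splits)

lemma Var_Tcar: "v \<in> Tvars n m \<Longrightarrow> Var v \<in> Tcar n m"
  by (simp add: Tcar_eq_Pcar Var_Pcar)

lemma const_Pcar [simp]: "single 0 c \<in> Pcar V"
  by (auto simp: Pcar_def)

lemma const_Tcar [simp]: "single 0 c \<in> Tcar n m"
  by (auto simp: Tcar_def)

lemma ZV_Tvars: "i \<in> {1..n} \<Longrightarrow> j \<in> {1..n} \<Longrightarrow> ZV i j \<in> Tvars n m"
  and YV_Tvars: "t \<in> {1..n-1} \<Longrightarrow> r \<in> {1..m-1} \<Longrightarrow> YV t r \<in> Tvars n m"
  and DV_Tvars: "DV \<in> Tvars n m"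
  by (auto simp: Tvars_def)

lemma detZ_Pcar: "length rows = length cols \<Longrightarrow> set rows \<subseteq> {1..n} \<Longrightarrow> set cols \<subseteq> {1..n} \<Longrightarrow> detZ rows cols \<in> Pcar {ZV i j | i j. (i, j) \<in> square n}"
  unfolding detZ_def
proof (intro subring_sum[OF subring_Pcar] subring_mult[OF subring_Pcar] subring_of_int[OF subring_Pcar]
    subring_prod[OF subring_Pcar] Var_Pcar)
  fix \<pi> a assume *: "length rows = length cols" "set rows \<subseteq> {1..n}" "set cols \<subseteq> {1..n}"
    "\<pi> \<in> {\<pi>. \<pi> permutes {0..<length rows}}" "a \<in> {0..<length rows}"
  then have "rows ! a \<in> {1..n}" by (meson atLeastLessThan_iff nth_mem subsetD)
  moreover have "\<pi> a < length cols" using * permutes_in_image[of \<pi> "{0..<length rows}" a] by simp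
  then have "cols ! \<pi> a \<in> {1..n}" using * nth_mem by blast
  ultimately show "ZV (rows ! a) (cols ! \<pi> a) \<in> {ZV i j | i j. (i, j) \<in> square n}" by blast
qed

lemma qminor_Fcar:
  assumes "length I = length J" "set I \<subseteq> {1..n}" "set J \<subseteq> {1..n}"
  shows "qminor q I J \<in> Fcar n" "qminor_tau q I J \<in> Fcar n"
proof -
  have "X (I ! a) (J ! \<pi> a) \<in> Fcar n" "X (J ! \<pi> a) (I ! a) \<in> Fcar n"
    if "\<pi> permutes {0..<length I}" "a < length I" for \<pi> a
  proof -
    have "\<pi> a < length J" using that assms(1) permutes_in_image[of \<pi> "{0..<length I}" a] by simp
    then have "J ! \<pi> a \<in> {1..n}" "I ! a \<in> {1..n}" using assms that(2) nth_mem by blast+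
    then show "X (I ! a) (J ! \<pi> a) \<in> Fcar n" "X (J ! \<pi> a) (I ! a) \<in> Fcar n" by (simp_all add: X_Fcar)
  qed
  note X = this
  show "qminor q I J \<in> Fcar n"
    unfolding qminor_def
    by (intro subring_sum[OF subring_Fcar] subring_mult[OF subring_Fcar] subring_prod_list[OF subring_Fcar] fsc_Fcar)
      (use X(1) in auto)
  show "qminor_tau q I J \<in> Fcar n"
    unfolding qminor_tau_def
    by (intro subring_sum[OF subring_Fcar] subring_mult[OF subring_Fcar] subring_prod_list[OF subring_Fcar] fsc_Fcar)
      (use X(2) in auto)
qed

context twisted
begin

lemma \<kappa>_lin: "\<kappa> (lin T f) a = lookup f a"
proof -
  have s: "\<kappa> (sum F A) a = (\<Sum>x\<in>A. \<kappa> (F x) a)" for F :: "'e \<Rightarrow> 'r" and A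
    by (induction A rule: infinite_finite_induct) (auto simp: \<kappa>_add)
  show ?thesis
    by (auto simp: lin_def s \<kappa>_sc \<kappa>_T in_keys_iff if_distrib[of "\<lambda>c. _ * c"] cong: if_cong)
qed

lemma lin_laurent_sc: "lin T (laurent_sc c f) = sc c (lin T f)"
  unfolding laurent_sc_def by (subst lin_mult) (auto split: if_splits)

end

section \<open>Torus values of the minors and the commutative model of the centre\<close>

context quantum_matrices
begin

lemma torus_power: "torus p a ^ k = torus p (frag_cmul (int k) a)"
proof (induction k)
  case (Suc k)
  have "frag_cmul (int (Suc k)) a = a + frag_cmul (int k) a"
    by (rule poly_mapping_eqI) (simp add: lookup_add algebra_simps)
  then show ?case by (simp add: Suc tor.T_mult qform_frag_cmul_right)
qed (simp add: frag_cmul_def)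

lemma torus_diag: "prod_list (map (\<lambda>a. t (i + a) (j + a)) [0..<h]) = torus p (diag i j h)"
proof (induction h)
  case (Suc h)
  have "qform (diag i j h) (single (i + h, j + h) 1) = 0"
    by (simp add: qform_diag_single)
  then show ?case by (simp add: Suc tor.T_mult diag_def)
qed (simp add: diag_def)

lemma x_minor_right:
  assumes "1 \<le> i" "i + h \<le> n + 1" "1 \<le> j" "j + h = n + 1" "1 \<le> h"
  shows "qlop.QD h (\<lambda>a b. x (i + a) (j + b)) = torus p (diag i j h)"
proof -
  obtain h' where h: "h = Suc h'" using assms(5) by (cases h) auto
  show ?thesis unfolding torus_diag[symmetric] h by (rule qg.minor_right_border) (use assms h in auto)
qed

lemma x_minor_bottom:
  assumes "1 \<le> i" "i + h = n + 1" "1 \<le> j" "j + h \<le> n + 1" "1 \<le> h"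
  shows "qlop.QD h (\<lambda>a b. x (i + b) (j + a)) = torus p (diag i j h)"
proof -
  obtain h' where h: "h = Suc h'" using assms(5) by (cases h) auto
  show ?thesis unfolding torus_diag[symmetric] h by (rule qg.minor_bottom_border) (use assms h in auto)
qed

lemma ev_qminor: "ev (qminor q I J) = qlop.QD (length I) (\<lambda>a b. x (I ! a) (J ! b))"
  by (simp add: qminor_def qlop.QD_def ev_sum ev_mult ev_prod_list)

lemma ev_qminor_tau: "ev (qminor_tau q I J) = qlop.QD (length I) (\<lambda>a b. x (J ! b) (I ! a))"
  by (simp add: qminor_tau_def qlop.QD_def ev_sum ev_mult ev_prod_list)

lemma ev_Dq: "n \<ge> 1 \<Longrightarrow> ev (Dq n q) = torus p (diag 1 1 n)"
proof -
  assume n: "n \<ge> 1"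
  have "ev (Dq n q) = qlop.QD n (\<lambda>a b. x (1 + a) (1 + b))"
    unfolding Dq_def ev_qminor length_upt add_diff_cancel_right'
    by (rule qlop.QD_cong) (simp del: upt_Suc)
  also have "\<dots> = torus p (diag 1 1 n)"
    by (rule x_minor_right) (use n in auto)
  finally show ?thesis .
qed

lemma ev_Dt: "s \<in> {1..n-1} \<Longrightarrow> ev (Dt n q s) = torus p (diag 1 (n - s + 1) s)"
proof -
  assume s: "s \<in> {1..n-1}"
  have "ev (Dt n q s) = qlop.QD s (\<lambda>a b. x (1 + a) (n - s + 1 + b))"
    unfolding Dt_def ev_qminor length_upt add_diff_cancel_right'
    by (rule qlop.QD_cong) (use s in \<open>simp del: upt_Suc\<close>)
  also have "\<dots> = torus p (diag 1 (n - s + 1) s)"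
    by (rule x_minor_right) (use s in auto)
  finally show ?thesis .
qed

lemma ev_tauDt: "s \<in> {1..n-1} \<Longrightarrow> ev (tauDt n q (n - s)) = torus p (diag (s + 1) 1 (n - s))"
proof -
  assume s: "s \<in> {1..n-1}"
  have "ev (tauDt n q (n - s)) = qlop.QD (n - s) (\<lambda>a b. x (s + 1 + b) (1 + a))"
    unfolding tauDt_def ev_qminor_tau length_upt add_diff_cancel_right'
    by (rule qlop.QD_cong) (use s in \<open>simp del: upt_Suc\<close>)
  also have "\<dots> = torus p (diag (s + 1) 1 (n - s))"
    by (rule x_minor_bottom) (use s in auto)
  finally show ?thesis .
qed

text \<open>The commutative counterparts of \<open>t i j ^ m\<close>; \<open>telt\<close> sends the
  one to the other.\<close>

definition u :: "nat \<Rightarrow> nat \<Rightarrow> 'k laurent" where "u i j = lmono (single (i, j) (int m))"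
definition u' :: "nat \<Rightarrow> nat \<Rightarrow> 'k laurent" where "u' i j = lmono (- single (i, j) (int m))"

lemma u_inverse: "u i j * u' i j = 1"
  by (simp add: u_def u'_def mult_single)

definition pv :: "var \<Rightarrow> 'k laurent" where
  "pv v = (case v of (0, i, j) \<Rightarrow> px u u' n n i j | (Suc 0, s, r) \<Rightarrow> lmono (yexp n m s r) | _ \<Rightarrow> lmono (diag 1 1 n))"

lemma pv_simps [simp]: "pv (ZV i j) = px u u' n n i j" "pv (YV s r) = lmono (yexp n m s r)" "pv DV = lmono (diag 1 1 n)"
  by (simp_all add: pv_def ZV_def YV_def DV_def numeral_2_eq_2)

lemma Tvars_cases:
  assumes "v \<in> Tvars n m"
  obtains (Z) i j where "v = ZV i j" "i \<in> {1..n}" "j \<in> {1..n}"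
  | (Y) s r where "v = YV s r" "s \<in> {1..n-1}" "r \<in> {1..m-1}"
  | (D) "v = DV"
  using assms unfolding Tvars_def by blast

definition psi :: "'k cpoly \<Rightarrow> 'k laurent" where
  "psi = laurent_kalg.lin (meval pv)"

lemma psi_mult: "psi (f * g) = psi f * psi g"
  unfolding psi_def by (rule laurent_kalg.lin_mult) (rule meval_add)

lemma psi_add: "psi (f + g) = psi f + psi g"
  and psi_diff: "psi (f - g) = psi f - psi g"
  and psi_sum: "psi (sum F A) = (\<Sum>a\<in>A. psi (F a))"
  and psi_0 [simp]: "psi 0 = 0"
  unfolding psi_def by (simp_all add: laurent_kalg.lin_add laurent_kalg.lin_diff laurent_kalg.lin_sum)

lemma psi_const [simp]: "psi (single 0 c) = single 0 c"
  by (simp add: psi_def laurent_sc_def)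

lemma psi_1 [simp]: "psi 1 = 1"
  using psi_const[of 1] by simp

lemma psi_of_int [simp]: "psi (of_int k) = of_int k"
  using psi_const[of "of_int k"] by simp

lemma psi_Var [simp]: "psi (Var v) = pv v"
  by (simp add: psi_def Var_def)

lemma psi_power: "psi (f ^ k) = psi f ^ k"
  by (induction k) (auto simp: psi_mult)

lemma psi_prod: "psi (prod F A) = (\<Prod>a\<in>A. psi (F a))"
  by (induction A rule: infinite_finite_induct) (auto simp: psi_mult)

definition central :: "'k laurent set" where
  "central = {f. keys f \<subseteq> rad n m}"

lemma subring_central: "is_subring central"
  unfolding is_subring_def
proof (intro conjI ballI)
  fix f g assume *: "f \<in> central" "g \<in> central"
  show "f + g \<in> central" using * keys_add[of f g] by (auto simp: central_def)
  show "f * g \<in> central"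
    using * keys_mult[of f g] rad_add by (fastforce simp: central_def)
qed (auto simp: central_def rad_zero)

lemma mono_central: "a \<in> rad n m \<Longrightarrow> lmono a \<in> central"
  by (simp add: central_def)

text \<open>From commutative Laurent monomials to torus monomials. On \<open>central\<close> no
  power of \<open>p\<close> arises in products, which makes it multiplicative there; it is injective
  everywhere.\<close>

definition telt :: "'k laurent \<Rightarrow> (expo, 'k) lop" where
  "telt = lop.lin (torus p)"

lemma torus_rad_mult: "a \<in> rad n m \<Longrightarrow> keys b \<subseteq> square n \<Longrightarrow> torus p a * torus p b = torus p (a + b)"
  by (simp add: tor.T_mult p_powi_eq_1 rad_dvd)

lemma torus_rad_commute: "a \<in> rad n m \<Longrightarrow> keys b \<subseteq> square n \<Longrightarrow> torus p a * torus p b = torus p b * torus p a"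
  using p_powi_eq_1[of "qform b a"] rad_dvd[of a n m b]
  by (simp add: torus_rad_mult tor.T_mult[of b a] qform_antisym[of b a] add.commute)

lemma telt_mult: "f \<in> central \<Longrightarrow> g \<in> central \<Longrightarrow> telt (f * g) = telt f * telt g"
  unfolding telt_def
  by (rule lop.lin_mult, rule torus_rad_mult[symmetric]) (auto simp: central_def rad_def)

lemma telt_add: "telt (f + g) = telt f + telt g"
  and telt_diff: "telt (f - g) = telt f - telt g"
  and telt_sum: "telt (sum F A) = (\<Sum>a\<in>A. telt (F a))"
  and telt_mono [simp]: "telt (lmono a) = torus p a"
  and telt_sc: "telt (laurent_sc c f) = lop_sc c (telt f)"
  unfolding telt_def by (simp_all add: lop.lin_add lop.lin_diff lop.lin_sum tor.lin_laurent_sc)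

lemma telt_0 [simp]: "telt 0 = 0"
  by (simp add: telt_def)

lemma telt_1 [simp]: "telt 1 = 1"
  using telt_mono[of 0] by simp

lemma telt_eq_0_iff: "telt f = 0 \<longleftrightarrow> f = 0"
proof
  assume "telt f = 0"
  then have "lookup f a = 0" for a
    using tor.\<kappa>_lin[of f a] by (simp add: telt_def)
  then show "f = 0" by (simp add: poly_mapping_eqI)
qed simp

lemma telt_power: "f \<in> central \<Longrightarrow> telt (f ^ k) = telt f ^ k"
  by (induction k) (auto simp: telt_mult subring_power[OF subring_central])

lemma telt_below: "f \<in> laurent.below a \<Longrightarrow> telt f \<in> tor.below a"
  by (induction f rule: laurent.below.induct) (auto simp: telt_add telt_sc intro: tor.below.intros)

lemma telt_lead: "laurent.lead f a c \<Longrightarrow> tor.lead (telt f) a c"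
proof -
  assume "laurent.lead f a c"
  then have "telt (f - laurent_sc c (lmono a)) \<in> tor.below a"
    by (intro telt_below) (simp add: laurent.lead_def)
  moreover have "telt (f - laurent_sc c (lmono a)) = telt f - lop_sc c (torus p a)"
    by (simp add: telt_diff telt_sc)
  ultimately show ?thesis by (simp add: tor.lead_def)
qed

lemma u_power: "telt (u i j) = t i j ^ m" "telt (u' i j) = t' i j ^ m"
  by (simp_all add: u_def u'_def torus_power frag_cmul_single single_uminus[symmetric])

lemma u_central: "(i, j) \<in> square n \<Longrightarrow> u i j \<in> central" "(i, j) \<in> square n \<Longrightarrow> u' i j \<in> central"
  by (simp_all add: u_def u'_def mono_central rad_single)

text \<open>All factors of a path sum in \<open>u\<close> and \<open>u'\<close> lie in
  \<open>central\<close>, so \<open>telt\<close> passes through it; together with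
  \<open>path_power\<close> this makes \<open>x i j ^ m\<close> the image of a commutative path
  sum.\<close>

lemma px_u:
  assumes "1 \<le> i" "r \<le> n" "1 \<le> j" "j \<le> n"
  shows "px u u' r n i j \<in> central \<and> telt (px u u' r n i j) = px (\<lambda>i j. t i j ^ m) (\<lambda>i j. t' i j ^ m) r n i j"
  using assms
proof (induction r arbitrary: j)
  case 0
  then show ?case using subring_0[OF subring_central] by simp
next
  case (Suc r)
  have c: "px u u' r n i l \<in> central" "u' (Suc r) l \<in> central" "u (Suc r) j \<in> central"
    "telt (px u u' r n i l) = px (\<lambda>i j. t i j ^ m) (\<lambda>i j. t' i j ^ m) r n i l" if "l \<in> {j..n}" for l
    using that Suc.IH[of l] Suc.prems by (auto intro!: u_central)
  then have "(\<Sum>l\<in>{j..n}. px u u' r n i l * u' (Suc r) l * u (Suc r) j) \<in> central"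
    by (intro subring_sum[OF subring_central] subring_mult[OF subring_central])
  moreover have "telt (px u u' r n i l * u' (Suc r) l * u (Suc r) j)
      = px (\<lambda>i j. t i j ^ m) (\<lambda>i j. t' i j ^ m) r n i l * t' (Suc r) l ^ m * t (Suc r) j ^ m" if "l \<in> {j..n}" for l
    using c[OF that] by (simp add: telt_mult subring_mult[OF subring_central] u_power)
  ultimately show ?case
    using Suc.prems u_central[of "Suc r" j] by (auto simp: telt_sum u_power intro!: sum.cong)
qed

lemma pv_central: "v \<in> Tvars n m \<Longrightarrow> pv v \<in> central"
  by (erule Tvars_cases) (use rad_diag[of n m] in \<open>auto simp: px_u mono_central rad_yexp\<close>)

lemma psi_central:
  assumes "P \<in> Tcar n m" shows "psi P \<in> central"
proof -
  have sc: "laurent_sc c f \<in> central" if "f \<in> central" for c f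
    using that by (auto simp: central_def in_keys_iff lookup_laurent_sc)
  have "meval pv \<mu> \<in> central" if "\<mu> \<in> keys P" for \<mu>
    unfolding meval_def
  proof (intro subring_prod[OF subring_central] subring_power[OF subring_central] pv_central)
    fix v assume "v \<in> keys \<mu>"
    then show "v \<in> Tvars n m" using assms that by (auto simp: Tcar_def)
  qed
  then show ?thesis
    unfolding psi_def laurent_kalg.lin_def by (intro subring_sum[OF subring_central] sc)
qed

lemma ev_img:
  assumes "v \<in> Tvars n m" "n \<ge> 1"
  shows "ev (img n m q v) = telt (pv v)"
  using assms(1)
proof (cases rule: Tvars_cases)
  case (Z i j)
  then have "ev (img n m q v) = x i j ^ m" by (simp add: img_def ZV_def ev_power)
  also have "\<dots> = telt (px u u' n n i j)"
    using qg.path_power[OF root odd_m, of i n j n] px_u[of i n j] Z by simp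
  finally show ?thesis using Z by simp
next
  case (Y s r)
  let ?d1 = "diag 1 (n - s + 1) s" and ?d2 = "diag (s + 1) 1 (n - s)"
  have "ev (img n m q v) = torus p (frag_cmul (int r) ?d1) * torus p (frag_cmul (int (m - r)) ?d2)"
    using Y ev_Dt[of s] ev_tauDt[of s] by (simp add: img_def YV_def ev_mult ev_power torus_power)
  also have "\<dots> = torus p (frag_cmul (int r) ?d1 + frag_cmul (int (m - r)) ?d2)"
    using Y by (simp add: tor.T_mult qform_frag_cmul_left qform_frag_cmul_right qform_diag_diag)
  also have "frag_cmul (int r) ?d1 + frag_cmul (int (m - r)) ?d2 = yexp n m s r"
  proof -
    have "r \<le> m" using Y by auto
    then show ?thesis by (simp add: yexp_def of_nat_diff)
  qed
  finally show ?thesis using Y by simp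
next
  case D
  have "ev (img n m q DV) = torus p (diag 1 1 n)"
    using ev_Dq[OF assms(2)] by (simp add: img_def DV_def numeral_2_eq_2)
  then show ?thesis unfolding D pv_simps telt_mono .
qed

text \<open>Both sides agree on generators by \<open>ev_img\<close>. Since \<open>telt\<close> is
  multiplicative on the commutative ring \<open>central\<close>, the fixed order of the factors in
  \<open>phi\<close> makes no difference.\<close>

theorem ev_phi:
  assumes "P \<in> Tcar n m" "n \<ge> 1"
  shows "ev (phi n m q P) = telt (psi P)"
proof -
  have "ev (fsc (lookup P \<mu>) * prod_list (map (\<lambda>v. img n m q v ^ lookup \<mu> v)
      (sorted_list_of_set (keys \<mu>)))) = telt (laurent_sc (lookup P \<mu>) (meval pv \<mu>))"
    if \<mu>: "\<mu> \<in> keys P" for \<mu>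
  proof -
    let ?L = "sorted_list_of_set (keys \<mu>)"
    have v: "v \<in> Tvars n m" if "v \<in> set ?L" for v
      using that assms(1) \<mu> by (auto simp: Tcar_def)
    have *: "set L \<subseteq> Tvars n m \<Longrightarrow> prod_list (map (\<lambda>v. telt (pv v) ^ lookup \<mu> v) L)
        = telt (prod_list (map (\<lambda>v. pv v ^ lookup \<mu> v) L))" for L
    proof (induction L)
      case (Cons v L)
      have "prod_list (map (\<lambda>v. pv v ^ lookup \<mu> v) L) \<in> central"
        using Cons.prems by (intro subring_prod_list[OF subring_central])
          (auto intro!: subring_power[OF subring_central] pv_central)
      then show ?case
        using Cons pv_central[of v] subring_power[OF subring_central] by (simp add: telt_mult telt_power)
    qed simp
    have "ev (prod_list (map (\<lambda>v. img n m q v ^ lookup \<mu> v) ?L))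
        = prod_list (map (\<lambda>v. telt (pv v) ^ lookup \<mu> v) ?L)"
      unfolding ev_prod_list ev_power
      by (intro arg_cong[where f = prod_list] map_cong refl) (use ev_img[OF v assms(2)] in simp)
    also have "\<dots> = telt (prod_list (map (\<lambda>v. pv v ^ lookup \<mu> v) ?L))"
      by (rule *) (use v in blast)
    also have "prod_list (map (\<lambda>v. pv v ^ lookup \<mu> v) ?L) = meval pv \<mu>"
      unfolding meval_def by (subst prod.distinct_set_conv_list[symmetric]) simp_all
    finally show ?thesis by (simp add: ev_mult telt_sc)
  qed
  then show ?thesis
    by (simp add: phi_def ev_sum psi_def laurent_kalg.lin_def telt_sum)
qed

lemma phi_Fcar:
  assumes "P \<in> Tcar n m"
  shows "phi n m q P \<in> Fcar n"
proof -
  have img: "img n m q v \<in> Fcar n" if "v \<in> Tvars n m" for v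
    using that
  proof (cases rule: Tvars_cases)
    case (Z i j)
    then show ?thesis by (simp add: img_def ZV_def subring_power[OF subring_Fcar] X_Fcar)
  next
    case (Y s r)
    have "Dt n q s \<in> Fcar n" "tauDt n q (n - s) \<in> Fcar n"
      unfolding Dt_def tauDt_def using Y by (auto intro!: qminor_Fcar simp del: upt_Suc)
    then show ?thesis using Y
      by (simp add: img_def YV_def subring_mult[OF subring_Fcar] subring_power[OF subring_Fcar])
  next
    case D
    have "Dq n q \<in> Fcar n" unfolding Dq_def by (auto intro!: qminor_Fcar simp del: upt_Suc)
    then show ?thesis using D by (simp add: img_def DV_def numeral_2_eq_2)
  qed
  show ?thesis
    unfolding phi_def
  proof (intro subring_sum[OF subring_Fcar] subring_mult[OF subring_Fcar] fsc_Fcar subring_prod_list[OF subring_Fcar] subsetI)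
    fix \<mu> y assume "\<mu> \<in> keys P"
      "y \<in> set (map (\<lambda>v. img n m q v ^ lookup \<mu> v) (sorted_list_of_set (keys \<mu>)))"
    then show "y \<in> Fcar n"
      using assms img subring_power[OF subring_Fcar] unfolding Tcar_def by fastforce
  qed
qed

text \<open>The operators that commute with all radical monomials are closed under sums and products
  and contain \<open>t\<close> and \<open>t'\<close> on the square, hence all path sums and all
  values of \<open>ev\<close>.\<close>

lemma telt_central_commute:
  assumes "f \<in> central" "g \<in> Fcar n"
  shows "telt f * ev g = ev g * telt f"
proof -
  define C where "C = {y :: (expo, 'k) lop. \<forall>a\<in>rad n m. torus p a * y = y * torus p a}"
  have Cmult: "y * z \<in> C" if "y \<in> C" "z \<in> C" for y z
  proof -
    have "torus p a * (y * z) = y * z * torus p a" if a: "a \<in> rad n m" for a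
    proof -
      have yz: "torus p a * y = y * torus p a" "torus p a * z = z * torus p a"
        using a \<open>y \<in> C\<close> \<open>z \<in> C\<close> by (auto simp: C_def)
      have "torus p a * (y * z) = (torus p a * y) * z" by (simp only: mult.assoc)
      also have "\<dots> = y * (torus p a * z)" by (simp only: yz(1) mult.assoc)
      finally show ?thesis by (simp only: yz(2) mult.assoc)
    qed
    then show ?thesis by (simp add: C_def)
  qed
  have Csum: "sum F A \<in> C" if "\<And>z. z \<in> A \<Longrightarrow> F z \<in> C" for F :: "nat \<Rightarrow> _" and A
    using that by (auto simp: C_def sum_distrib_left sum_distrib_right)
  have Ct: "t i j \<in> C" "t' i j \<in> C" if "(i, j) \<in> square n" for i j
    using that by (auto simp: C_def intro!: torus_rad_commute)
  have px: "px t t' r n i j \<in> C" if "1 \<le> i" "r \<le> n" "1 \<le> j" "j \<le> n" for r i j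
    using that
  proof (induction r arbitrary: j)
    case (Suc r)
    then show ?case by (auto intro!: Csum Cmult Ct)
  qed (simp add: C_def)
  have "ev_word w \<in> C" if w: "w \<in> keys g" for w
  proof -
    obtain l where l: "w = FW l" by (cases w)
    then have "set l \<subseteq> square n" using assms(2) w by (auto simp: Fcar_def)
    then have "prod_list (map (\<lambda>v. x (fst v) (snd v)) l) \<in> C"
      by (induction l) (auto intro!: Cmult px, simp add: C_def)
    then show ?thesis by (simp add: l ev_word_def)
  qed
  then have "torus p a * ev g = ev g * torus p a" if "a \<in> rad n m" for a
    using that by (simp add: ev_def lop.lin_def sum_distrib_left sum_distrib_right C_def)
  then show ?thesis
    using assms(1) by (auto simp: telt_def lop.lin_def sum_distrib_left sum_distrib_right central_def intro!: sum.cong)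
qed

theorem phi_centre: "P \<in> Tcar n m \<Longrightarrow> n \<ge> 1 \<Longrightarrow> phi n m q P \<in> centre_reps n q"
proof -
  assume P: "P \<in> Tcar n m" "n \<ge> 1"
  have "phi n m q P * g - g * phi n m q P \<in> Jq n q" if g: "g \<in> Fcar n" for g
  proof -
    have "ev (phi n m q P * g - g * phi n m q P) = 0"
      using telt_central_commute[OF psi_central[OF P(1)] g] by (simp add: ev_diff ev_mult ev_phi[OF P])
    then show ?thesis
      using ev_eq_0_iff subring_diff[OF subring_Fcar] subring_mult[OF subring_Fcar] phi_Fcar[OF P(1)] g by blast
  qed
  then show ?thesis using phi_Fcar[OF P(1)] by (simp add: centre_reps_def)
qed

theorem phi_Jq_iff: "P \<in> Tcar n m \<Longrightarrow> n \<ge> 1 \<Longrightarrow> phi n m q P \<in> Jq n q \<longleftrightarrow> psi P = 0"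
  using ev_eq_0_iff[OF phi_Fcar] ev_phi telt_eq_0_iff by metis

end

section \<open>The kernel of the evaluation map\<close>

abbreviation Zvars :: "nat \<Rightarrow> var set" where
  "Zvars n \<equiv> {ZV i j | i j. (i, j) \<in> square n}"

lemma Zvars_Tvars: "Zvars n \<subseteq> Tvars n m"
  by (auto simp: Tvars_def)

lemma Pcar_mono: "V \<subseteq> W \<Longrightarrow> Pcar V \<subseteq> Pcar W"
  by (auto simp: Pcar_def)

lemma Zcar_Tcar: "f \<in> Pcar (Zvars n) \<Longrightarrow> f \<in> Tcar n m"
  using Pcar_mono[OF Zvars_Tvars] by (auto simp: Tcar_eq_Pcar)

lemma detA_Zcar: "t \<in> {1..n-1} \<Longrightarrow> detA n t \<in> Pcar (Zvars n)"
  and detB_Zcar: "t \<in> {1..n-1} \<Longrightarrow> detB n (n - t) \<in> Pcar (Zvars n)"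
  and detZ_Zcar: "detZ [1..<n+1] [1..<n+1] \<in> Pcar (Zvars n)"
  unfolding detA_def detB_def by (rule detZ_Pcar; auto simp del: upt_Suc)+

lemma Var_power: "Var v ^ k = single (single v k) 1"
  by (induction k) (auto simp: Var_def mult_single single_add[symmetric])

lemma single_eq_prod_Var:
  "single \<mu> (c :: 'k::comm_ring_1) =
    single 0 c * (\<Prod>v\<in>keys \<mu>. Var v ^ lookup \<mu> v)"
proof -
  have "(\<Prod>v\<in>A. Var v ^ lookup \<mu> v)
      = single (\<Sum>v\<in>A. single v (lookup \<mu> v)) (1 :: 'k)" for A
    unfolding Var_power by (induction A rule: infinite_finite_induct) (auto simp: mult_single)
  then show ?thesis by (simp add: poly_mapping_sum_single mult_single)
qed

lemma Igens_Tcar: "Igens n m \<subseteq> Tcar n m"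
proof -
  note R = subring_Tcar
  have 1: "Var DV ^ m - detZ [1..<n+1] [1..<n+1] \<in> Tcar n m"
    by (intro subring_diff[OF R] subring_power[OF R] Var_Tcar DV_Tvars Zcar_Tcar[OF detZ_Zcar])
  have 2: "Var (YV t i) * Var (YV t j) -
        (if i + j < m then Var (YV t (i + j)) * detB n (n - t)
         else if i + j = m then detA n t * detB n (n - t)
         else Var (YV t (i + j - m)) * detA n t) \<in> Tcar n m"
    if t: "t \<in> {1..n-1}" and ij: "i \<in> {1..m-1}" "j \<in> {1..m-1}" for t i j
  proof -
    have V: "Var (YV t k) \<in> Tcar n m" if "0 < k" "k < m" for k
      using that t by (intro Var_Tcar YV_Tvars) auto
    have "Var (YV t i) \<in> Tcar n m" "Var (YV t j) \<in> Tcar n m" using ij by (auto intro!: V)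
    moreover have "detA n t \<in> Tcar n m" "detB n (n - t) \<in> Tcar n m"
      using t by (auto intro!: Zcar_Tcar detA_Zcar detB_Zcar)
    ultimately show ?thesis
      using ij by (auto intro!: subring_diff[OF R] subring_mult[OF R] V simp del: One_nat_def)
  qed
  show ?thesis unfolding Igens_def using 1 2 by blast
qed

lemma ideal_Iideal: "ideal_in (Tcar n m) (Iideal n m)"
  unfolding Iideal_def by (rule ideal_gen_ideal[OF subring_Tcar Igens_Tcar])

lemma Iideal_gen: "g \<in> Igens n m \<Longrightarrow> g \<in> Iideal n m"
  unfolding Iideal_def using gen_ideal_superset by blast

context quantum_matrices
begin

sublocale ug: grid laurent_sc 1 u u'
proof -
  interpret one: qkalg "laurent_sc :: 'k \<Rightarrow> 'k laurent \<Rightarrow> 'k laurent" 1 by standard simp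
  show "grid laurent_sc 1 u u'"
    by standard (auto simp: u_inverse mult.commute[of "u' _ _"] one.qc_def mult.commute)
qed

text \<open>At \<open>q = 1\<close> the quantum determinant is the ordinary one, so the border minor
  lemmas also evaluate \<open>detA\<close> and \<open>detB\<close>.\<close>

lemma ug_QD: "ug.QD h z = (\<Sum>\<pi> | \<pi> permutes {0..<h}. of_int (sign \<pi>) * (\<Prod>a\<in>{0..<h}. z a (\<pi> a)))"
  unfolding ug.QD_def
proof (intro sum.cong refl)
  fix \<pi> assume "\<pi> \<in> {\<pi>. \<pi> permutes {0..<h}}"
  then have "sign \<pi> = (- 1) ^ inversions h \<pi>" by (simp add: sign_eq_inversions)
  moreover have "single 0 ((- 1 :: 'k) ^ k) = (of_int ((- 1) ^ k) :: 'k laurent)" for k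
    using single_of_int[of "(- 1) ^ k", where 'b = 'k and 'a = expo] by simp
  ultimately show "laurent_sc ((- 1) ^ inversions h \<pi>) (prod_list (map (\<lambda>a. z a (\<pi> a)) [0..<h]))
      = of_int (sign \<pi>) * (\<Prod>a\<in>{0..<h}. z a (\<pi> a))"
    by (simp add: laurent_sc_def prod.distinct_set_conv_list[symmetric] del: of_int_power)
qed

text \<open>\<open>minor_bottom_border\<close> takes the columns as lines, while \<open>detZ\<close>
  is written along rows.\<close>

lemma ug_QD_transpose: "ug.QD h (\<lambda>a b. z b a) = ug.QD h z"
proof -
  have "ug.QD h (\<lambda>a b. z b a) = (\<Sum>\<pi> | \<pi> permutes {0..<h}. of_int (sign (inv \<pi>)) * (\<Prod>a\<in>{0..<h}. z (inv \<pi> a) a))"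
    unfolding ug_QD by (rule sum_permutations_inverse)
  also have "\<dots> = (\<Sum>\<pi> | \<pi> permutes {0..<h}. of_int (sign \<pi>) * (\<Prod>a\<in>{0..<h}. z a (\<pi> a)))"
  proof (intro sum.cong refl)
    fix \<pi> assume "\<pi> \<in> {\<pi>. \<pi> permutes {0..<h}}"
    then have \<pi>: "\<pi> permutes {0..<h}" by simp
    have "(\<Prod>a\<in>{0..<h}. z (inv \<pi> a) a) = (\<Prod>a\<in>{0..<h}. z (inv \<pi> (\<pi> a)) (\<pi> a))"
      using prod.permute[OF \<pi>, of "\<lambda>a. z (inv \<pi> a) a"] by (simp add: comp_def)
    also have "\<dots> = (\<Prod>a\<in>{0..<h}. z a (\<pi> a))"
      using permutes_inverses(2)[OF \<pi>] by simp
    finally have eq: "(\<Prod>a\<in>{0..<h}. z (inv \<pi> a) a) = (\<Prod>a\<in>{0..<h}. z a (\<pi> a))" .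
    have "permutation \<pi>" using \<pi> permutation_permutes finite_atLeastLessThan by blast
    then show "of_int (sign (inv \<pi>)) * (\<Prod>a\<in>{0..<h}. z (inv \<pi> a) a) = of_int (sign \<pi>) * (\<Prod>a\<in>{0..<h}. z a (\<pi> a))"
      by (simp only: eq sign_inverse)
  qed
  finally show ?thesis by (simp add: ug_QD)
qed

lemma psi_detZ: "psi (detZ rows cols) = ug.QD (length rows) (\<lambda>a b. px u u' n n (rows ! a) (cols ! b))"
  by (simp add: detZ_def ug_QD psi_sum psi_mult psi_prod)

lemma u_diag: "prod_list (map (\<lambda>a. u (i + a) (j + a)) [0..<h]) = lmono (frag_cmul (int m) (diag i j h))"
proof (induction h)
  case (Suc h)
  have "frag_cmul (int m) (diag i j (Suc h)) = frag_cmul (int m) (diag i j h) + single (i + h, j + h) (int m)"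
    by (simp add: diag_def frag_cmul_distrib2 frag_cmul_single)
  then show ?case by (simp add: Suc u_def[of "i + h"] mult_single)
qed (simp add: diag_def)

lemma psi_detZ_right:
  assumes "1 \<le> i" "i + h \<le> n + 1" "1 \<le> j" "j + h = n + 1" "1 \<le> h"
    "length rows = h" "\<And>a. a < h \<Longrightarrow> rows ! a = i + a" "\<And>a. a < h \<Longrightarrow> cols ! a = j + a"
  shows "psi (detZ rows cols) = lmono (frag_cmul (int m) (diag i j h))"
proof -
  obtain h' where h: "h = Suc h'" using assms(5) by (cases h) auto
  have "psi (detZ rows cols) = ug.QD h (\<lambda>a b. px u u' n n (i + a) (j + b))"
    unfolding psi_detZ assms(6) by (rule ug.QD_cong) (simp add: assms)
  also have "\<dots> = lmono (frag_cmul (int m) (diag i j h))"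
    unfolding u_diag[symmetric] h by (rule ug.minor_right_border) (use assms h in auto)
  finally show ?thesis .
qed

lemma psi_detZ_bottom:
  assumes "1 \<le> i" "i + h = n + 1" "1 \<le> j" "j + h \<le> n + 1" "1 \<le> h"
    "length rows = h" "\<And>a. a < h \<Longrightarrow> rows ! a = i + a" "\<And>a. a < h \<Longrightarrow> cols ! a = j + a"
  shows "psi (detZ rows cols) = lmono (frag_cmul (int m) (diag i j h))"
proof -
  obtain h' where h: "h = Suc h'" using assms(5) by (cases h) auto
  have "psi (detZ rows cols) = ug.QD h (\<lambda>a b. px u u' n n (i + a) (j + b))"
    unfolding psi_detZ assms(6) by (rule ug.QD_cong) (simp add: assms)
  also have "\<dots> = ug.QD h (\<lambda>a b. px u u' n n (i + b) (j + a))"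
    by (rule ug_QD_transpose[symmetric])
  also have "\<dots> = lmono (frag_cmul (int m) (diag i j h))"
    unfolding u_diag[symmetric] h by (rule ug.minor_bottom_border) (use assms h in auto)
  finally show ?thesis .
qed

lemma psi_det:
  assumes "n \<ge> 1"
  shows "psi (detZ [1..<n+1] [1..<n+1]) = lmono (frag_cmul (int m) (diag 1 1 n))"
  by (rule psi_detZ_right) (use assms in \<open>auto simp del: upt_Suc\<close>)

lemma psi_detA:
  assumes "s \<in> {1..n-1}"
  shows "psi (detA n s) = lmono (frag_cmul (int m) (diag 1 (n - s + 1) s))"
  unfolding detA_def by (rule psi_detZ_right) (use assms in \<open>auto simp del: upt_Suc\<close>)

lemma psi_detB:
  assumes "s \<in> {1..n-1}"
  shows "psi (detB n (n - s)) = lmono (frag_cmul (int m) (diag (s + 1) 1 (n - s)))"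
  unfolding detB_def by (rule psi_detZ_bottom) (use assms in \<open>auto simp del: upt_Suc\<close>)

lemma lmono_power: "lmono a ^ k = (lmono (frag_cmul (int k) a) :: 'k laurent)"
proof (induction k)
  case (Suc k)
  have "frag_cmul (int (Suc k)) a = a + frag_cmul (int k) a"
    by (rule poly_mapping_eqI) (simp add: lookup_add algebra_simps)
  then show ?case by (simp add: Suc mult_single)
qed simp

text \<open>Under \<open>psi\<close> each generator of the ideal becomes a difference of two Laurent
  monomials, and the relations reduce to additive identities between exponents.\<close>

lemma Iideal_psi:
  assumes "n \<ge> 1" "f \<in> Iideal n m"
  shows "psi f = 0"
proof -
  have "ideal_in (Tcar n m) {f \<in> Tcar n m. psi f = 0}"
    unfolding ideal_in_def
    using subring_0[OF subring_Tcar] subring_add[OF subring_Tcar] subring_mult[OF subring_Tcar]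
    by (auto simp: psi_add psi_mult)
  moreover have "Igens n m \<subseteq> {f \<in> Tcar n m. psi f = 0}"
  proof -
    have 1: "psi (Var DV ^ m - detZ [1..<n+1] [1..<n+1]) = 0"
      unfolding psi_diff psi_det[OF assms(1)] by (simp add: psi_power lmono_power)
    have 2: "psi (Var (YV s i) * Var (YV s j) -
        (if i + j < m then Var (YV s (i + j)) * detB n (n - s)
         else if i + j = m then detA n s * detB n (n - s)
         else Var (YV s (i + j - m)) * detA n s)) = 0" (is "psi (?l - ?r) = 0")
      if s: "s \<in> {1..n-1}" for s i j
    proof -
      let ?d1 = "diag 1 (n - s + 1) s" and ?d2 = "diag (s + 1) 1 (n - s)"
      have "psi ?r = lmono (yexp n m s i + yexp n m s j)"
      proof -
        consider "i + j < m" | "i + j = m" | "i + j > m" by linarith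
        then show ?thesis
        proof cases
          case 1
          have "yexp n m s (i + j) + frag_cmul (int m) ?d2 = yexp n m s i + yexp n m s j"
            by (rule poly_mapping_eqI) (simp add: yexp_def lookup_add algebra_simps)
          then show ?thesis using 1 s by (simp add: psi_mult psi_detB mult_single del: One_nat_def)
        next
          case 2
          have "frag_cmul (int m) ?d1 + frag_cmul (int m) ?d2 = yexp n m s i + yexp n m s j"
            unfolding 2[symmetric] by (rule poly_mapping_eqI) (simp add: yexp_def lookup_add algebra_simps)
          then show ?thesis using 2 s by (simp add: psi_mult psi_detA psi_detB mult_single del: One_nat_def)
        next
          case 3
          then have "int (i + j - m) = int i + int j - int m" by (simp add: of_nat_diff)
          then have "yexp n m s (i + j - m) + frag_cmul (int m) ?d1 = yexp n m s i + yexp n m s j"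
            by (intro poly_mapping_eqI) (simp add: yexp_def lookup_add algebra_simps)
          then show ?thesis using 3 s by (simp add: psi_mult psi_detA mult_single del: One_nat_def)
        qed
      qed
      then show ?thesis by (simp add: psi_diff psi_mult mult_single)
    qed
    show ?thesis
    proof
      fix g :: "'k cpoly" assume g: "g \<in> Igens n m"
      then have "psi g = 0"
        unfolding Igens_def using 1 2 by blast
      then show "g \<in> {f \<in> Tcar n m. psi f = 0}" using g Igens_Tcar by blast
    qed
  qed
  ultimately have "Iideal n m \<subseteq> {f \<in> Tcar n m. psi f = 0}"
    unfolding Iideal_def by (rule gen_ideal_least)
  then show ?thesis using assms(2) by blast
qed

subsection \<open>Normal forms\<close>

text \<open>Slot 0 carries the power of \<open>D\<close>, slot \<open>s\<close> with
  \<open>0 < s\<close> at most one \<open>Y\<close>; index 0 stands for the absent factor.\<close>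

definition nf_factor :: "nat \<Rightarrow> nat \<Rightarrow> 'k cpoly" where
  "nf_factor s k = (if s = 0 then Var DV ^ k else if k = 0 then 1 else Var (YV s k))"

definition nf :: "(nat \<Rightarrow> nat) \<Rightarrow> 'k cpoly" where
  "nf \<rho> = (\<Prod>s\<in>{0..<n}. nf_factor s (\<rho> s))"

abbreviation nf_index :: "(nat \<Rightarrow> nat) set" where
  "nf_index \<equiv> {0..<n} \<rightarrow>\<^sub>E {0..<m}"

text \<open>Congruent to a combination of normal forms with coefficients in the polynomials in the
  \<open>Z\<close>.\<close>

definition reducible :: "'k cpoly set" where
  "reducible = {f. \<exists>\<zeta>. (\<forall>\<rho>. \<zeta> \<rho> \<in> Pcar (Zvars n)) \<and> f - (\<Sum>\<rho>\<in>nf_index. \<zeta> \<rho> * nf \<rho>) \<in> Iideal n m}"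

lemma nf_factor_Tcar: "s < n \<Longrightarrow> k < m \<Longrightarrow> nf_factor s k \<in> Tcar n m"
  unfolding nf_factor_def
  by (auto intro!: subring_power[OF subring_Tcar] subring_1[OF subring_Tcar] Var_Tcar DV_Tvars YV_Tvars)

lemma finite_nf_index: "finite nf_index"
  by (intro finite_PiE) auto

lemma reducible_nf:
  assumes "\<zeta> \<in> Pcar (Zvars n)" "\<rho> \<in> nf_index" "f - \<zeta> * nf \<rho> \<in> Iideal n m"
  shows "f \<in> reducible"
proof -
  have "(\<Sum>\<rho>'\<in>nf_index. (if \<rho>' = \<rho> then \<zeta> else 0) * nf \<rho>') = \<zeta> * nf \<rho>"
    using finite_nf_index assms(2) by (simp add: if_distrib[of "\<lambda>c. c * _"] cong: if_cong)
  then show ?thesis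
    unfolding reducible_def using assms(1,3) subring_0[OF subring_Pcar]
    by (intro CollectI exI[of _ "\<lambda>\<rho>'. if \<rho>' = \<rho> then \<zeta> else 0"]) auto
qed

lemma reducible_add:
  assumes "f \<in> reducible" "g \<in> reducible" shows "f + g \<in> reducible"
proof -
  obtain \<zeta> \<xi> where *: "\<And>\<rho>. \<zeta> \<rho> \<in> Pcar (Zvars n)" "f - (\<Sum>\<rho>\<in>nf_index. \<zeta> \<rho> * nf \<rho>) \<in> Iideal n m"
    "\<And>\<rho>. \<xi> \<rho> \<in> Pcar (Zvars n)" "g - (\<Sum>\<rho>\<in>nf_index. \<xi> \<rho> * nf \<rho>) \<in> Iideal n m"
    using assms unfolding reducible_def by blast
  have eq: "f + g - (\<Sum>\<rho>\<in>nf_index. (\<zeta> \<rho> + \<xi> \<rho>) * nf \<rho>)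
      = (f - (\<Sum>\<rho>\<in>nf_index. \<zeta> \<rho> * nf \<rho>)) + (g - (\<Sum>\<rho>\<in>nf_index. \<xi> \<rho> * nf \<rho>))"
    by (simp add: distrib_right sum.distrib)
  have "f + g - (\<Sum>\<rho>\<in>nf_index. (\<zeta> \<rho> + \<xi> \<rho>) * nf \<rho>) \<in> Iideal n m"
    unfolding eq by (rule ideal_add[OF ideal_Iideal *(2,4)])
  then show ?thesis
    unfolding reducible_def using subring_add[OF subring_Pcar *(1) *(3)]
    by (intro CollectI exI[of _ "\<lambda>\<rho>. \<zeta> \<rho> + \<xi> \<rho>"]) blast
qed

lemma reducible_Iideal:
  assumes "f \<in> Iideal n m" shows "f \<in> reducible"
  unfolding reducible_def using assms subring_0[OF subring_Pcar]
  by (intro CollectI exI[of _ "\<lambda>_. 0"]) simp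

lemma reducible_sum: "(\<And>a. a \<in> A \<Longrightarrow> F a \<in> reducible) \<Longrightarrow> sum F A \<in> reducible"
  by (induction A rule: infinite_finite_induct)
    (auto intro: reducible_add reducible_Iideal ideal_0[OF ideal_Iideal])

text \<open>A variable other than the \<open>Z\<close> acts on one slot \<open>s\<close> only, and
  there it shifts the index modulo \<open>m\<close> at the cost of a determinant. Hence
  \<open>reducible\<close> is closed under multiplication by variables.\<close>

lemma nf_factor_reduce:
  assumes "v \<in> Tvars n m - Zvars n" "n \<ge> 1"
  shows "\<exists>s<n. \<forall>k<m. \<exists>c\<in>Pcar (Zvars n). \<exists>l<m. nf_factor s k * Var v - c * nf_factor s l \<in> Iideal n m"
proof -
  have v: "v \<in> Tvars n m" "v \<notin> Zvars n"
    by (rule DiffD1[OF assms(1)], rule notI, rule DiffD2[OF assms(1)])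
  from v(1) show ?thesis
  proof (cases rule: Tvars_cases)
    case (Z i j)
    then show ?thesis using v(2) by blast
  next
    case (Y s r)
    have "\<exists>c\<in>Pcar (Zvars n). \<exists>l<m. nf_factor s k * Var v - c * nf_factor s l \<in> Iideal n m" if k: "k < m" for k
    proof (cases "k = 0")
      case True
      then show ?thesis using Y subring_1[OF subring_Pcar] ideal_0[OF ideal_Iideal]
        by (intro bexI[of _ 1] exI[of _ r]) (auto simp: nf_factor_def)
    next
      case False
      \<comment> \<open>For \<open>k + r = m\<close> the new index is 0, whose factor is 1; so one
        formula for \<open>?l\<close> covers this case too.\<close>
      let ?c = "(if k + r < m then detB n (n - s) else if k + r = m then detA n s * detB n (n - s) else detA n s) :: 'k cpoly"
      let ?l = "if k + r < m then k + r else k + r - m"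
      have AB: "(detA n s :: 'k cpoly) \<in> Pcar (Zvars n)" "(detB n (n - s) :: 'k cpoly) \<in> Pcar (Zvars n)"
        by (rule detA_Zcar[OF Y(2)], rule detB_Zcar[OF Y(2)])
      have "?c \<in> Pcar (Zvars n)"
        using AB subring_mult[OF subring_Pcar AB] by simp
      moreover have "?l < m" using k Y by auto
      moreover have "nf_factor s k * Var v - ?c * nf_factor s ?l \<in> Igens n m"
      proof -
        have "nf_factor s k * Var v - ?c * nf_factor s ?l = Var (YV s k) * Var (YV s r) -
            (if k + r < m then Var (YV s (k + r)) * detB n (n - s)
             else if k + r = m then detA n s * detB n (n - s)
             else Var (YV s (k + r - m)) * detA n s)"
          using Y False by (auto simp: nf_factor_def mult.commute)
        then show ?thesis
          unfolding Igens_def using Y False k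
          by (intro UnI2 CollectI exI[of _ s] exI[of _ k] exI[of _ r]) simp
      qed
      ultimately show ?thesis using Iideal_gen by blast
    qed
    then show ?thesis using Y by (intro exI[of _ s]) auto
  next
    case D
    have "\<exists>c\<in>Pcar (Zvars n). \<exists>l<m. nf_factor 0 k * Var v - c * nf_factor 0 l \<in> Iideal n m" if k: "k < m" for k
    proof (cases "Suc k < m")
      case True
      then show ?thesis using D subring_1[OF subring_Pcar] ideal_0[OF ideal_Iideal]
        by (intro bexI[of _ 1] exI[of _ "Suc k"]) (auto simp: nf_factor_def mult.commute)
    next
      case False
      then have "m = Suc k" using k by simp
      then have "nf_factor 0 k * Var v - detZ [1..<n+1] [1..<n+1] * nf_factor 0 0
          = Var DV ^ m - detZ [1..<n+1] [1..<n+1]"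
        using D by (simp add: nf_factor_def mult.commute del: upt_Suc)
      also have "\<dots> \<in> Iideal n m" by (rule Iideal_gen) (simp add: Igens_def)
      finally show ?thesis using detZ_Zcar m_pos by blast
    qed
    then show ?thesis using assms(2) by (intro exI[of _ 0]) auto
  qed
qed

lemma reducible_mult_Var:
  assumes "f \<in> reducible" "v \<in> Tvars n m" "n \<ge> 1"
  shows "f * Var v \<in> reducible"
proof -
  obtain \<zeta> where \<zeta>: "\<And>\<rho>. \<zeta> \<rho> \<in> Pcar (Zvars n)" "f - (\<Sum>\<rho>\<in>nf_index. \<zeta> \<rho> * nf \<rho>) \<in> Iideal n m"
    using assms unfolding reducible_def by blast
  have "\<zeta> \<rho> * nf \<rho> * Var v \<in> reducible" if \<rho>: "\<rho> \<in> nf_index" for \<rho>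
  proof (cases "v \<in> Zvars n")
    case True
    then have "\<zeta> \<rho> * Var v \<in> Pcar (Zvars n)"
      using \<zeta>(1) by (intro subring_mult[OF subring_Pcar] Var_Pcar)
    then show ?thesis using ideal_0[OF ideal_Iideal] \<rho>
      by (intro reducible_nf) (auto simp: mult_ac)
  next
    case False
    then obtain s where s: "s < n" and red: "\<forall>k<m. \<exists>c\<in>Pcar (Zvars n). \<exists>l<m. nf_factor s k * Var v - c * nf_factor s l \<in> Iideal n m"
      using nf_factor_reduce[of v] assms by blast
    have "\<rho> s < m" using \<rho> s by auto
    then obtain c l where c: "c \<in> Pcar (Zvars n)" "l < m" "nf_factor s (\<rho> s) * Var v - c * nf_factor s l \<in> Iideal n m"
      using red by blast
    define R where "R = (\<Prod>s'\<in>{0..<n}-{s}. nf_factor s' (\<rho> s'))"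
    have "R \<in> Tcar n m"
      unfolding R_def using \<rho> by (intro subring_prod[OF subring_Tcar] nf_factor_Tcar) auto
    moreover have nf1: "nf \<rho> = nf_factor s (\<rho> s) * R"
      unfolding nf_def R_def using s by (intro prod.remove) auto
    moreover have nf2: "nf (\<rho>(s := l)) = nf_factor s l * R"
    proof -
      have "nf (\<rho>(s := l)) = nf_factor s l * (\<Prod>s'\<in>{0..<n}-{s}. nf_factor s' ((\<rho>(s := l)) s'))"
        unfolding nf_def using s by (subst prod.remove[of _ s]) auto
      also have "(\<Prod>s'\<in>{0..<n}-{s}. nf_factor s' ((\<rho>(s := l)) s')) = R"
        unfolding R_def by (intro prod.cong) auto
      finally show ?thesis .
    qed
    ultimately have "(\<zeta> \<rho> * R) * (nf_factor s (\<rho> s) * Var v - c * nf_factor s l) \<in> Iideal n m"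
      using Zcar_Tcar[OF \<zeta>(1)] c by (intro ideal_mult_left[OF ideal_Iideal] subring_mult[OF subring_Tcar])
    also have "(\<zeta> \<rho> * R) * (nf_factor s (\<rho> s) * Var v - c * nf_factor s l)
        = \<zeta> \<rho> * nf \<rho> * Var v - (\<zeta> \<rho> * c) * nf (\<rho>(s := l))"
      by (simp add: nf1 nf2 algebra_simps)
    finally show ?thesis
      using \<zeta>(1) c \<rho> s by (intro reducible_nf[of "\<zeta> \<rho> * c" "\<rho>(s := l)"] subring_mult[OF subring_Pcar])
        (auto simp: PiE_iff extensional_def)
  qed
  then have "(\<Sum>\<rho>\<in>nf_index. \<zeta> \<rho> * nf \<rho>) * Var v \<in> reducible"
    unfolding sum_distrib_right by (rule reducible_sum)
  from reducible_add[OF _ this]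
  have "(f - (\<Sum>\<rho>\<in>nf_index. \<zeta> \<rho> * nf \<rho>)) * Var v + (\<Sum>\<rho>\<in>nf_index. \<zeta> \<rho> * nf \<rho>) * Var v \<in> reducible"
    using \<zeta>(2) assms(2) by (blast intro: reducible_Iideal ideal_mult_right[OF ideal_Iideal] Var_Tcar)
  then show ?thesis by (simp add: algebra_simps)
qed

lemma reducible_const: 
  assumes "n \<ge> 1" shows "single 0 c \<in> reducible"
proof -
  let ?\<rho> = "\<lambda>s. if s < n then 0 else undefined"
  have "nf ?\<rho> = 1" unfolding nf_def by (rule prod.neutral) (auto simp: nf_factor_def)
  then show ?thesis using m_pos ideal_0[OF ideal_Iideal]
    by (intro reducible_nf[of "single 0 c" ?\<rho>]) auto
qed

lemma Tcar_reducible: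
  assumes "f \<in> Tcar n m" "n \<ge> 1" shows "f \<in> reducible"
proof -
  have "single \<mu> c \<in> reducible" if \<mu>: "\<mu> \<in> keys f" for \<mu> c
  proof -
    have "single 0 c * (\<Prod>v\<in>V. Var v ^ e v) \<in> reducible"
      if "finite V" "V \<subseteq> Tvars n m" for V e
      using that
    proof (induction V rule: finite_induct)
      case empty
      then show ?case using reducible_const[OF assms(2)] by simp
    next
      case (insert v V)
      have "single 0 c * (\<Prod>v\<in>V. Var v ^ e v) * Var v ^ k \<in> reducible" for k
      proof (induction k)
        case 0
        then show ?case using insert by simp
      next
        case (Suc k)
        then show ?case using reducible_mult_Var[OF Suc, of v] insert.prems assms(2) by (simp add: mult_ac)
      qed
      then show ?case using insert.hyps by (simp add: mult_ac)
    qed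
    then show ?thesis
      unfolding single_eq_prod_Var[of \<mu>] using assms(1) \<mu> by (auto simp: Tcar_def)
  qed
  then have "(\<Sum>\<mu>\<in>keys f. single \<mu> (lookup f \<mu>)) \<in> reducible"
    by (intro reducible_sum) auto
  then show ?thesis by (simp add: poly_mapping_sum_single)
qed

subsection \<open>Exponents of normal forms\<close>

definition nf_expo :: "nat \<Rightarrow> nat \<Rightarrow> expo" where
  "nf_expo s k = (if s = 0 then frag_cmul (int k) (diag 1 1 n) else if k = 0 then 0 else yexp n m s k)"

lemma psi_nf: "psi (nf \<rho>) = lmono (\<Sum>s\<in>{0..<n}. nf_expo s (\<rho> s))"
proof -
  have "psi (nf_factor s k) = lmono (nf_expo s k)" for s k
    by (auto simp: nf_factor_def nf_expo_def psi_power lmono_power)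
  moreover have "(\<Prod>s\<in>A. lmono (f s)) = (lmono (\<Sum>s\<in>A. f s) :: 'k laurent)" for f :: "nat \<Rightarrow> expo" and A
    by (induction A rule: infinite_finite_induct) (auto simp: mult_single)
  ultimately show ?thesis by (simp add: nf_def psi_prod)
qed

text \<open>Every diagonal of the square carries exactly one of the parameters of a normal form.\<close>
definition diag_index :: "nat \<Rightarrow> nat \<Rightarrow> nat" where
  "diag_index i j = (if i = j then 0 else if i < j then n - (j - i) else i - j)"

text \<open>On or above the main diagonal the entry is the index \<open>k\<close>; below it, it is
  the residue of \<open>- k\<close>, written as 0 or \<open>m - k\<close>.\<close>

lemma lookup_nf_expo:
  assumes "(i, j) \<in> square n" "s < n"
  shows "lookup (nf_expo s k) (i, j) =
    (if s \<noteq> diag_index i j then 0 else if i \<le> j then int k else if k = 0 then 0 else int m - int k)"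
  using assms by (auto simp: nf_expo_def yexp_def lookup_add lookup_diag diag_index_def)

lemma lookup_nf_sum:
  assumes "(i, j) \<in> square n"
  shows "lookup (\<Sum>s\<in>{0..<n}. nf_expo s (\<rho> s)) (i, j) =
    (let k = \<rho> (diag_index i j) in if i \<le> j then int k else if k = 0 then 0 else int m - int k)"
proof -
  have d: "diag_index i j < n" using assms by (auto simp: diag_index_def)
  have "lookup (\<Sum>s\<in>{0..<n}. nf_expo s (\<rho> s)) (i, j)
      = (\<Sum>s\<in>{0..<n}. if s = diag_index i j then
          (if i \<le> j then int (\<rho> s) else if \<rho> s = 0 then 0 else int m - int (\<rho> s)) else 0)"
    unfolding lookup_sum by (intro sum.cong refl) (use assms in \<open>auto simp: lookup_nf_expo\<close>)
  then show ?thesis using d by (simp add: Let_def)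
qed

lemma diag_index_surj:
  assumes "s < n" obtains j where "(1, j) \<in> square n" "diag_index 1 j = s"
proof (cases "s = 0")
  case True
  then show ?thesis using that[of 1] assms by (auto simp: diag_index_def)
next
  case False
  then show ?thesis using that[of "n - s + 1"] assms by (auto simp: diag_index_def)
qed

definition m_lattice :: "expo set" where
  "m_lattice = {a. \<forall>v. int m dvd lookup a v}"

lemma m_lattice_diff: "a \<in> m_lattice \<Longrightarrow> b \<in> m_lattice \<Longrightarrow> a - b \<in> m_lattice"
  by (simp add: m_lattice_def lookup_minus)

text \<open>The first row meets every diagonal on or above the main one, so modulo \<open>m\<close>
  it shows all the indices. Different normal forms therefore lie in different cosets of
  \<open>m_lattice\<close>.\<close>

lemma nf_sum_inj:
  assumes "\<rho> \<in> nf_index" "\<rho>' \<in> nf_index"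
    "(\<Sum>s\<in>{0..<n}. nf_expo s (\<rho> s)) - (\<Sum>s\<in>{0..<n}. nf_expo s (\<rho>' s)) \<in> m_lattice"
  shows "\<rho> = \<rho>'"
proof (rule PiE_ext[OF assms(1,2)])
  fix s assume "s \<in> {0..<n}"
  then obtain j where j: "(1, j) \<in> square n" "diag_index 1 j = s" using diag_index_surj by auto
  have "\<forall>v. int m dvd lookup ((\<Sum>s\<in>{0..<n}. nf_expo s (\<rho> s)) - (\<Sum>s\<in>{0..<n}. nf_expo s (\<rho>' s))) v"
    using assms(3) unfolding m_lattice_def mem_Collect_eq .
  from spec[OF this, of "(1, j)"] have "int m dvd int (\<rho> s) - int (\<rho>' s)"
    unfolding lookup_minus lookup_nf_sum[OF j(1)] Let_def j(2) using j(1) by simp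
  moreover have "\<rho> s < m" "\<rho>' s < m" using assms \<open>s \<in> _\<close> by auto
  ultimately show "\<rho> s = \<rho>' s"
    by (metis mod_eq_dvd_iff mod_less nat_int of_nat_less_iff of_nat_mod zmod_int of_nat_eq_iff)
qed

section \<open>Images of polynomials in the Z variables\<close>

definition z_expo :: "(var \<Rightarrow>\<^sub>0 nat) \<Rightarrow> expo" where
  "z_expo \<mu> = (\<Sum>v\<in>keys \<mu>. frag_cmul (int (lookup \<mu> v)) (single (snd v) (int m)))"

lemma lookup_z_expo:
  assumes "keys \<mu> \<subseteq> Zvars n"
  shows "lookup (z_expo \<mu>) w = int m * int (lookup \<mu> (0, w))"
proof -
  have "lookup (z_expo \<mu>) w
      = (\<Sum>v\<in>keys \<mu>. if v = (0, w) then int m * int (lookup \<mu> (0, w)) else 0)"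
    unfolding z_expo_def lookup_sum
    by (intro sum.cong refl) (use assms in \<open>auto simp: lookup_single when_def ZV_def\<close>)
  then show ?thesis by (auto simp: in_keys_iff)
qed

lemma lead_mult_laurent:
  "laurent.lead f a (1::'k) \<Longrightarrow> laurent.lead g b 1 \<Longrightarrow> laurent.lead (f * g) (a + b) 1"
  using laurent.lead_mult[of f a 1 g b 1] by simp

lemma lead_power_laurent:
  "laurent.lead f a (1::'k) \<Longrightarrow> laurent.lead (f ^ k) (frag_cmul (int k) a) 1"
proof (induction k)
  case 0
  then show ?case using laurent.lead_T[of 0] by simp
next
  case (Suc k)
  have "frag_cmul (int (Suc k)) a = a + frag_cmul (int k) a"
    by (rule poly_mapping_eqI) (simp add: lookup_add algebra_simps)
  then show ?case using lead_mult_laurent[OF Suc.prems Suc.IH] Suc.prems by simp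
qed

lemma lead_prod_laurent:
  "(\<And>v. v \<in> A \<Longrightarrow> laurent.lead (f v) (a v) (1::'k)) \<Longrightarrow> laurent.lead (\<Prod>v\<in>A. f v) (\<Sum>v\<in>A. a v) 1"
proof (induction A rule: infinite_finite_induct)
  case (insert v A)
  then show ?case by (simp add: lead_mult_laurent)
qed (use laurent.lead_T[of 0] in simp_all)

lemma meval_lead:
  assumes "keys \<mu> \<subseteq> Zvars n"
  shows "laurent.lead (meval pv \<mu>) (z_expo \<mu>) 1"
  unfolding meval_def z_expo_def
proof (intro lead_prod_laurent lead_power_laurent)
  fix v assume "v \<in> keys \<mu>"
  then obtain i j where v: "v = ZV i j" "(i, j) \<in> square n" using assms by blast
  have "laurent.lead (px (\<lambda>i j. lmono (single (i, j) (int m)))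
      (\<lambda>i j. lmono (- single (i, j) (int m))) n n i j) (single (i, j) (int m)) (1 :: 'k)"
    by (rule laurent.path_lead) (use v m_pos in \<open>auto simp: mult_single\<close>)
  then show "laurent.lead (pv v) (single (snd v) (int m)) 1"
    unfolding v pv_simps by (simp add: ZV_def u_def[abs_def] u'_def[abs_def])
qed

text \<open>The leading exponent of a monomial in the \<open>Z\<close> is \<open>m\<close> times its
  own exponent, so different monomials have different leading terms.\<close>

lemma psi_Zcar_inj:
  assumes "\<zeta> \<in> Pcar (Zvars n)" "psi \<zeta> = 0"
  shows "\<zeta> = 0"
proof (rule ccontr)
  assume "\<zeta> \<noteq> 0"
  then have ne: "keys \<zeta> \<noteq> {}" by simp
  have Z: "keys \<mu> \<subseteq> Zvars n" if "\<mu> \<in> keys \<zeta>" for \<mu>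
    using assms(1) that by (auto simp: Pcar_def)
  have "inj_on z_expo (keys \<zeta>)"
  proof (rule inj_onI, rule poly_mapping_eqI)
    fix \<mu> \<nu> v assume *: "\<mu> \<in> keys \<zeta>" "\<nu> \<in> keys \<zeta>" "z_expo \<mu> = z_expo \<nu>"
    show "lookup \<mu> v = lookup \<nu> v"
    proof (cases "v \<in> Zvars n")
      case True
      then have "v = (0, snd v)" by (auto simp: ZV_def)
      then show ?thesis
        using * lookup_z_expo[OF Z[OF *(1)], of "snd v"] lookup_z_expo[OF Z[OF *(2)], of "snd v"] m_pos by auto
    next
      case False
      then have "v \<notin> keys \<mu>" "v \<notin> keys \<nu>" using Z[OF *(1)] Z[OF *(2)] by blast+
      then show ?thesis by (simp add: in_keys_iff)
    qed
  qed
  then obtain \<mu> where \<mu>: "\<mu> \<in> keys \<zeta>"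
      "laurent.lead (psi \<zeta>) (z_expo \<mu>) (lookup \<zeta> \<mu> * 1)"
    unfolding psi_def laurent_kalg.lin_def
    using laurent.lead_sum[OF finite_keys ne, of z_expo "\<lambda>\<mu>. laurent_sc (lookup \<zeta> \<mu>) (meval pv \<mu>)"
        "\<lambda>\<mu>. lookup \<zeta> \<mu> * 1"] laurent.lead_sc[OF meval_lead[OF Z]] by blast
  then have "psi \<zeta> \<noteq> 0" using laurent.lead_nonzero by (auto simp: in_keys_iff)
  then show False using assms(2) by simp
qed

text \<open>Only the variables \<open>u\<close> and their inverses occur, and their exponents are
  multiples of \<open>m\<close>.\<close>

lemma psi_m_lattice:
  assumes "\<zeta> \<in> Pcar (Zvars n)"
  shows "keys (psi \<zeta>) \<subseteq> m_lattice"
proof -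
  define M where "M = {f :: 'k laurent. keys f \<subseteq> m_lattice}"
  have M: "is_subring M"
    unfolding is_subring_def
  proof (intro conjI ballI)
    fix f g assume *: "f \<in> M" "g \<in> M"
    show "f + g \<in> M" using * keys_add[of f g] by (auto simp: M_def)
    have "a + b \<in> m_lattice" if "a \<in> m_lattice" "b \<in> m_lattice" for a b
      using that by (simp add: m_lattice_def lookup_add)
    then show "f * g \<in> M" using * keys_mult[of f g] by (fastforce simp: M_def)
  qed (auto simp: M_def m_lattice_def)
  have u: "u i j \<in> M" "u' i j \<in> M" for i j
    by (auto simp: M_def u_def u'_def m_lattice_def lookup_single when_def)
  have "px u u' r s i j \<in> M" for r s i j
  proof (induction r arbitrary: j)
    case (Suc r)
    then show ?case using u by (auto intro!: subring_sum[OF M] subring_mult[OF M])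
  qed (use subring_0[OF M] in simp)
  then have pv: "pv v \<in> M" if "v \<in> Zvars n" for v using that by auto
  have sc: "laurent_sc c f \<in> M" if "f \<in> M" for c f
    using that by (auto simp: M_def in_keys_iff lookup_laurent_sc)
  have "psi \<zeta> \<in> M"
    unfolding psi_def laurent_kalg.lin_def meval_def
    using assms by (intro subring_sum[OF M] sc subring_prod[OF M] subring_power[OF M] pv) (auto simp: Pcar_def)
  then show "keys (psi \<zeta>) \<subseteq> m_lattice" by (simp add: M_def)
qed

lemma lookup_mult_lmono: "lookup (f * lmono g) (b :: expo) = (lookup f (b - g) :: 'k)"
proof -
  have eq: "f * lmono g = (\<Sum>a\<in>keys f. single (a + g) (lookup f a))"
    by (subst (1) poly_mapping_sum_single[of f, symmetric]) (simp add: sum_distrib_right mult_single)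
  have "lookup (f * lmono g) b = (\<Sum>a\<in>keys f. if a = b - g then lookup f a else 0)"
    unfolding eq lookup_sum by (intro sum.cong refl) (auto simp: lookup_single when_def)
  also have "\<dots> = (if b - g \<in> keys f then lookup f (b - g) else 0)"
    by (rule sum.delta) simp
  finally show ?thesis by (simp add: in_keys_iff)
qed

text \<open>Write \<open>f\<close> in normal forms modulo the ideal. The images of different normal
  forms, even with coefficients in the \<open>Z\<close>, have supports in different cosets of
  \<open>m_lattice\<close>; so every coefficient has image 0 and hence is 0.\<close>

theorem psi_eq_0_iff:
  assumes "f \<in> Tcar n m" "n \<ge> 1"
  shows "psi f = 0 \<longleftrightarrow> f \<in> Iideal n m"
proof
  assume f: "psi f = 0"
  obtain \<zeta> where \<zeta>: "\<And>\<rho>. \<zeta> \<rho> \<in> Pcar (Zvars n)" "f - (\<Sum>\<rho>\<in>nf_index. \<zeta> \<rho> * nf \<rho>) \<in> Iideal n m"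
    using Tcar_reducible[OF assms] unfolding reducible_def by blast
  let ?\<gamma> = "\<lambda>\<rho>. \<Sum>s\<in>{0..<n}. nf_expo s (\<rho> s)"
  have 0: "(\<Sum>\<rho>\<in>nf_index. psi (\<zeta> \<rho>) * lmono (?\<gamma> \<rho>)) = 0"
    using Iideal_psi[OF assms(2) \<zeta>(2)] f by (simp add: psi_diff psi_sum psi_mult psi_nf)
  have "\<zeta> \<rho> = 0" if \<rho>: "\<rho> \<in> nf_index" for \<rho>
  proof (rule psi_Zcar_inj[OF \<zeta>(1)], rule ccontr)
    assume "psi (\<zeta> \<rho>) \<noteq> 0"
    then obtain a where a: "a \<in> keys (psi (\<zeta> \<rho>))" by (metis all_not_in_conv keys_eq_empty)
    have neg: "- b \<in> m_lattice" if "b \<in> m_lattice" for b using that by (simp add: m_lattice_def)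
    \<comment> \<open>A contribution of \<open>\<rho>'\<close> to the same exponent would put the
      difference of the two normal form exponents into \<open>m_lattice\<close>.\<close>
    have other: "lookup (psi (\<zeta> \<rho>')) (a + ?\<gamma> \<rho> - ?\<gamma> \<rho>') = 0" if "\<rho>' \<in> nf_index - {\<rho>}" for \<rho>'
    proof (rule ccontr)
      assume "lookup (psi (\<zeta> \<rho>')) (a + ?\<gamma> \<rho> - ?\<gamma> \<rho>') \<noteq> 0"
      then have "a + ?\<gamma> \<rho> - ?\<gamma> \<rho>' \<in> m_lattice" "a \<in> m_lattice"
        using psi_m_lattice[OF \<zeta>(1)[of \<rho>']] psi_m_lattice[OF \<zeta>(1)[of \<rho>]] a
        by (meson in_keys_iff subsetD)+
      then have "(a + ?\<gamma> \<rho> - ?\<gamma> \<rho>') - a \<in> m_lattice" by (rule m_lattice_diff)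
      then have "?\<gamma> \<rho> - ?\<gamma> \<rho>' \<in> m_lattice" by simp
      then show False using nf_sum_inj[of \<rho> \<rho>'] that \<rho> by auto
    qed
    have "0 = lookup (\<Sum>\<rho>\<in>nf_index. psi (\<zeta> \<rho>) * lmono (?\<gamma> \<rho>)) (a + ?\<gamma> \<rho>)"
      by (simp only: 0 lookup_zero)
    also have "\<dots> = (\<Sum>\<rho>'\<in>nf_index. lookup (psi (\<zeta> \<rho>')) (a + ?\<gamma> \<rho> - ?\<gamma> \<rho>'))"
      by (simp only: lookup_sum lookup_mult_lmono)
    also have "\<dots> = lookup (psi (\<zeta> \<rho>)) (a + ?\<gamma> \<rho> - ?\<gamma> \<rho>)"
      using other finite_nf_index \<rho> by (subst sum.remove[of _ \<rho>]) auto
    also have "\<dots> \<noteq> 0" using a by (simp add: in_keys_iff)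
    finally show False by simp
  qed
  then show "f \<in> Iideal n m" using \<zeta>(2) by simp
qed (rule Iideal_psi[OF assms(2)])

end

section \<open>Surjectivity onto the centre\<close>

definition nonneg_expo :: "nat \<Rightarrow> expo set" where
  "nonneg_expo n = {a. keys a \<subseteq> square n \<and> (\<forall>v. 0 \<le> lookup a v)}"

text \<open>Integer exponents as such admit infinite descent. Nonnegative ones supported in the
  square become lists of naturals of fixed length, compared lexicographically.\<close>

lemma wf_nonneg_expo: "wf {(a, b). a \<in> nonneg_expo n \<and> b \<in> nonneg_expo n \<and> a < b}"
proof -
  define L where "L = sorted_list_of_set (square n)"
  define code where "code a = map (\<lambda>v. nat (lookup a v)) L" for a :: expo
  have L: "set L = square n" "sorted_wrt (<) L"
    by (simp_all add: L_def)
  have "(code a, code b) \<in> lex less_than"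
    if ab: "a \<in> nonneg_expo n" "b \<in> nonneg_expo n" "a < b" for a b
  proof -
    obtain v where v: "lookup a v < lookup b v"
      "\<And>w. w < v \<Longrightarrow> lookup a w = lookup b w"
      using ab(3) unfolding less_poly_mapping.rep_eq by (rule less_funE) blast
    have nn: "0 \<le> lookup a v" using ab(1) unfolding nonneg_expo_def by blast
    then have "v \<in> keys b" using v(1) by (auto simp: in_keys_iff)
    then have "v \<in> set L" using ab(2) L(1) by (auto simp: nonneg_expo_def)
    then obtain L1 L2 where split: "L = L1 @ v # L2" by (auto dest: split_list)
    have "w < v" if "w \<in> set L1" for w using L(2) that by (simp add: split sorted_wrt_append)
    then have eq: "map (\<lambda>v. nat (lookup a v)) L1 = map (\<lambda>v. nat (lookup b v)) L1"
      using v(2) by auto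
    have "nat (lookup a v) < nat (lookup b v)" using nn v(1) by simp
    then show ?thesis
      unfolding code_def split map_append list.map eq by (intro lex_append_leftI) simp
  qed
  then have "{(a, b). a \<in> nonneg_expo n \<and> b \<in> nonneg_expo n \<and> a < b} \<subseteq> inv_image (lex less_than) code"
    by (auto simp: inv_image_def)
  then show ?thesis
    by (rule wf_subset[rotated]) (intro wf_inv_image wf_lex wf_less_than)
qed

text \<open>Passing from \<open>k\<close> to \<open>Suc k\<close> raises the sign by 1 exactly at
  \<open>i = k\<close> and \<open>i = Suc k\<close>.\<close>

lemma sum_sgn_diff:
  fixes f :: "nat \<Rightarrow> int"
  assumes "k \<in> {1..n}" "Suc k \<in> {1..n}"
  shows "(\<Sum>i\<in>{1..n}. f i * sgn (int (Suc k) - int i)) = (\<Sum>i\<in>{1..n}. f i * sgn (int k - int i)) + f k + f (Suc k)"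
proof -
  have "(\<Sum>i\<in>{1..n}. f i * sgn (int (Suc k) - int i))
      = (\<Sum>i\<in>{1..n}. f i * sgn (int k - int i) + (if i = k then f k else 0) + (if i = Suc k then f (Suc k) else 0))"
    by (intro sum.cong refl) (auto simp: sgn_if)
  also have "\<dots> = (\<Sum>i\<in>{1..n}. f i * sgn (int k - int i)) + (\<Sum>i\<in>{1..n}. if i = k then f k else 0)
      + (\<Sum>i\<in>{1..n}. if i = Suc k then f (Suc k) else 0)"
    by (simp only: sum.distrib)
  also have "(\<Sum>i\<in>{1..n}. if i = k then f k else 0) = f k"
    using assms by (subst sum.delta) auto
  also have "(\<Sum>i\<in>{1..n}. if i = Suc k then f (Suc k) else 0) = f (Suc k)"
    using assms by (subst sum.delta) auto
  finally show ?thesis .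
qed

context quantum_matrices
begin

section \<open>Exponents in the radical modulo m\<close>

context
  fixes a :: expo
  assumes keys_a: "keys a \<subseteq> square n"
    and radical: "\<And>v. v \<in> square n \<Longrightarrow> int m dvd qform a (single v 1)"
begin

definition form_at :: "nat \<Rightarrow> nat \<Rightarrow> int" where
  "form_at k l = (\<Sum>i\<in>{1..n}. lookup a (i, l) * sgn (int k - int i)) +
    (\<Sum>j\<in>{1..n}. lookup a (k, j) * sgn (int l - int j))"

lemma dvd_form_at: "(k, l) \<in> square n \<Longrightarrow> int m dvd form_at k l"
  using radical[of "(k, l)"] qform_single_right[OF keys_a, of k l] by (simp add: form_at_def)

lemma form_at_Suc:
  assumes "k \<in> {1..n}" "Suc k \<in> {1..n}"
  shows "form_at (Suc k) l - form_at k l = lookup a (k, l) + lookup a (Suc k, l)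
    + (\<Sum>j\<in>{1..n}. (lookup a (Suc k, j) - lookup a (k, j)) * sgn (int l - int j))"
  using sum_sgn_diff[OF assms, of "\<lambda>i. lookup a (i, l)"]
  by (simp add: form_at_def left_diff_distrib sum_subtractf)

text \<open>The mixed second difference of the form in \<open>k\<close> and \<open>l\<close> is
  twice the difference along the diagonal, and 2 is invertible modulo \<open>m\<close>.\<close>

lemma radical_diagonal_step:
  assumes "k \<in> {1..n}" "Suc k \<in> {1..n}" "l \<in> {1..n}" "Suc l \<in> {1..n}"
  shows "int m dvd lookup a (Suc k, Suc l) - lookup a (k, l)"
proof -
  have "int m dvd (form_at (Suc k) (Suc l) - form_at k (Suc l)) - (form_at (Suc k) l - form_at k l)"
    using assms by (intro dvd_diff dvd_form_at) auto
  also have "(form_at (Suc k) (Suc l) - form_at k (Suc l)) - (form_at (Suc k) l - form_at k l)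
      = 2 * (lookup a (Suc k, Suc l) - lookup a (k, l))"
    unfolding form_at_Suc[OF assms(1,2)]
    using sum_sgn_diff[OF assms(3,4), of "\<lambda>j. lookup a (Suc k, j) - lookup a (k, j)"]
    by simp
  finally show ?thesis
    using odd_m by (subst (asm) coprime_dvd_mult_right_iff) auto
qed

lemma radical_diagonal:
  assumes "(i, j) \<in> square n" "i + d \<le> n" "j + d \<le> n"
  shows "int m dvd lookup a (i + d, j + d) - lookup a (i, j)"
  using assms(2,3)
proof (induction d)
  case (Suc d)
  have "int m dvd (lookup a (Suc (i + d), Suc (j + d)) - lookup a (i + d, j + d))
      + (lookup a (i + d, j + d) - lookup a (i, j))"
    by (intro dvd_add radical_diagonal_step Suc.IH) (use Suc.prems assms(1) in auto)
  then show ?case by simp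
qed simp

text \<open>\<open>(Suc k, 1)\<close> starts the diagonal of length \<open>n - k\<close> and
  \<open>(k, n)\<close> ends the one of length \<open>k\<close>. Take the difference of the form
  between rows \<open>Suc k\<close> and \<open>k\<close> in column 1: modulo \<open>m\<close> the
  row \<open>Suc k\<close> is the row \<open>k\<close> shifted by one column, so the sum
  telescopes.\<close>

lemma radical_opposite:
  assumes "k \<in> {1..n}" "Suc k \<in> {1..n}"
  shows "int m dvd lookup a (Suc k, 1) + lookup a (k, n)"
proof -
  let ?\<alpha> = "\<lambda>i j. lookup a (i, j)"
  have "(\<Sum>j\<in>{1..n}. (?\<alpha> (Suc k) j - ?\<alpha> k j) * sgn (int 1 - int j)) = - (\<Sum>j\<in>{Suc 1..n}. ?\<alpha> (Suc k) j - ?\<alpha> k j)"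
    unfolding sum_negf[symmetric] by (rule sum.mono_neutral_cong_right) (auto simp: sgn_if)
  then have F: "form_at (Suc k) 1 - form_at k 1
      = ?\<alpha> k 1 + ?\<alpha> (Suc k) 1 - (\<Sum>j\<in>{Suc 1..n}. ?\<alpha> (Suc k) j - ?\<alpha> k j)"
    using form_at_Suc[OF assms, of 1] by simp
  have tel: "(\<Sum>j\<in>{Suc 1..n}. ?\<alpha> k j - ?\<alpha> k (j - 1)) = ?\<alpha> k n - ?\<alpha> k 1"
    using assms by (intro sum_telescope'') auto
  have "(\<Sum>j\<in>{Suc 1..n}. ?\<alpha> (Suc k) j - ?\<alpha> k (j - 1))
      = (\<Sum>j\<in>{Suc 1..n}. (?\<alpha> (Suc k) j - ?\<alpha> k j) + (?\<alpha> k j - ?\<alpha> k (j - 1)))"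
    by simp
  also have "\<dots> = (\<Sum>j\<in>{Suc 1..n}. ?\<alpha> (Suc k) j - ?\<alpha> k j) + (?\<alpha> k n - ?\<alpha> k 1)"
    unfolding sum.distrib tel ..
  finally have eq: "?\<alpha> (Suc k) 1 + ?\<alpha> k n
      = (form_at (Suc k) 1 - form_at k 1) + (\<Sum>j\<in>{Suc 1..n}. ?\<alpha> (Suc k) j - ?\<alpha> k (j - 1))"
    unfolding F by simp
  have "int m dvd (\<Sum>j\<in>{Suc 1..n}. ?\<alpha> (Suc k) j - ?\<alpha> k (j - 1))"
  proof (rule dvd_sum)
    fix j assume "j \<in> {Suc 1..n}"
    then obtain j' where "j = Suc j'" "1 \<le> j'" "Suc j' \<le> n" by (cases j) auto
    then show "int m dvd ?\<alpha> (Suc k) j - ?\<alpha> k (j - 1)"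
      using radical_diagonal_step[of k j'] assms by auto
  qed
  then show ?thesis
    unfolding eq using assms by (intro dvd_add dvd_diff dvd_form_at) auto
qed

text \<open>Divide every entry by \<open>m\<close>. The remainders are governed by the first row and
  form the exponent of a normal form; the quotients are nonnegative and form a monomial in the
  \<open>Z\<close>.\<close>

lemma radical_expo:
  assumes "\<And>v. 0 \<le> lookup a v" "n \<ge> 1"
  shows "\<exists>\<mu> \<rho>. keys \<mu> \<subseteq> Zvars n \<and> \<rho> \<in> nf_index \<and> a = z_expo \<mu> + (\<Sum>s\<in>{0..<n}. nf_expo s (\<rho> s))"
proof -
  let ?\<alpha> = "\<lambda>i j. lookup a (i, j)"
  \<comment> \<open>The first row meets the diagonal of slot \<open>s\<close> in column
    \<open>n - s + 1\<close>, and the main diagonal, slot 0, in column 1.\<close>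
  define \<rho> where "\<rho> s = (if s < n then nat (?\<alpha> 1 (if s = 0 then 1 else n - s + 1) mod int m) else undefined)" for s
  define \<mu> where "\<mu> = (\<Sum>w\<in>square n. single (0::nat, w) (nat (lookup a w div int m)))"
  let ?\<gamma> = "\<Sum>s\<in>{0..<n}. nf_expo s (\<rho> s)"
  have m: "int m > 0" using m_pos by simp
  have lookup_\<mu>: "lookup \<mu> (0, w) = (if w \<in> square n then nat (lookup a w div int m) else 0)" for w
  proof -
    have "lookup \<mu> (0, w) = (\<Sum>v\<in>square n. if v = w then nat (lookup a v div int m) else 0)"
      unfolding \<mu>_def lookup_sum by (intro sum.cong refl) (simp add: lookup_single when_def)
    then show ?thesis by (subst (asm) sum.delta) auto
  qed
  have keys_\<mu>: "keys \<mu> \<subseteq> Zvars n"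
  proof -
    have "keys \<mu> \<subseteq> (\<Union>w\<in>square n. keys (single (0::nat, w) (nat (lookup a w div int m))))"
      unfolding \<mu>_def by (rule keys_sum)
    then show ?thesis by (fastforce simp: ZV_def split: if_splits)
  qed
  have \<rho>: "\<rho> \<in> nf_index"
    using m by (auto simp: \<rho>_def nat_less_iff)
  have \<gamma>: "lookup ?\<gamma> (i, j) = ?\<alpha> i j mod int m" if ij: "(i, j) \<in> square n" for i j
  proof (cases "i \<le> j")
    case True
    have "\<rho> (diag_index i j) = nat (?\<alpha> 1 (1 + (j - i)) mod int m)"
      using ij True by (auto simp: \<rho>_def diag_index_def)
    moreover have "int m dvd ?\<alpha> (1 + (i - 1)) (1 + (j - i) + (i - 1)) - ?\<alpha> 1 (1 + (j - i))"
      by (rule radical_diagonal) (use ij True in auto)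
    then have "?\<alpha> 1 (1 + (j - i)) mod int m = ?\<alpha> i j mod int m"
      using ij True by (simp add: mod_eq_dvd_iff dvd_diff_commute)
    ultimately show ?thesis
      using lookup_nf_sum[OF ij, of \<rho>] True m by (simp add: Let_def)
  next
    case False
    define s where "s = i - j"
    have s: "1 \<le> s" "s < n" using ij False by (auto simp: s_def)
    have r: "\<rho> (diag_index i j) = nat (?\<alpha> 1 (n - s + 1) mod int m)"
      using False s by (auto simp: \<rho>_def diag_index_def s_def)
    have idx: "Suc s + (j - 1) = i" "1 + (j - 1) = j" "1 + (s - 1) = s" "n - s + 1 + (s - 1) = n"
      using ij False s by (auto simp: s_def)
    have "int m dvd ?\<alpha> (Suc s + (j - 1)) (1 + (j - 1)) - ?\<alpha> (Suc s) 1"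
      by (rule radical_diagonal) (use ij False s in \<open>auto simp: s_def\<close>)
    then have 1: "int m dvd ?\<alpha> i j - ?\<alpha> (Suc s) 1" unfolding idx .
    have 2: "int m dvd ?\<alpha> (Suc s) 1 + ?\<alpha> s n"
      by (rule radical_opposite) (use s in auto)
    have "int m dvd ?\<alpha> (1 + (s - 1)) (n - s + 1 + (s - 1)) - ?\<alpha> 1 (n - s + 1)"
      by (rule radical_diagonal) (use s in auto)
    then have 3: "int m dvd ?\<alpha> s n - ?\<alpha> 1 (n - s + 1)" unfolding idx .
    have "int m dvd (?\<alpha> i j - ?\<alpha> (Suc s) 1) + (?\<alpha> (Suc s) 1 + ?\<alpha> s n) - (?\<alpha> s n - ?\<alpha> 1 (n - s + 1))"
      by (rule dvd_diff[OF dvd_add[OF 1 2] 3])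
    then have "?\<alpha> i j mod int m = (- ?\<alpha> 1 (n - s + 1)) mod int m"
      by (simp add: mod_eq_dvd_iff)
    \<comment> \<open>The residue of \<open>- k\<close> is 0 or \<open>m - k\<close>, exactly the
      case distinction for entries below the main diagonal of a normal form.\<close>
    also have "\<dots> = (if ?\<alpha> 1 (n - s + 1) mod int m = 0 then 0 else int m - ?\<alpha> 1 (n - s + 1) mod int m)"
      by (rule zmod_zminus1_eq_if)
    finally show ?thesis
      using lookup_nf_sum[OF ij, of \<rho>] False m pos_mod_sign[of "int m" "?\<alpha> 1 (n - s + 1)"]
      by (auto simp: Let_def r nat_eq_iff)
  qed
  have keys_\<gamma>: "keys ?\<gamma> \<subseteq> square n"
  proof -
    have "keys (nf_expo s k) \<subseteq> square n" if "s \<in> {0..<n}" for s k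
      using that rad_yexp[of s n m k] keys_cmul[of "int k" "diag 1 1 n"] rad_diag[of n m]
      by (auto simp: nf_expo_def rad_def)
    then show ?thesis using keys_sum[of "\<lambda>s. nf_expo s (\<rho> s)" "{0..<n}"] by blast
  qed
  have "a = z_expo \<mu> + ?\<gamma>"
  proof (rule poly_mapping_eqI)
    fix w :: "nat \<times> nat"
    obtain i j where w: "w = (i, j)" by (cases w)
    show "lookup a w = lookup (z_expo \<mu> + ?\<gamma>) w"
    proof (cases "w \<in> square n")
      case True
      then have "int (nat (?\<alpha> i j div int m)) = ?\<alpha> i j div int m"
        using assms(1)[of "(i, j)"] m by (simp add: pos_imp_zdiv_nonneg_iff)
      then show ?thesis
        using True \<gamma>[of i j] w by (simp add: lookup_add lookup_z_expo[OF keys_\<mu>] lookup_\<mu>)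
    next
      case False
      then have "w \<notin> keys a" "w \<notin> keys ?\<gamma>" using keys_a keys_\<gamma> by blast+
      then show ?thesis
        using False by (simp only: lookup_add lookup_z_expo[OF keys_\<mu>] lookup_\<mu> in_keys_iff) simp
    qed
  qed
  then show ?thesis using keys_\<mu> \<rho> by blast
qed

end

section \<open>Removing leading terms of central elements\<close>

lemma wt_nonneg: "set l \<subseteq> square n \<Longrightarrow> wt l \<in> nonneg_expo n"
  by (auto simp: nonneg_expo_def lookup_wt in_keys_iff)

lemma nf_Tcar: "\<rho> \<in> nf_index \<Longrightarrow> nf \<rho> \<in> Tcar n m"
  unfolding nf_def by (intro subring_prod[OF subring_Tcar] nf_factor_Tcar) auto

lemma centre_diff: "f \<in> centre_reps n q \<Longrightarrow> g \<in> centre_reps n q \<Longrightarrow> f - g \<in> centre_reps n q"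
proof -
  assume *: "f \<in> centre_reps n q" "g \<in> centre_reps n q"
  have "(f - g) * h - h * (f - g) \<in> Jq n q" if "h \<in> Fcar n" for h
  proof -
    have "(f * h - h * f) - (g * h - h * g) \<in> Jq n q"
      by (rule ideal_diff[OF subring_Fcar ideal_Jq]) (use * that in \<open>auto simp: centre_reps_def\<close>)
    then show ?thesis by (simp add: algebra_simps)
  qed
  then show ?thesis using * subring_diff[OF subring_Fcar] by (auto simp: centre_reps_def)
qed

text \<open>A monomial in the \<open>Z\<close> times a normal form, suitably scaled, has an image
  with the same leading term. The difference is again central, and its leading exponent is a weight
  \<open>wt\<close>, hence nonnegative, and smaller.\<close>

lemma centre_surjective_lead:
  assumes "n \<ge> 1" "a \<in> nonneg_expo n" "f \<in> centre_reps n q" "tor.lead (ev f) a c" "c \<noteq> 0"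
  shows "\<exists>P\<in>Tcar n m. phi n m q P - f \<in> Jq n q"
  using assms(2-5)
proof (induction a arbitrary: f c rule: wf_induct_rule[OF wf_nonneg_expo[of n]])
  case (1 a)
  have f: "f \<in> Fcar n" using 1 by (simp add: centre_reps_def)
  obtain \<mu> \<rho> where \<mu>: "keys \<mu> \<subseteq> Zvars n" "\<rho> \<in> nf_index"
    and a: "a = z_expo \<mu> + (\<Sum>s\<in>{0..<n}. nf_expo s (\<rho> s))"
    using radical_expo[of a] centre_lead[OF 1(3-5)] 1(2) assms(1) by (auto simp: nonneg_expo_def)
  define P where "P = single \<mu> c * nf \<rho>"
  have P: "P \<in> Tcar n m"
    unfolding P_def using \<mu> Zvars_Tvars[of n m]
    by (intro subring_mult[OF subring_Tcar] nf_Tcar) (auto simp: Tcar_def split: if_splits)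
  have "psi P = laurent_sc c (meval pv \<mu> * lmono (\<Sum>s\<in>{0..<n}. nf_expo s (\<rho> s)))"
    unfolding P_def psi_mult psi_nf by (simp add: psi_def)
  moreover have "laurent.lead (meval pv \<mu> * lmono (\<Sum>s\<in>{0..<n}. nf_expo s (\<rho> s))) a 1"
    unfolding a by (intro lead_mult_laurent meval_lead \<mu> laurent.lead_T)
  ultimately have "laurent.lead (psi P) a c"
    using laurent.lead_sc[of _ a 1 c] by simp
  then have leadP: "tor.lead (ev (phi n m q P)) a c"
    using telt_lead ev_phi[OF P assms(1)] by simp
  define g where "g = f - phi n m q P"
  have g: "g \<in> centre_reps n q"
    unfolding g_def by (intro centre_diff 1 phi_centre P assms(1))
  have evg: "ev g = ev f - ev (phi n m q P)" by (simp add: g_def ev_diff)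
  show ?case
  proof (cases "g \<in> Jq n q")
    case True
    then have "- g \<in> Jq n q" by (rule ideal_uminus[OF subring_Fcar ideal_Jq])
    then show ?thesis using P by (intro bexI[of _ P]) (auto simp: g_def)
  next
    case False
    have "g \<in> Fcar n" using g by (simp add: centre_reps_def)
    then obtain l d where l: "set l \<subseteq> square n" "d \<noteq> 0" "tor.lead (ev g) (wt l) d"
      using ev_lead False by blast
    have "ev g \<in> tor.below a" unfolding evg by (rule tor.lead_diff[OF 1(4) leadP])
    then have "wt l < a"
      using tor.\<kappa>_below[of "ev g" a "wt l"] tor.lead_\<kappa>[OF l(3)] l(2) by (meson leI)
    then obtain P' where P': "P' \<in> Tcar n m" "phi n m q P' - g \<in> Jq n q"
      using 1(1)[of "wt l" g d] 1(2) wt_nonneg[OF l(1)] g l by blast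
    have PP: "P' + P \<in> Tcar n m" by (rule subring_add[OF subring_Tcar P'(1) P])
    have "ev (phi n m q (P' + P) - f) = 0"
      using Jq_ev[OF P'(2)] by (simp add: ev_diff ev_phi[OF PP assms(1)] ev_phi[OF P assms(1)] ev_phi[OF P'(1) assms(1)] psi_add telt_add evg)
    then have "phi n m q (P' + P) - f \<in> Jq n q"
      using ev_eq_0_iff subring_diff[OF subring_Fcar phi_Fcar[OF PP] f] by blast
    then show ?thesis using PP by blast
  qed
qed

theorem centre_surjective:
  assumes "n \<ge> 1" "f \<in> centre_reps n q"
  shows "\<exists>P\<in>Tcar n m. phi n m q P - f \<in> Jq n q"
proof (cases "f \<in> Jq n q")
  case True
  have "phi n m q 0 - f \<in> Jq n q"
    using ideal_uminus[OF subring_Fcar ideal_Jq True] by (simp add: phi_def)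
  then show ?thesis using subring_0[OF subring_Tcar] by blast
next
  case False
  have "f \<in> Fcar n" using assms(2) by (simp add: centre_reps_def)
  then obtain l c where "set l \<subseteq> square n" "c \<noteq> 0" "tor.lead (ev f) (wt l) c"
    using ev_lead False by blast
  then show ?thesis using centre_surjective_lead assms wt_nonneg by blast
qed

end

section \<open>Krull dimension\<close>

lemma homogeneous_system_nontrivial:
  fixes M :: "'a \<Rightarrow> 'b \<Rightarrow> 'k::field"
  assumes "finite B" "finite A" "card B < card A"
  shows "\<exists>c. (\<exists>a\<in>A. c a \<noteq> 0) \<and> (\<forall>b\<in>B. (\<Sum>a\<in>A. c a * M a b) = 0)"
  using assms
proof (induction B arbitrary: A M rule: finite_induct)
  case empty
  then have "A \<noteq> {}" by auto
  then show ?case by (intro exI[of _ "\<lambda>_. 1"]) auto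
next
  case (insert b B)
  show ?case
  proof (cases "\<exists>a\<in>A. M a b \<noteq> 0")
    case False
    obtain c where "\<exists>a\<in>A. c a \<noteq> 0" "\<forall>b\<in>B. (\<Sum>a\<in>A. c a * M a b) = 0"
      using insert.IH[of A M] insert.prems insert.hyps by auto
    then show ?thesis using False by (intro exI[of _ c]) auto
  next
    case True
    then obtain a0 where a0: "a0 \<in> A" "M a0 b \<noteq> 0" by blast
    define M' where "M' a b' = M a b' - M a b / M a0 b * M a0 b'" for a b'
    have "card B < card (A - {a0})" using insert.prems insert.hyps a0 by simp
    then obtain c where c: "\<exists>a\<in>A-{a0}. c a \<noteq> 0" "\<forall>b'\<in>B. (\<Sum>a\<in>A-{a0}. c a * M' a b') = 0"
      using insert.IH[of "A - {a0}" M'] insert.prems by auto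
    \<comment> \<open>Equation \<open>b\<close> determines the value at the pivot \<open>a0\<close>;
      substituting it into the other equations gives the system \<open>M'\<close>.\<close>
    define c' where "c' a = (if a = a0 then - (\<Sum>a\<in>A-{a0}. c a * (M a b / M a0 b)) else c a)" for a
    have sum: "(\<Sum>a\<in>A. c' a * M a b') = (\<Sum>a\<in>A-{a0}. c a * M' a b')" for b'
    proof -
      have "(\<Sum>a\<in>A. c' a * M a b') = c' a0 * M a0 b' + (\<Sum>a\<in>A-{a0}. c' a * M a b')"
        using a0 insert.prems by (intro sum.remove) auto
      also have "(\<Sum>a\<in>A-{a0}. c' a * M a b') = (\<Sum>a\<in>A-{a0}. c a * M a b')"
        by (intro sum.cong) (auto simp: c'_def)
      also have "c' a0 * M a0 b' = - (\<Sum>a\<in>A-{a0}. c a * (M a b / M a0 b * M a0 b'))"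
        by (simp add: c'_def sum_distrib_right mult.assoc)
      finally show ?thesis by (simp add: M'_def right_diff_distrib sum_subtractf)
    qed
    have "(\<Sum>a\<in>A. c' a * M a b) = 0"
      unfolding sum using a0 by (simp add: M'_def)
    moreover have "\<exists>a\<in>A. c' a \<noteq> 0" using c(1) by (auto simp: c'_def)
    ultimately show ?thesis using c(2) sum by (intro exI[of _ c']) auto
  qed
qed

definition box :: "nat \<Rightarrow> nat \<Rightarrow> expo set" where
  "box n M = {a. keys a \<subseteq> square n \<and> (\<forall>v. \<bar>lookup a v\<bar> \<le> int M)}"

lemma card_box: "finite (box n M)" "card (box n M) \<le> (2 * M + 1) ^ (n ^ 2)"
proof -
  let ?P = "square n \<rightarrow>\<^sub>E {- int M..int M}"
  let ?f = "\<lambda>a. restrict (lookup a) (square n)"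
  have inj: "inj_on ?f (box n M)"
  proof (rule inj_onI, rule poly_mapping_eqI)
    fix a b :: expo and v assume *: "a \<in> box n M" "b \<in> box n M" "?f a = ?f b"
    show "lookup a v = lookup b v"
    proof (cases "v \<in> square n")
      case True
      then show ?thesis using fun_cong[OF *(3), of v] by simp
    next
      case False
      then have "v \<notin> keys a" "v \<notin> keys b" using * unfolding box_def by blast+
      then show ?thesis by (simp add: in_keys_iff)
    qed
  qed
  have sub: "?f ` box n M \<subseteq> ?P"
  proof
    fix g assume "g \<in> ?f ` box n M"
    then obtain a where a: "a \<in> box n M" "g = ?f a" by blast
    show "g \<in> ?P"
      unfolding a(2)
    proof (rule PiE_I)
      fix v assume v: "v \<in> square n"
      have "\<bar>lookup a v\<bar> \<le> int M" using a(1) unfolding box_def by blast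
      then have "- int M \<le> lookup a v \<and> lookup a v \<le> int M" by linarith
      then show "?f a v \<in> {- int M..int M}"
        using v by (simp only: restrict_apply if_True atLeastAtMost_iff)
    qed (simp only: restrict_apply if_False)
  qed
  have fin: "finite ?P" by (intro finite_PiE) auto
  have "nat (2 * int M + 1) = 2 * M + 1" by linarith
  then have "card ?P = (2 * M + 1) ^ (n ^ 2)"
    by (subst card_PiE) (auto simp: power2_eq_square)
  then show "card (box n M) \<le> (2 * M + 1) ^ (n ^ 2)"
    using card_mono[OF fin sub] card_image[OF inj] by simp
  show "finite (box n M)"
    using finite_subset[OF sub fin] inj finite_image_iff by blast
qed

lemma box_mult:
  fixes f g :: "'k::field laurent"
  assumes "keys f \<subseteq> box n M" "keys g \<subseteq> box n N"
  shows "keys (f * g) \<subseteq> box n (M + N)"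
proof
  fix c assume "c \<in> keys (f * g)"
  then obtain a b where "a \<in> box n M" "b \<in> box n N" "c = a + b"
    using keys_mult[of f g] assms by blast
  then show "c \<in> box n (M + N)"
    using keys_add[of a b] unfolding box_def
    by (auto simp: lookup_add intro!: order.trans[OF abs_triangle_ineq] add_mono)
qed

lemma box_power:
  fixes f :: "'k::field laurent"
  assumes "keys f \<subseteq> box n M"
  shows "keys (f ^ k) \<subseteq> box n (k * M)"
proof (induction k)
  case 0
  then show ?case by (auto simp: box_def)
next
  case (Suc k)
  then show ?case using box_mult[OF assms Suc] by simp
qed

lemma box_prod:
  fixes f :: "'i \<Rightarrow> 'k::field laurent"
  assumes "finite A" "\<And>i. i \<in> A \<Longrightarrow> keys (f i) \<subseteq> box n (M i)"
  shows "keys (\<Prod>i\<in>A. f i) \<subseteq> box n (\<Sum>i\<in>A. M i)"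
  using assms
proof (induction A rule: finite_induct)
  case empty
  then show ?case by (auto simp: box_def)
next
  case (insert i A)
  then show ?case using box_mult[of "f i" n "M i" "\<Prod>i\<in>A. f i" "\<Sum>i\<in>A. M i"] by simp
qed

lemma box_mono: "M \<le> N \<Longrightarrow> box n M \<subseteq> box n N"
  unfolding box_def by (auto intro: order.trans[of _ "int M" "int N"])

lemma laurent_in_box:
  fixes f :: "'k::field laurent"
  assumes "\<And>a. a \<in> keys f \<Longrightarrow> keys a \<subseteq> square n"
  shows "\<exists>M. keys f \<subseteq> box n M"
proof -
  define M where "M = (\<Sum>a\<in>keys f. \<Sum>v\<in>keys a. nat \<bar>lookup a v\<bar>)"
  have "\<bar>lookup a v\<bar> \<le> int M" if a: "a \<in> keys f" for a v
  proof (cases "v \<in> keys a")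
    case True
    have "nat \<bar>lookup a v\<bar> \<le> (\<Sum>v\<in>keys a. nat \<bar>lookup a v\<bar>)"
      using True by (intro member_le_sum) auto
    also have "\<dots> \<le> M"
      unfolding M_def using a by (intro member_le_sum[of a _ "\<lambda>a. \<Sum>v\<in>keys a. nat \<bar>lookup a v\<bar>"]) auto
    finally show ?thesis by linarith
  qed (simp add: in_keys_iff)
  then show ?thesis using assms unfolding box_def by blast
qed

text \<open>More than \<open>n\<^sup>2\<close> Laurent polynomials in \<open>n\<^sup>2\<close> variables satisfy a polynomial relation: there are more
  monomials with exponents at most \<open>s\<close> in them than lattice points in the box that contains their supports.\<close>
lemma laurent_algebraic_dependence:
  fixes y :: "nat \<Rightarrow> 'k::field laurent"
  assumes "\<And>i a. a \<in> keys (y i) \<Longrightarrow> keys a \<subseteq> square n"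
  shows "\<exists>F c. finite F \<and> F \<noteq> {} \<and> F \<subseteq> extensional {0..<Suc (n ^ 2)} \<and> (\<forall>\<alpha>\<in>F. c \<alpha> \<noteq> 0) \<and>
    (\<Sum>\<alpha>\<in>F. single 0 (c \<alpha>) * (\<Prod>i\<in>{0..<Suc (n ^ 2)}. y i ^ \<alpha> i)) = 0"
proof -
  let ?d = "n ^ 2"
  let ?I = "{0..<Suc ?d}"
  obtain N where N: "\<And>i. keys (y i) \<subseteq> box n (N i)"
    using laurent_in_box[of "y _" n] assms by metis
  define E where "E = (\<Sum>i\<in>?I. N i)"
  define K where "K = 2 * E + 1"
  \<comment> \<open>Chosen so that \<open>(2 * (s * E) + 1) ^ ?d \<le> (K * (s + 1)) ^ ?d = s * (s +
    1) ^ ?d\<close>, which is less than \<open>(s + 1) ^ Suc ?d\<close>, the number of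
    monomials.\<close>
  define s where "s = K ^ ?d"
  let ?A = "?I \<rightarrow>\<^sub>E {0..s}"
  have yE: "keys (\<Prod>i\<in>?I. y i ^ \<alpha> i) \<subseteq> box n (s * E)" if "\<alpha> \<in> ?A" for \<alpha>
  proof -
    have "keys (\<Prod>i\<in>?I. y i ^ \<alpha> i) \<subseteq> box n (\<Sum>i\<in>?I. \<alpha> i * N i)"
      by (intro box_prod box_power N) auto
    also have "(\<Sum>i\<in>?I. \<alpha> i * N i) \<le> s * E"
      unfolding E_def sum_distrib_left using that by (intro sum_mono mult_right_mono) auto
    then have "box n (\<Sum>i\<in>?I. \<alpha> i * N i) \<subseteq> box n (s * E)" by (rule box_mono)
    finally show ?thesis .
  qed
  have finA: "finite ?A" by (intro finite_PiE) auto
  have "card (box n (s * E)) \<le> (2 * (s * E) + 1) ^ ?d" by (rule card_box)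
  also have "\<dots> \<le> (K * (s + 1)) ^ ?d"
    by (intro power_mono) (auto simp: K_def algebra_simps)
  also have "\<dots> = s * (s + 1) ^ ?d" by (simp only: power_mult_distrib s_def)
  also have "\<dots> < (s + 1) ^ Suc ?d" by simp
  also have "\<dots> = card ?A" by (subst card_PiE) auto
  finally obtain c where c: "\<exists>\<alpha>\<in>?A. c \<alpha> \<noteq> 0"
      "\<And>b. b \<in> box n (s * E) \<Longrightarrow> (\<Sum>\<alpha>\<in>?A. c \<alpha> * lookup (\<Prod>i\<in>?I. y i ^ \<alpha> i) b) = 0"
    using homogeneous_system_nontrivial[OF card_box(1) finA, of n "s * E" "\<lambda>\<alpha>. lookup (\<Prod>i\<in>?I. y i ^ \<alpha> i)"]
    by blast
  define F where "F = {\<alpha>\<in>?A. c \<alpha> \<noteq> 0}"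
  have "(\<Sum>\<alpha>\<in>F. single 0 (c \<alpha>) * (\<Prod>i\<in>?I. y i ^ \<alpha> i)) = 0"
  proof (rule poly_mapping_eqI)
    fix b
    have "lookup (\<Sum>\<alpha>\<in>F. single 0 (c \<alpha>) * (\<Prod>i\<in>?I. y i ^ \<alpha> i)) b
        = (\<Sum>\<alpha>\<in>F. c \<alpha> * lookup (\<Prod>i\<in>?I. y i ^ \<alpha> i) b)"
      by (simp only: lookup_sum laurent_sc_def[symmetric] lookup_laurent_sc)
    also have "\<dots> = (\<Sum>\<alpha>\<in>?A. c \<alpha> * lookup (\<Prod>i\<in>?I. y i ^ \<alpha> i) b)"
      by (rule sum.mono_neutral_left[OF finA]) (auto simp: F_def)
    also have "\<dots> = 0"
    proof (cases "b \<in> box n (s * E)")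
      case False
      have "c \<alpha> * lookup (\<Prod>i\<in>?I. y i ^ \<alpha> i) b = 0" if "\<alpha> \<in> ?A" for \<alpha>
      proof -
        have "b \<notin> keys (\<Prod>i\<in>?I. y i ^ \<alpha> i)" using yE[OF that] False by blast
        then show ?thesis by (simp add: in_keys_iff)
      qed
      then show ?thesis by (rule sum.neutral[OF ballI])
    qed (rule c(2))
    finally show "lookup (\<Sum>\<alpha>\<in>F. single 0 (c \<alpha>) * (\<Prod>i\<in>?I. y i ^ \<alpha> i)) b
        = lookup 0 b" by simp
  qed
  moreover have "finite F" by (rule finite_subset[OF _ finA]) (auto simp: F_def)
  moreover have "F \<noteq> {}" "F \<subseteq> extensional ?I" "\<forall>\<alpha>\<in>F. c \<alpha> \<noteq> 0"
    using c(1) by (auto simp: F_def PiE_def)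
  ultimately show ?thesis by blast
qed

text \<open>Compare the lexicographically smallest monomial of the relation with the rest, climbing the chain.\<close>
lemma prime_chain_no_relation:
  fixes S :: "'a::comm_ring_1 set"
  assumes S: "is_subring S"
    and C: "\<And>i. i \<le> l \<Longrightarrow> prime_in S (C i)" "\<And>i. i < l \<Longrightarrow> C i \<subseteq> C (Suc i)"
    and x: "\<And>i. i < l \<Longrightarrow> x i \<in> C (Suc i) - C i"
    and c: "\<And>\<alpha>. \<alpha> \<in> F \<Longrightarrow> c \<alpha> \<in> S \<and> (\<exists>d\<in>S. c \<alpha> * d = 1)"
    and "k \<le> l" "finite F" "F \<noteq> {}"
    and inj: "\<And>\<alpha> \<beta>. \<alpha> \<in> F \<Longrightarrow> \<beta> \<in> F \<Longrightarrow> (\<And>i. k \<le> i \<Longrightarrow> i < l \<Longrightarrow> \<alpha> i = (\<beta> i :: nat)) \<Longrightarrow> \<alpha> = \<beta>"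
    and "(\<Sum>\<alpha>\<in>F. c \<alpha> * (\<Prod>i\<in>{k..<l}. x i ^ \<alpha> i)) \<in> C k"
  shows False
  using assms(6,5,7-)
proof (induction k arbitrary: F rule: inc_induct)
  case base
  have id: "ideal_in S (C l)" using C(1)[of l] by (simp add: prime_in_def)
  obtain \<alpha> where "\<alpha> \<in> F" using base.prems(3) by blast
  \<comment> \<open>At the top of the chain no index remains in which two exponents could differ, so
    \<open>F\<close> is a singleton; its coefficient, a unit, would lie in a proper ideal.\<close>
  moreover have "\<beta> = \<alpha>" if "\<beta> \<in> F" for \<beta> by (rule base.prems(4)) (use that \<open>\<alpha> \<in> F\<close> in auto)
  ultimately have "F = {\<alpha>}" by blast
  then have "c \<alpha> \<in> C l" using base by simp
  moreover obtain d where "d \<in> S" "c \<alpha> * d = 1" using base \<open>F = {\<alpha>}\<close> by blast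
  ultimately have "1 \<in> C l" using ideal_mult_right[OF id] by metis
  then have "S \<subseteq> C l" using ideal_mult_left[OF id] by (metis mult_1_right subsetI)
  then show False using C(1)[of l] ideal_subset[OF id] by (auto simp: prime_in_def)
next
  case (step k)
  have k: "k < l" using step by simp
  have idk: "ideal_in S (C k)" and idk': "ideal_in S (C (Suc k))"
    and pr: "\<And>a b. a \<in> S \<Longrightarrow> b \<in> S \<Longrightarrow> a * b \<in> C k \<Longrightarrow> a \<in> C k \<or> b \<in> C k"
    using C(1)[of k] C(1)[of "Suc k"] k by (auto simp: prime_in_def)
  have xS: "x i \<in> S" if "k \<le> i" "i < l" for i
  proof -
    have "ideal_in S (C (Suc i))" using C(1)[of "Suc i"] that by (simp add: prime_in_def)
    then show ?thesis using x[of i] that ideal_subset by blast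
  qed
  \<comment> \<open>Divide by the smallest power of \<open>x k\<close>, which is outside the prime
    \<open>C k\<close>. What remains is \<open>P + x k * R\<close> with \<open>P\<close> free of
    \<open>x k\<close>; since \<open>x k\<close> lies in \<open>C (Suc k)\<close>, so does
    \<open>P\<close>, a relation one step higher.\<close>
  define N where "N = Min ((\<lambda>\<alpha>. \<alpha> k) ` F)"
  have N: "N \<le> \<alpha> k" if "\<alpha> \<in> F" for \<alpha> using that step.prems by (simp add: N_def)
  define F0 where "F0 = {\<alpha>\<in>F. \<alpha> k = N}"
  have "N \<in> (\<lambda>\<alpha>. \<alpha> k) ` F" unfolding N_def using step.prems by (intro Min_in) auto
  then have F0: "F0 \<noteq> {}" "finite F0" "F0 \<subseteq> F" using step.prems by (auto simp: F0_def)
  define m where "m \<alpha> = c \<alpha> * (\<Prod>i\<in>{Suc k..<l}. x i ^ \<alpha> i)" for \<alpha>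
  have mS: "m \<alpha> \<in> S" if "\<alpha> \<in> F" for \<alpha>
    unfolding m_def using that step.prems(1) xS
    by (intro subring_mult[OF S] subring_prod[OF S] subring_power[OF S]) auto
  define P where "P = (\<Sum>\<alpha>\<in>F0. m \<alpha>)"
  define R where "R = (\<Sum>\<alpha>\<in>F-F0. x k ^ (\<alpha> k - N - 1) * m \<alpha>)"
  have PS: "P \<in> S" "R \<in> S"
    unfolding P_def R_def using F0 mS xS[of k] k
    by (auto intro!: subring_sum[OF S] subring_mult[OF S] subring_power[OF S])
  have split: "c \<alpha> * (\<Prod>i\<in>{k..<l}. x i ^ \<alpha> i) = x k ^ \<alpha> k * m \<alpha>" for \<alpha>
    using k by (simp add: m_def prod.atLeast_Suc_lessThan mult_ac)
  have "(\<Sum>\<alpha>\<in>F. c \<alpha> * (\<Prod>i\<in>{k..<l}. x i ^ \<alpha> i)) = (\<Sum>\<alpha>\<in>F0. x k ^ \<alpha> k * m \<alpha>) + (\<Sum>\<alpha>\<in>F-F0. x k ^ \<alpha> k * m \<alpha>)"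
    unfolding split using step.prems F0 by (simp add: sum.subset_diff[of F0 F] add.commute)
  also have "(\<Sum>\<alpha>\<in>F0. x k ^ \<alpha> k * m \<alpha>) = x k ^ N * P"
    unfolding P_def sum_distrib_left by (intro sum.cong) (auto simp: F0_def)
  also have "(\<Sum>\<alpha>\<in>F-F0. x k ^ \<alpha> k * m \<alpha>) = x k ^ N * (x k * R)"
    unfolding R_def sum_distrib_left
  proof (intro sum.cong refl)
    fix \<alpha> assume "\<alpha> \<in> F - F0"
    then have "N < \<alpha> k" using N[of \<alpha>] by (auto simp: F0_def)
    then have "\<alpha> k = N + (1 + (\<alpha> k - N - 1))" by simp
    then have "x k ^ \<alpha> k = x k ^ N * (x k * x k ^ (\<alpha> k - N - 1))"
      by (metis power_add power_one_right)
    then show "x k ^ \<alpha> k * m \<alpha> = x k ^ N * (x k * (x k ^ (\<alpha> k - N - 1) * m \<alpha>))"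
      by (simp add: mult.assoc)
  qed
  finally have "x k ^ N * (P + x k * R) \<in> C k" using step.prems by (simp add: distrib_left)
  moreover have "x k ^ N \<notin> C k" for N
  proof (induction N)
    case 0
    show ?case
    proof
      assume "x k ^ 0 \<in> C k"
      then have "S \<subseteq> C k" using ideal_mult_left[OF idk] by (metis mult_1_right power_0 subsetI)
      then show False using C(1)[of k] k ideal_subset[OF idk] by (auto simp: prime_in_def)
    qed
  next
    case (Suc N)
    then show ?case using pr[of "x k" "x k ^ N"] x[OF k] xS[of k] k subring_power[OF S] by auto
  qed
  ultimately have "P + x k * R \<in> C k"
    using pr[of "x k ^ N" "P + x k * R"] PS xS[of k] k
    by (auto intro: subring_power[OF S] subring_add[OF S] subring_mult[OF S])
  then have "P + x k * R \<in> C (Suc k)" using C(2)[OF k] by blast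
  moreover have "x k * R \<in> C (Suc k)" using ideal_mult_right[OF idk'] PS x[OF k] by blast
  ultimately have "P \<in> C (Suc k)" using ideal_diff[OF S idk', of "P + x k * R" "x k * R"] by simp
  show False
  proof (rule step.IH[of F0])
    show "(\<Sum>\<alpha>\<in>F0. c \<alpha> * (\<Prod>i\<in>{Suc k..<l}. x i ^ \<alpha> i)) \<in> C (Suc k)"
      using \<open>P \<in> C (Suc k)\<close> by (simp add: P_def m_def)
    fix \<alpha> \<beta> assume ab: "\<alpha> \<in> F0" "\<beta> \<in> F0" "\<And>i. Suc k \<le> i \<Longrightarrow> i < l \<Longrightarrow> \<alpha> i = \<beta> i"
    show "\<alpha> = \<beta>"
    proof (rule step.prems(4))
      fix i assume "k \<le> i" "i < l"
      then show "\<alpha> i = \<beta> i" using ab by (cases "i = k") (auto simp: F0_def)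
    qed (use ab F0 in auto)
  qed (use step.prems F0 in auto)
qed

section \<open>Lower bound: setting variables to 1\<close>

definition drop_vars :: "(nat \<times> nat) set \<Rightarrow> expo \<Rightarrow> expo" where
  "drop_vars S a = Poly_Mapping.mapp (\<lambda>v c. if v \<in> S then 0 else c) a"

lemma lookup_drop_vars: "lookup (drop_vars S a) v = (if v \<in> S then 0 else lookup a v)"
  by (simp add: drop_vars_def lookup_mapp when_def in_keys_iff)

text \<open>The ring endomorphism that sets the variables in \<open>S\<close> to 1, which on
  exponents means deleting the coordinates in \<open>S\<close>.\<close>

definition specialize :: "(nat \<times> nat) set \<Rightarrow> 'k::field laurent \<Rightarrow> 'k laurent" where
  "specialize S = laurent_kalg.lin (\<lambda>a. lmono (drop_vars S a))"

lemma specialize_mult: "specialize S (f * g) = specialize S f * specialize S g"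
  unfolding specialize_def
proof (rule laurent_kalg.lin_mult)
  fix a b :: expo
  have "drop_vars S (a + b) = drop_vars S a + drop_vars S b"
    by (rule poly_mapping_eqI) (simp add: lookup_drop_vars lookup_add)
  then show "lmono (drop_vars S (a + b)) = lmono (drop_vars S a) * (lmono (drop_vars S b) :: 'k::field laurent)"
    by (simp add: mult_single)
qed

lemma specialize_add: "specialize S (f + g) = specialize S f + specialize S g"
  and specialize_diff: "specialize S (f - g) = specialize S f - specialize S g"
  and specialize_sum: "specialize S (sum F A) = (\<Sum>a\<in>A. specialize S (F a))"
  and specialize_0 [simp]: "specialize S 0 = 0"
  and specialize_lmono [simp]: "specialize S (lmono a) = lmono (drop_vars S a)"
  unfolding specialize_def by (simp_all add: laurent_kalg.lin_add laurent_kalg.lin_diff laurent_kalg.lin_sum)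

lemma drop_vars_0 [simp]: "drop_vars S 0 = 0"
  by (rule poly_mapping_eqI) (simp add: lookup_drop_vars)

lemma specialize_const [simp]: "specialize S (single 0 c) = single 0 c"
  by (simp add: specialize_def laurent_sc_def mult_single)

lemma specialize_1 [simp]: "specialize S 1 = 1"
  using specialize_const[of S 1] by (simp del: specialize_const)

lemma specialize_specialize:
  assumes "S \<subseteq> S'" shows "specialize S' (specialize S f) = specialize S' f"
proof -
  have "drop_vars S' (drop_vars S a) = drop_vars S' a" for a
    by (rule poly_mapping_eqI) (use assms in \<open>auto simp: lookup_drop_vars\<close>)
  then have "specialize S' (laurent_sc c (lmono (drop_vars S a))) = laurent_sc c (lmono (drop_vars S' a) :: 'a laurent)" for c a
    by (simp add: laurent_sc_def specialize_mult)
  then have "specialize S' (\<Sum>a\<in>keys f. laurent_sc (lookup f a) (lmono (drop_vars S a)))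
      = (\<Sum>a\<in>keys f. laurent_sc (lookup f a) (lmono (drop_vars S' a)))"
    by (simp only: specialize_sum)
  then show ?thesis by (simp only: specialize_def laurent_kalg.lin_def)
qed

lemma drop_vars_single: "drop_vars S (single v c) = (if v \<in> S then 0 else single v c)"
  by (rule poly_mapping_eqI) (simp add: lookup_drop_vars lookup_single when_def)

lemma drop_vars_uminus: "drop_vars S (- a) = - drop_vars S a"
  by (rule poly_mapping_eqI) (simp add: lookup_drop_vars)

context quantum_matrices
begin

lemma specialize_u:
  "specialize S (u i j) = (if (i, j) \<in> S then 1 else u i j)"
  "specialize S (u' i j) = (if (i, j) \<in> S then 1 else u' i j)"
  by (simp_all add: u_def u'_def drop_vars_single drop_vars_uminus)

text \<open>Once all variables after \<open>(i, j)\<close> are 1, every path that does not turn at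
  \<open>(i, j)\<close> contributes 1, because all its turns lie after \<open>(i, j)\<close>. The
  claim for the columns beyond \<open>j\<close> is what the induction on the rows needs.\<close>

lemma specialize_px:
  assumes "1 \<le> i" "i \<le> r" "r \<le> n" "1 \<le> j"
    and S: "\<And>k l. (k, l) \<in> square n \<Longrightarrow> (k, l) \<in> S \<longleftrightarrow> (i, j) < (k, l)"
  shows "(\<forall>l\<in>{j..n}. l \<noteq> j \<longrightarrow> (\<exists>c. specialize S (px u u' r n i l) = single 0 c)) \<and>
    (j \<le> n \<longrightarrow> (\<exists>c. specialize S (px u u' r n i j) = u i j + single 0 c))"
  using assms(2,3)
proof (induction r)
  case (Suc r)
  have const_sum: "\<exists>c. (\<Sum>l\<in>A. f l) = (single 0 c :: 'k laurent)"
    if "\<And>l. l \<in> A \<Longrightarrow> \<exists>c. f l = single 0 c" for f and A :: "nat set"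
    using that
  proof (induction A rule: infinite_finite_induct)
    case (insert a A)
    then obtain c d where "f a = single 0 c" "(\<Sum>l\<in>A. f l) = single 0 d" by blast
    then show ?case using insert by (auto simp: single_add[symmetric])
  qed (auto intro: exI[of _ 0])
  show ?case
  proof (cases "i = Suc r")
    case True
    have "(i, j) \<notin> S" if "j \<le> n" using S[of i j] that assms(1,4) Suc.prems True by auto
    moreover have "(i, l) \<in> S" if "l \<in> {j..n}" "l \<noteq> j" for l
      using S[of i l] that assms(1,4) Suc.prems True by (auto simp: less_prod_def)
    ultimately show ?thesis
      using True by (auto simp: specialize_u intro: exI[of _ 0] exI[of _ 1])
  next
    case False
    then have i: "i \<le> r" using Suc.prems by simp
    have inS: "(Suc r, l) \<in> S" if "l \<in> {j..n}" for l
      using S[of "Suc r" l] that assms(1,4) Suc.prems i by (auto simp: less_prod_def)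
    have px: "specialize S (px u u' (Suc r) n i l) = (\<Sum>a\<in>{l..n}. specialize S (px u u' r n i a))" if "l \<in> {j..n}" for l
      using False that inS by (simp add: specialize_sum specialize_mult specialize_u)
    have IH: "\<exists>c. specialize S (px u u' r n i l) = single 0 c" if "l \<in> {Suc j..n}" for l
      using Suc.IH i Suc.prems that by auto
    have "\<exists>c. specialize S (px u u' (Suc r) n i j) = u i j + single 0 c" if j: "j \<le> n"
    proof -
      obtain c where "specialize S (px u u' r n i j) = u i j + single 0 c"
        using Suc.IH i Suc.prems j by auto
      moreover have "\<exists>d. (\<Sum>a\<in>{Suc j..n}. specialize S (px u u' r n i a)) = single 0 d"
        by (rule const_sum) (rule IH)
      then obtain d where "(\<Sum>a\<in>{Suc j..n}. specialize S (px u u' r n i a)) = single 0 d" ..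
      moreover have "{j..n} = insert j {Suc j..n}" using j by auto
      ultimately have "specialize S (px u u' (Suc r) n i j) = u i j + single 0 (c + d)"
        using px[of j] j by (simp add: single_add add.assoc)
      then show ?thesis by blast
    qed
    moreover have "\<exists>c. specialize S (px u u' (Suc r) n i l) = single 0 c" if "l \<in> {j..n}" "l \<noteq> j" for l
      unfolding px[OF that(1)] by (rule const_sum) (use IH that in auto)
    ultimately show ?thesis by blast
  qed
qed (use assms(1) in simp)

definition spec_kernel :: "(nat \<times> nat) set \<Rightarrow> 'k cpoly set" where
  "spec_kernel S = {f \<in> Tcar n m. specialize S (psi f) = 0}"

text \<open>It is the kernel of a unital homomorphism into a Laurent polynomial ring, which is a
  domain.\<close>

lemma prime_spec_kernel: "prime_in (Tcar n m) (spec_kernel S)"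
proof -
  have "(1 :: 'k cpoly) \<in> Tcar n m" "(1 :: 'k cpoly) \<notin> spec_kernel S"
    using subring_1[OF subring_Tcar] by (auto simp: spec_kernel_def)
  then have "spec_kernel S \<noteq> Tcar n m" by blast
  then show ?thesis
    unfolding prime_in_def ideal_in_def
    using subring_0[OF subring_Tcar] subring_add[OF subring_Tcar] subring_mult[OF subring_Tcar]
    by (auto simp: spec_kernel_def psi_add psi_mult specialize_add specialize_mult)
qed

lemma Iideal_spec_kernel: "n \<ge> 1 \<Longrightarrow> Iideal n m \<subseteq> spec_kernel S"
  using Iideal_psi ideal_subset[OF ideal_Iideal] by (auto simp: spec_kernel_def)

text \<open>After specialisation by \<open>S\<close>, the image of the variable \<open>Z\<close> at
  \<open>(i, j)\<close> is \<open>u i j\<close> plus a constant, so \<open>u i j\<close> can still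
  be set to 1 as a new condition.\<close>

lemma spec_kernel_step:
  assumes "(i, j) \<in> square n" "\<And>k l. (k, l) \<in> square n \<Longrightarrow> (k, l) \<in> S \<longleftrightarrow> (i, j) < (k, l)"
  shows "spec_kernel S \<subset> spec_kernel (insert (i, j) S)"
proof
  have ins: "specialize (insert (i, j) S) f = specialize (insert (i, j) S) (specialize S f)" for f :: "'k laurent"
    by (rule specialize_specialize[symmetric]) blast
  show "spec_kernel S \<subseteq> spec_kernel (insert (i, j) S)"
    unfolding spec_kernel_def by (auto, subst ins, simp)
  obtain c where c: "specialize S (psi (Var (ZV i j))) = u i j + single 0 c"
    using specialize_px[of i n j S] assms by auto
  \<comment> \<open>The constant is adjusted so that the image is \<open>u i j - 1\<close>: nonzero
    for \<open>S\<close>, zero once \<open>(i, j)\<close> is added.\<close>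
  let ?f = "Var (ZV i j) - single 0 (1 + c)"
  have f: "?f \<in> Tcar n m"
    using assms(1) by (intro subring_diff[OF subring_Tcar] Var_Tcar ZV_Tvars) auto
  have 1: "specialize S (psi ?f) = u i j - 1"
    unfolding psi_diff specialize_diff c by (simp add: single_add psi_add specialize_add)
  have "u i j \<noteq> 1"
  proof
    assume "u i j = 1"
    then have "lookup (u i j) (single (i, j) (int m)) = lookup 1 (single (i, j) (int m))"
      by simp
    moreover have "single (i, j) (int m) \<noteq> 0"
      using m_pos lookup_single_eq[of "(i, j)" "int m"] by (metis lookup_zero of_nat_0_less_iff less_irrefl)
    ultimately show False by (simp add: u_def lookup_one when_def)
  qed
  then have "?f \<notin> spec_kernel S" using 1 by (simp add: spec_kernel_def)
  moreover have "specialize (insert (i, j) S) (psi ?f) = 0"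
    unfolding ins[of "psi ?f"] 1 by (simp add: specialize_diff specialize_u)
  then have "?f \<in> spec_kernel (insert (i, j) S)" using f by (simp add: spec_kernel_def)
  ultimately show "spec_kernel S \<noteq> spec_kernel (insert (i, j) S)" by blast
qed

lemma krull_dim_lower:
  assumes "n \<ge> 1"
  shows "enat (n ^ 2) \<le> krull_dim_quot (Tcar n m) (Iideal n m :: 'k cpoly set)"
proof -
  define L where "L = sorted_list_of_set (square n)"
  have L: "set L = square n" "sorted_wrt (<) L" "length L = n ^ 2"
    by (simp_all add: L_def power2_eq_square)
  \<comment> \<open>\<open>C l\<close> sets the last \<open>l\<close> variables to 1. Largest first,
    since \<open>spec_kernel_step\<close> needs exactly the variables after \<open>(i, j)\<close> to
    be gone.\<close>
  define C where "C l = spec_kernel (set (drop (n ^ 2 - l) L))" for l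
  have "C l \<subset> C (Suc l)" if l: "l < n ^ 2" for l
  proof -
    define k where "k = n ^ 2 - Suc l"
    have k: "k < length L" "Suc k = n ^ 2 - l" using l L(3) by (auto simp: k_def)
    obtain i j where ij: "L ! k = (i, j)" by (cases "L ! k")
    have sq: "(i, j) \<in> square n" using k(1) ij L(1) nth_mem by metis
    have split: "L = take k L @ (i, j) # drop (Suc k) L"
      using k(1) ij by (metis id_take_nth_drop)
    have lt: "\<And>v. v \<in> set (drop (Suc k) L) \<Longrightarrow> (i, j) < v" "\<And>v. v \<in> set (take k L) \<Longrightarrow> v < (i, j)"
      using L(2) by (subst (asm) split, force simp: sorted_wrt_append)+
    have "v \<in> set (drop (Suc k) L) \<longleftrightarrow> (i, j) < v" if "v \<in> square n" for v
    proof -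
      have "v \<in> set (take k L) \<or> v = (i, j) \<or> v \<in> set (drop (Suc k) L)"
        using that L(1) split by (metis Un_iff set_ConsD set_append)
      then show ?thesis using lt by fastforce
    qed
    then have "spec_kernel (set (drop (Suc k) L)) \<subset> spec_kernel (insert (i, j) (set (drop (Suc k) L)))"
      using sq by (intro spec_kernel_step) auto
    moreover have "insert (i, j) (set (drop (Suc k) L)) = set (drop k L)"
      using k(1) ij by (metis Cons_nth_drop_Suc list.simps(15))
    ultimately show ?thesis by (simp add: C_def k(2)[symmetric]) (simp add: k_def)
  qed
  moreover have "\<forall>i\<le>n ^ 2. prime_in (Tcar n m) (C i) \<and> Iideal n m \<subseteq> C i"
    using prime_spec_kernel Iideal_spec_kernel[OF assms] by (simp add: C_def)
  ultimately show ?thesis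
    unfolding krull_dim_quot_def by (intro Sup_upper) blast
qed

text \<open>Choose one element from each step of a longer chain. A relation among their images under
  \<open>psi\<close> lifts to an element of the kernel, which is the ideal and lies in the bottom
  prime; \<open>prime_chain_no_relation\<close> excludes this.\<close>

lemma krull_dim_upper:
  assumes "n \<ge> 1"
  shows "krull_dim_quot (Tcar n m) (Iideal n m :: 'k cpoly set) \<le> enat (n ^ 2)"
  unfolding krull_dim_quot_def
proof (rule Sup_least)
  fix e assume "e \<in> {enat l |l. \<exists>C. (\<forall>i\<le>l. prime_in (Tcar n m) (C i) \<and> (Iideal n m :: 'k cpoly set) \<subseteq> C i) \<and> (\<forall>i<l. C i \<subset> C (Suc i))}"
  then obtain l and C :: "nat \<Rightarrow> 'k cpoly set" where e: "e = enat l"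
    and C: "\<And>i. i \<le> l \<Longrightarrow> prime_in (Tcar n m) (C i)" "\<And>i. i \<le> l \<Longrightarrow> Iideal n m \<subseteq> C i" "\<And>i. i < l \<Longrightarrow> C i \<subset> C (Suc i)"
    by blast
  have "l \<le> n ^ 2"
  proof (rule ccontr)
    let ?d = "Suc (n ^ 2)"
    assume "\<not> l \<le> n ^ 2"
    then have l: "?d \<le> l" by simp
    have "\<exists>y. i < ?d \<longrightarrow> y \<in> C (Suc i) - C i" for i using C(3)[of i] l by auto
    then obtain x0 where x0: "\<And>i. i < ?d \<Longrightarrow> x0 i \<in> C (Suc i) - C i" by metis
    define x where "x i = (if i < ?d then x0 i else 0)" for i
    have x: "x i \<in> C (Suc i) - C i" if "i < ?d" for i using x0[OF that] that by (simp add: x_def)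
    have xT: "x i \<in> Tcar n m" for i
    proof (cases "i < ?d")
      case True
      then have "ideal_in (Tcar n m) (C (Suc i))" using C(1)[of "Suc i"] l by (simp add: prime_in_def)
      then show ?thesis using x[OF True] ideal_subset by blast
    qed (use subring_0[OF subring_Tcar] in \<open>simp add: x_def\<close>)
    have "keys a \<subseteq> square n" if "a \<in> keys (psi (x i))" for i a
      using psi_central[OF xT[of i]] that by (auto simp: central_def rad_def)
    then obtain F and c :: "_ \<Rightarrow> 'k" where F: "finite F" "F \<noteq> {}" "F \<subseteq> extensional {0..<?d}" "\<forall>\<alpha>\<in>F. c \<alpha> \<noteq> 0"
      "(\<Sum>\<alpha>\<in>F. single 0 (c \<alpha>) * (\<Prod>i\<in>{0..<?d}. psi (x i) ^ \<alpha> i)) = 0"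
      using laurent_algebraic_dependence[of "\<lambda>i. psi (x i)" n] by blast
    define Q where "Q = (\<Sum>\<alpha>\<in>F. single 0 (c \<alpha>) * (\<Prod>i\<in>{0..<?d}. x i ^ \<alpha> i))"
    have "Q \<in> Tcar n m"
      unfolding Q_def using xT
      by (intro subring_sum[OF subring_Tcar] subring_mult[OF subring_Tcar] subring_prod[OF subring_Tcar]
          subring_power[OF subring_Tcar] const_Tcar)
    moreover have "psi Q = 0"
      using F(5) by (simp only: Q_def psi_sum psi_mult psi_prod psi_power psi_const)
    ultimately have Q: "Q \<in> C 0" using psi_eq_0_iff[of Q] assms C(2)[of 0] by blast
    show False
    proof (rule prime_chain_no_relation[OF subring_Tcar, where l = ?d and k = 0 and F = F and C = C and x = x
          and c = "\<lambda>\<alpha>. single 0 (c \<alpha>)"])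
      fix \<alpha> assume \<alpha>: "\<alpha> \<in> F"
      have "single 0 (c \<alpha>) * single 0 (inverse (c \<alpha>)) = (1 :: 'k cpoly)"
        using F(4) \<alpha> by (simp add: mult_single)
      then show "single 0 (c \<alpha>) \<in> Tcar n m \<and> (\<exists>d\<in>Tcar n m. single 0 (c \<alpha>) * d = (1 :: 'k cpoly))"
        using const_Tcar by blast
    next
      fix \<alpha> \<beta> assume ab: "\<alpha> \<in> F" "\<beta> \<in> F" "\<And>i. 0 \<le> i \<Longrightarrow> i < ?d \<Longrightarrow> \<alpha> i = \<beta> i"
      show "\<alpha> = \<beta>"
        by (rule extensionalityI[of _ "{0..<?d}"]) (use ab F(3) in auto)
    next
      show "(\<Sum>\<alpha>\<in>F. single 0 (c \<alpha>) * (\<Prod>i\<in>{0..<?d}. x i ^ \<alpha> i)) \<in> C 0"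
        using Q by (simp only: Q_def)
    qed (use C x l F in \<open>auto simp: psubset_imp_subset\<close>)
  qed
  then show "e \<le> enat (n ^ 2)" by (simp add: e)
qed

end

text \<open>\<open>phi\<close> takes values in the free algebra and multiplies monomials out in a
  fixed order, so it is a homomorphism modulo \<open>Jq\<close>. Read in this quotient, the
  conditions on \<open>phi\<close> describe a unital algebra map onto the centre with kernel
  \<open>Iideal n m\<close>.\<close>

theorem mainTheorem8:
  fixes q :: "'k::field_char_0" and n m :: nat
  assumes "alg_closed TYPE('k)"
    and "n \<ge> 2"
    and "root_of_unity_order q m" and "m \<ge> 3" and "odd m"
  shows "krull_dim_quot (Tcar n m) (Iideal n m :: 'k cpoly set) = enat (n ^ 2)
       \<and> quot_is_domain (Tcar n m) (Iideal n m :: 'k cpoly set)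
       \<and> (\<forall>p \<in> Tcar n m. phi n m q p \<in> centre_reps n q)
       \<and> phi n m q 1 - 1 \<in> Jq n q
       \<and> (\<forall>p \<in> Tcar n m. \<forall>p' \<in> Tcar n m.
            phi n m q (p + p') - (phi n m q p + phi n m q p') \<in> Jq n q
          \<and> phi n m q (p * p') - phi n m q p * phi n m q p' \<in> Jq n q)
       \<and> (\<forall>c. \<forall>p \<in> Tcar n m.
            phi n m q (Poly_Mapping.single 0 c * p) - fsc c * phi n m q p \<in> Jq n q)
       \<and> (\<forall>p \<in> Tcar n m. phi n m q p \<in> Jq n q \<longleftrightarrow> p \<in> Iideal n m)
       \<and> (\<forall>f \<in> centre_reps n q. \<exists>p \<in> Tcar n m. phi n m q p - f \<in> Jq n q)"
proof (intro conjI ballI allI)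
  interpret quantum_matrices q n m by standard (rule assms)+
  have n: "n \<ge> 1" using assms(2) by simp
  note R = subring_Tcar[of n m] and F = subring_Fcar[of n]
  \<comment> \<open>Each congruence modulo \<open>Jq\<close> below is checked by applying
    \<open>ev\<close>.\<close>
  have J: "f \<in> Jq n q" if "f \<in> Fcar n" "ev f = 0" for f
    using ev_eq_0_iff that by blast
  show "krull_dim_quot (Tcar n m) (Iideal n m :: 'k cpoly set) = enat (n ^ 2)"
    by (rule antisym[OF krull_dim_upper[OF n] krull_dim_lower[OF n]])
  show "quot_is_domain (Tcar n m) (Iideal n m :: 'k cpoly set)"
    unfolding quot_is_domain_def
  proof (intro conjI ballI impI)
    show "(1 :: 'k cpoly) \<notin> Iideal n m" using Iideal_psi[OF n, of 1] by auto
    fix a b assume ab: "a \<in> Tcar n m" "b \<in> Tcar n m" "a * b \<in> (Iideal n m :: 'k cpoly set)"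
    then have "psi a * psi b = 0" using Iideal_psi[OF n] by (simp add: psi_mult[symmetric])
    then show "a \<in> Iideal n m \<or> b \<in> Iideal n m" using psi_eq_0_iff n ab by auto
  qed
  show "phi n m q f \<in> centre_reps n q" if "f \<in> Tcar n m" for f
    using phi_centre that n by blast
  show "phi n m q 1 - 1 \<in> Jq n q"
    using subring_1[OF R] subring_1[OF F]
    by (intro J subring_diff[OF F] phi_Fcar) (simp_all add: ev_diff ev_phi[OF subring_1[OF R] n])
  fix f g :: "'k cpoly" and c assume f: "f \<in> Tcar n m"
  have cf: "single 0 c * f \<in> Tcar n m" by (intro subring_mult[OF R] f const_Tcar)
  have "telt (psi (single 0 c * f)) = lop_sc c (telt (psi f))"
    by (simp add: psi_mult telt_sc[symmetric] laurent_sc_def)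
  then show "phi n m q (single 0 c * f) - fsc c * phi n m q f \<in> Jq n q"
    by (intro J subring_diff[OF F] subring_mult[OF F] phi_Fcar cf f fsc_Fcar)
      (simp add: ev_diff ev_mult ev_phi[OF cf n] ev_phi[OF f n])
  show "phi n m q f \<in> Jq n q \<longleftrightarrow> f \<in> Iideal n m"
    using phi_Jq_iff[OF f n] psi_eq_0_iff[OF f n] by simp
  assume g: "g \<in> Tcar n m"
  have fg: "f + g \<in> Tcar n m" "f * g \<in> Tcar n m"
    by (rule subring_add[OF R f g], rule subring_mult[OF R f g])
  show "phi n m q (f + g) - (phi n m q f + phi n m q g) \<in> Jq n q"
    by (intro J subring_diff[OF F] subring_add[OF F] phi_Fcar f g fg)
      (simp add: ev_diff ev_add ev_phi[OF fg(1) n] ev_phi[OF f n] ev_phi[OF g n] psi_add telt_add)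
  show "phi n m q (f * g) - phi n m q f * phi n m q g \<in> Jq n q"
    by (intro J subring_diff[OF F] subring_mult[OF F] phi_Fcar f g fg)
      (simp add: ev_diff ev_mult ev_phi[OF fg(2) n] ev_phi[OF f n] ev_phi[OF g n] psi_mult telt_mult psi_central f g)
next
  interpret quantum_matrices q n m by standard (rule assms)+
  fix f assume "f \<in> centre_reps n q"
  then show "\<exists>P\<in>Tcar n m. phi n m q P - f \<in> Jq n q"
    using centre_surjective assms(2) by simp
qed

end
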